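(* Let $Q=\langle s,w_2\rangle\le\mathrm{M}(11,\mathbb{C})$ (so $Q\cong M_{11}$). Let $\mathcal{Q}^*$ be the set consisting of (a) all groups $\langle s,w_2,A\rangle$ with $A$ a finite subgroup of $\mathrm{D}(11,\mathbb{C})$ invariant under conjugation by $\mathrm{Sym}(11)$ and not contained in the scalar matrices, and (b) all groups $\langle s,w_2d_{n+1},A\rangle$ with $n\ge0$ and $A$ a finite subgroup of $\mathrm{D}(11,\mathbb{C})$ invariant under conjugation by $\mathrm{Sym}(11)$ such that $A\cap X_{\{2\}}=\Omega_nX_{\{2\}}$. Then $\mathcal{Q}^*$ is a classification of the finite irreducible subgroups of $\mathrm{M}(11,\mathbb{C})$ with permutation part $M_{11}$: each group in $\mathcal{Q}^*$ is such a group, each such group is $\mathrm{GL}(11,\mathbb{C})$-conjugate to a group in $\mathcal{Q}^*$, and distinct groups in $\mathcal{Q}^*$ are not $\mathrm{GL}(11,\mathbb{C})$-conjugate.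
   Context: $\mathrm{M}(11,\mathbb{C})$ is the group of monomial matrices, $\mathrm{D}(11,\mathbb{C})$ the invertible diagonal matrices; permutations $\alpha$ are identified with permutation matrices $[\delta_{i\alpha,j}]_{i,j}$. The permutation part of a monomial group is its image under $dt\mapsto t$. $s$ is the permutation matrix of $(1,2,\ldots,11)$ and $w_2$ that of $(1,3)(2,8)(4,7)(5,6)$. For $n\ge1$, $d_n=\mathrm{diag}(\epsilon_n,\epsilon_n^{-1},\epsilon_n^{-1},1,\epsilon_n^{-1},\epsilon_n,1,\epsilon_n,1,1,1)$ with $\epsilon_n=e^{\pi i/2^{n-1}}$. $X=\mathrm{SL}(11,\mathbb{C})\cap\mathrm{D}(11,\mathbb{C})$, $X_{\{2\}}$ is its subgroup of elements of $2$-power order, and $\Omega_nX_{\{2\}}=\{a\in X_{\{2\}}:a^{2^n}=1\}$. *)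

theory Defs
  imports "HOL-Analysis.Analysis"
begin

text \<open>Indices 1..11 of the paper are represented by the elements 0..10 of the
  numeral type 11 (paper index k+1 corresponds to element k). Matrices are
  of type complex^11^11; a permutation matrix of alpha has (i,j)-entry
  1 iff alpha i = j.\<close>

type_synonym cmat11 = "complex^11^11"
type_synonym perm11 = "11 \<Rightarrow> 11"

definition perm_mat :: "perm11 \<Rightarrow> cmat11" where
  "perm_mat \<alpha> = (\<chi> i j. if \<alpha> i = j then 1 else 0)"

definition matpow :: "cmat11 \<Rightarrow> nat \<Rightarrow> cmat11" where
  "matpow M k = (((**) M) ^^ k) (mat 1)"

text \<open>A (matrix) group: a set of invertible matrices containing the identity,
  closed under products and inverses.\<close>
definition mat_group :: "cmat11 set \<Rightarrow> bool" where
  "mat_group G \<longleftrightarrow> mat 1 \<in> G \<and> (\<forall>x\<in>G. \<forall>y\<in>G. x ** y \<in> G)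
     \<and> (\<forall>x\<in>G. invertible x \<and> matrix_inv x \<in> G)"

text \<open>Subgroup of GL(11,C) generated by a set of matrices.\<close>
definition gen_mat_group :: "cmat11 set \<Rightarrow> cmat11 set" where
  "gen_mat_group S = \<Inter> {G. mat_group G \<and> S \<subseteq> G}"

definition monomial :: "cmat11 \<Rightarrow> bool" where
  "monomial M \<longleftrightarrow> (\<forall>i. \<exists>!j. M $ i $ j \<noteq> 0) \<and> (\<forall>j. \<exists>!i. M $ i $ j \<noteq> 0)"

text \<open>Permutation part of a monomial matrix d t: the permutation of t.\<close>
definition perm_of :: "cmat11 \<Rightarrow> perm11" where
  "perm_of M = (\<lambda>i. THE j. M $ i $ j \<noteq> 0)"

definition perm_part :: "cmat11 set \<Rightarrow> perm11 set" where
  "perm_part G = perm_of ` G"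

definition diag_inv :: "cmat11 \<Rightarrow> bool" where
  "diag_inv M \<longleftrightarrow> (\<forall>i j. i \<noteq> j \<longrightarrow> M $ i $ j = 0) \<and> (\<forall>i. M $ i $ i \<noteq> 0)"

definition scalar_mat :: "cmat11 \<Rightarrow> bool" where
  "scalar_mat M \<longleftrightarrow> (\<exists>c. M = mat c)"

text \<open>Complex-linear subspaces of C^11 and irreducibility.\<close>
definition csubspace :: "(complex^11) set \<Rightarrow> bool" where
  "csubspace W \<longleftrightarrow> 0 \<in> W \<and> (\<forall>x\<in>W. \<forall>y\<in>W. x + y \<in> W) \<and> (\<forall>c. \<forall>x\<in>W. c *s x \<in> W)"

definition irreducible_mat_group :: "cmat11 set \<Rightarrow> bool" where
  "irreducible_mat_group G \<longleftrightarrow>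
     (\<forall>W. csubspace W \<and> (\<forall>g\<in>G. \<forall>v\<in>W. g *v v \<in> W) \<longrightarrow> W = {0} \<or> W = UNIV)"

text \<open>Permutation group generated by a set of permutations.\<close>
inductive_set gen_perm_group :: "perm11 set \<Rightarrow> perm11 set" for S where
  gp_id: "id \<in> gen_perm_group S"
| gp_gen: "\<alpha> \<in> S \<Longrightarrow> \<alpha> \<in> gen_perm_group S"
| gp_comp: "\<alpha> \<in> gen_perm_group S \<Longrightarrow> \<beta> \<in> gen_perm_group S \<Longrightarrow> \<alpha> \<circ> \<beta> \<in> gen_perm_group S"
| gp_inv: "\<alpha> \<in> gen_perm_group S \<Longrightarrow> inv \<alpha> \<in> gen_perm_group S"

text \<open>The 11-cycle (1,2,...,11) and (1,3)(2,8)(4,7)(5,6), shifted to 0-based indices.\<close>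
definition sigma11 :: perm11 where
  "sigma11 = (\<lambda>i. i + 1)"

definition tau11 :: perm11 where
  "tau11 = (\<lambda>i. if i = 0 then 2 else if i = 2 then 0
              else if i = 1 then 7 else if i = 7 then 1
              else if i = 3 then 6 else if i = 6 then 3
              else if i = 4 then 5 else if i = 5 then 4 else i)"

definition s_mat :: cmat11 where "s_mat = perm_mat sigma11"
definition w2_mat :: cmat11 where "w2_mat = perm_mat tau11"

text \<open>M_11 as the permutation group generated by s and w_2.\<close>
definition M11 :: "perm11 set" where
  "M11 = gen_perm_group {sigma11, tau11}"

definition perm_group_iso :: "perm11 set \<Rightarrow> perm11 set \<Rightarrow> bool" where
  "perm_group_iso P R \<longleftrightarrow> (\<exists>f. bij_betw f P R \<and> (\<forall>x\<in>P. \<forall>y\<in>P. f (x \<circ> y) = f x \<circ> f y))"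

definition eps :: "nat \<Rightarrow> complex" where
  "eps n = exp (complex_of_real pi * \<i> / 2 ^ (n - 1))"

definition d_mat :: "nat \<Rightarrow> cmat11" where
  "d_mat n = (\<chi> i j. if i = j then
       (if i = 0 \<or> i = 5 \<or> i = 7 then eps n
        else if i = 1 \<or> i = 2 \<or> i = 4 then inverse (eps n) else 1)
     else 0)"

definition X_grp :: "cmat11 set" where
  "X_grp = {M. diag_inv M \<and> det M = 1}"

definition X2 :: "cmat11 set" where
  "X2 = {M \<in> X_grp. \<exists>k. matpow M (2 ^ k) = mat 1}"

definition Omega :: "nat \<Rightarrow> cmat11 set" where
  "Omega n = {a \<in> X2. matpow a (2 ^ n) = mat 1}"

text \<open>Finite subgroups of D(11,C) invariant under conjugation by Sym(11).\<close>
definition sym_inv_diag :: "cmat11 set \<Rightarrow> bool" where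
  "sym_inv_diag A \<longleftrightarrow> mat_group A \<and> finite A \<and> A \<subseteq> Collect diag_inv
     \<and> (\<forall>\<alpha>. bij \<alpha> \<longrightarrow> (\<forall>a\<in>A. perm_mat \<alpha> ** a ** perm_mat (inv \<alpha>) \<in> A))"

definition Qstar :: "cmat11 set set" where
  "Qstar =
     {gen_mat_group ({s_mat, w2_mat} \<union> A) | A. sym_inv_diag A \<and> \<not> (A \<subseteq> Collect scalar_mat)}
   \<union> {gen_mat_group ({s_mat, w2_mat ** d_mat (n + 1)} \<union> A) | n A.
        sym_inv_diag A \<and> A \<inter> X2 = Omega n}"

text \<open>Finite irreducible subgroups of M(11,C) with permutation part M_11.\<close>
definition target_group :: "cmat11 set \<Rightarrow> bool" where
  "target_group G \<longleftrightarrow> mat_group G \<and> G \<subseteq> Collect monomial \<and> finite G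
     \<and> irreducible_mat_group G \<and> perm_group_iso (perm_part G) M11"

definition GL_conj :: "cmat11 set \<Rightarrow> cmat11 set \<Rightarrow> bool" where
  "GL_conj G H \<longleftrightarrow> (\<exists>g. invertible g \<and> H = (\<lambda>h. g ** h ** matrix_inv g) ` G)"

end

theory Submission
  imports Defs
begin

text \<open>Write $A$ for the diagonal part of a group $G$ with permutation part $M_{11}$. Since $M_{11}$ is
  sharply 4-transitive, the regular subgroups of the stabilisers of two and of three points give, from
  $a \in A$, the element of $A$ with entries $a_0/a_1$, $a_1/a_0$ and otherwise 1. If these ratios form the
  group of $N$-th roots of unity, then $X[N] \le A \le Z\,D[N]$ with $Z$ the scalars, so $A$ is invariant
  under $\mathrm{Sym}(11)$ and $g \mapsto g^N$ turns $G$ into a monomial lift of $M_{11}$ modulo scalars.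
  After diagonal conjugation such a lift contains $s$ and the multiplier $u : i \mapsto 3i$; then an element
  normalising $\langle u \rangle$ has only two possible coefficient vectors, which belong to
  $\langle s, w_2\rangle$ and $\langle s, w_2 d_1\rangle$. The latter meets the diagonal matrices
  trivially because it permutes the twelve columns of a Hadamard matrix. Finally, $A$ contains every
  abelian normal subgroup of $G$, so a conjugation between two groups in the list preserves $A$ and, if $A$ is not
  scalar, is monomial.\<close>

subsection \<open>The index type and monomial matrices\<close>

text \<open>The power map acts entrywise on coefficients. It makes lifts unique up to scalars but
  forgets factors in $D[N]$, so a normal form of the powers has to be lifted back. For the sign
  vector of $w_2d_1$ this needs an entrywise $N$-th root: if $N = 2^n m$ with $m$ odd, the
  coefficient vector of $w_2d_{n+1}$ is one, which is where $d_{n+1}$ comes from and why $n$ is tied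
  to the 2-part of $A$. Each generator then still carries an unknown factor from $D[N]$. No
  presentation of $M_{11}$ is required. Uniqueness arguments use a handful of relations, each
  verified on eleven points. That the listed groups have no unwanted diagonal elements is shown by
  invariants of the generators: the Hadamard columns, the exponent and the product of the
  coefficients.\<close>

lemma UNIV_11: "(UNIV::11 set) = {0,1,2,3,4,5,6,7,8,9,10}"
proof -
  have "card {0,1,2,3,4,5,6,7,8,9,10::11} = 11" by simp
  then show ?thesis using card_subset_eq[of "UNIV::11 set" "{0,1,2,3,4,5,6,7,8,9,10::11}"] by simp
qed

lemma all_11: "(\<forall>i::11. P i) \<longleftrightarrow> P 0 \<and> P 1 \<and> P 2 \<and> P 3 \<and> P 4 \<and> P 5 \<and> P 6 \<and> P 7 \<and> P 8 \<and> P 9 \<and> P 10"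
proof -
  have "(\<forall>i::11. P i) \<longleftrightarrow> (\<forall>i\<in>UNIV. P i)" by simp
  then show ?thesis unfolding UNIV_11 by simp
qed

lemma prod_11: "(\<Prod>i\<in>UNIV. f (i::11)) = f 0 * f 1 * f 2 * f 3 * f 4 * f 5 * f 6 * f 7 * f 8 * f 9 * (f 10 :: 'a::comm_monoid_mult)"
  unfolding UNIV_11 by (simp add: mult.assoc)

lemma sum_11: "(\<Sum>i\<in>UNIV. f (i::11)) = f 0 + f 1 + f 2 + f 3 + f 4 + f 5 + f 6 + f 7 + f 8 + f 9 + (f 10 :: 'a::comm_monoid_add)"
  unfolding UNIV_11 by (simp add: add.assoc)

lemma cyclic_induct:
  fixes i j :: 11
  assumes "P i" "\<And>i. P i \<Longrightarrow> P (i + 1)"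
  shows "P j"
proof -
  have "P (i + of_nat n)" for n
  proof (induction n)
    case (Suc n)
    from assms(2)[OF this] show ?case by (simp add: add_ac)
  qed (simp add: assms)
  moreover have "\<forall>c::11. \<exists>n. c = of_nat n"
    unfolding all_11 by (metis of_nat_0 of_nat_1 of_nat_numeral)
  then obtain n where "j - i = of_nat n" by blast
  ultimately show ?thesis by (metis add_diff_cancel_left' diff_add_cancel add.commute)
qed

lemma cyclic_induct_down:
  fixes i j :: 11
  assumes "P i" "\<And>i. P i \<Longrightarrow> P (i - 1)"
  shows "P j"
  using cyclic_induct[of "\<lambda>i. P (- i)" "- i" "- j"] assms by simp

lemma shift_invariant_const:
  fixes f :: "11 \<Rightarrow> 'a"
  assumes "\<And>i. f (i + 1) = f i"
  shows "f i = f 0"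
  by (rule cyclic_induct[of _ 0]) (simp_all add: assms)

text \<open>Coefficients may vanish and \<open>t\<close> may be any function, so that
  \<open>mon_mult\<close> rewrites without side conditions; nonvanishing and bijectivity are added
  where inverses or uniqueness matter.\<close>

definition mon :: "(11 \<Rightarrow> complex) \<Rightarrow> perm11 \<Rightarrow> cmat11" where
  "mon d t = (\<chi> i j. if t i = j then d i else 0)"

lemma mon_nth [simp]: "mon d t $ i $ j = (if t i = j then d i else 0)"
  by (simp add: mon_def)

lemma mon_mult: "mon d t ** mon e r = mon (\<lambda>i. d i * e (t i)) (\<lambda>i. r (t i))"
  by (simp add: vec_eq_iff matrix_matrix_mult_def if_distrib[of "\<lambda>x. x * _"] cong: if_cong)

lemma mon_mult_vec: "(mon d t *v x) $ i = d i * x $ (t i)"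
  by (simp add: matrix_vector_mult_def if_distrib[of "\<lambda>x. x * _"] cong: if_cong)

lemma mat_eq_mon: "mat c = mon (\<lambda>_. c) (\<lambda>i. i)"
  by (simp add: vec_eq_iff mat_def)

lemma perm_mat_eq_mon: "perm_mat t = mon (\<lambda>_. 1) t"
  by (simp add: vec_eq_iff perm_mat_def)

lemma mon_eq_iff:
  assumes "\<And>i. d i \<noteq> 0"
  shows "mon d t = mon e r \<longleftrightarrow> d = e \<and> t = r"
proof
  assume h: "mon d t = mon e r"
  have "d i = (if r i = t i then e i else 0)" for i
    using arg_cong[OF h, of "\<lambda>M. M $ i $ t i"] by simp
  then show "d = e \<and> t = r" using assms by (metis ext)
qed simp

lemma perm_of_mon: "(\<And>i. d i \<noteq> 0) \<Longrightarrow> perm_of (mon d t) = t"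
  by (auto simp: perm_of_def fun_eq_iff)

lemma monomial_mon: "(\<And>i. d i \<noteq> 0) \<Longrightarrow> bij t \<Longrightarrow> monomial (mon d t)"
  unfolding monomial_def by (auto simp: bij_iff)

lemma monomialE:
  assumes "monomial M"
  obtains d t where "M = mon d t" "\<And>i. d i \<noteq> 0" "bij t"
proof -
  define t where "t = perm_of M"
  define d where "d i = M $ i $ t i" for i
  have ex: "\<exists>!j. M $ i $ j \<noteq> 0" for i using assms unfolding monomial_def by blast
  have nz: "d i \<noteq> 0" for i
    using theI'[OF ex[of i]] by (simp add: d_def t_def perm_of_def)
  have M: "M = mon d t"
    unfolding vec_eq_iff using ex nz by (simp add: d_def) metis
  have "\<exists>!i. t i = j" for j
  proof -
    have "\<exists>!i. M $ i $ j \<noteq> 0" using assms unfolding monomial_def by blast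
    then obtain i where "M $ i $ j \<noteq> 0" "\<And>k. M $ k $ j \<noteq> 0 \<Longrightarrow> k = i" by blast
    then have "t i = j" "\<And>k. t k = j \<Longrightarrow> k = i" unfolding M mon_nth using nz by metis+
    then show ?thesis by blast
  qed
  then have "bij t" by (simp add: bij_iff)
  with M nz show thesis using that by blast
qed

lemma mon_inverse:
  assumes "\<And>i. d i \<noteq> 0" "bij t"
  shows "mon d t ** mon (\<lambda>i. inverse (d (inv t i))) (inv t) = mat 1"
    "mon (\<lambda>i. inverse (d (inv t i))) (inv t) ** mon d t = mat 1"
  using assms by (simp_all add: mon_mult mat_eq_mon bij_is_inj bij_is_surj surj_f_inv_f)

lemma invertible_mon: "(\<And>i. d i \<noteq> 0) \<Longrightarrow> bij t \<Longrightarrow> invertible (mon d t)"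
  unfolding invertible_def using mon_inverse by blast

lemma matrix_inv_invertible:
  fixes A :: "'a::field^'n^'n"
  assumes "invertible A" shows "A ** matrix_inv A = mat 1" "matrix_inv A ** A = mat 1"
  using someI_ex[OF assms[unfolded invertible_def]] unfolding matrix_inv_def by simp_all

lemma matrix_inv_unique_right:
  fixes A :: "'a::field^'n^'n"
  assumes "A ** B = mat 1" shows "matrix_inv A = B"
proof -
  have "B ** A = mat 1" using assms matrix_left_right_inverse by blast
  then have "invertible A" using assms unfolding invertible_def by blast
  then have inv: "matrix_inv A ** A = mat 1" by (rule matrix_inv_invertible)
  have "matrix_inv A = matrix_inv A ** (A ** B)" by (simp add: assms)
  also have "\<dots> = B" by (simp add: matrix_mul_assoc inv)
  finally show ?thesis .
qed

lemma matrix_inv_mon: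
  assumes "\<And>i. d i \<noteq> 0" "bij t"
  shows "matrix_inv (mon d t) = mon (\<lambda>i. inverse (d (inv t i))) (inv t)"
  by (rule matrix_inv_unique_right, rule mon_inverse[OF assms])

lemma diag_inv_iff: "diag_inv M \<longleftrightarrow> (\<exists>d. M = mon d (\<lambda>i. i) \<and> (\<forall>i. d i \<noteq> 0))"
proof
  assume h: "diag_inv M"
  have "M = mon (\<lambda>i. M $ i $ i) (\<lambda>i. i)"
    using h unfolding vec_eq_iff diag_inv_def mon_nth by metis
  then show "\<exists>d. M = mon d (\<lambda>i. i) \<and> (\<forall>i. d i \<noteq> 0)" using h unfolding diag_inv_def by blast
qed (auto simp: diag_inv_def)

lemma scalar_mat_mon: "scalar_mat (mon d (\<lambda>i. i)) \<longleftrightarrow> (\<forall>i j. d i = d j)"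
proof
  assume "scalar_mat (mon d (\<lambda>i. i))"
  then obtain c where c: "mon d (\<lambda>i. i) = mat c" unfolding scalar_mat_def by blast
  have "d i = c" for i using arg_cong[OF c, of "\<lambda>M. M $ i $ i"] by (simp add: mat_def)
  then show "\<forall>i j. d i = d j" by simp
next
  assume h: "\<forall>i j. d i = d j"
  then have "d = (\<lambda>_. d 0)" by auto
  then show "scalar_mat (mon d (\<lambda>i. i))" unfolding scalar_mat_def mat_eq_mon by metis
qed

lemma det_mon_diag: "det (mon d (\<lambda>i. i)) = (\<Prod>i\<in>UNIV. d i)"
  by (subst det_diagonal) auto

lemma mon_power: "matpow (mon d (\<lambda>i. i)) k = mon (\<lambda>i. d i ^ k) (\<lambda>i. i)"
  by (induction k) (simp_all add: matpow_def mat_eq_mon mon_mult)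

subsection \<open>Groups of monomial matrices\<close>

lemma mat_groupD:
  assumes "mat_group G"
  shows "mat 1 \<in> G" "x \<in> G \<Longrightarrow> y \<in> G \<Longrightarrow> x ** y \<in> G" "x \<in> G \<Longrightarrow> invertible x"
    "x \<in> G \<Longrightarrow> matrix_inv x \<in> G"
  using assms unfolding mat_group_def by blast+

lemma mon_mult_in: "mat_group G \<Longrightarrow> mon d t \<in> G \<Longrightarrow> mon e r \<in> G \<Longrightarrow> mon (\<lambda>i. d i * e (t i)) (\<lambda>i. r (t i)) \<in> G"
  using mat_groupD(2) mon_mult by metis

text \<open>A singular generator would leave \<open>gen_mat_group\<close> intersecting an empty
  family. Invertible generators lie in the full linear group, and that member bounds the
  intersection.\<close>

lemma mat_group_gen:
  assumes "\<And>x. x \<in> S \<Longrightarrow> invertible x"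
  shows "mat_group (gen_mat_group S)"
proof -
  have inv: "invertible x" if "x \<in> gen_mat_group S" for x
  proof -
    have i1: "invertible (matrix_inv y)" if "invertible y" for y :: cmat11
      using matrix_inv_invertible[OF that] unfolding invertible_def by blast
    have "invertible (mat 1 :: cmat11)" unfolding invertible_def by (intro exI[of _ "mat 1"]) simp
    then have "mat_group {x. invertible x}"
      unfolding mat_group_def using i1 invertible_mult by auto
    then show ?thesis using that assms unfolding gen_mat_group_def by blast
  qed
  show ?thesis
    unfolding mat_group_def using inv by (auto simp: gen_mat_group_def mat_groupD)
qed

lemma gen_mat_group_incl: "S \<subseteq> gen_mat_group S"
  unfolding gen_mat_group_def by blast

lemma gen_mat_group_least: "mat_group G \<Longrightarrow> S \<subseteq> G \<Longrightarrow> gen_mat_group S \<subseteq> G"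
  unfolding gen_mat_group_def by blast

text \<open>The device for bounding generated groups: choose a property \<Phi> of coefficients and
  permutation that the generators have and that passes to products and inverses.\<close>

lemma mat_group_mon:
  assumes "\<Phi> (\<lambda>_. 1) (\<lambda>i. i)"
    and nz: "\<And>d t. \<Phi> d t \<Longrightarrow> (\<forall>i. d i \<noteq> 0) \<and> bij t"
    and "\<And>d t e r. \<Phi> d t \<Longrightarrow> \<Phi> e r \<Longrightarrow> \<Phi> (\<lambda>i. d i * e (t i)) (\<lambda>i. r (t i))"
    and "\<And>d t. \<Phi> d t \<Longrightarrow> \<Phi> (\<lambda>i. inverse (d (inv t i))) (inv t)"
  shows "mat_group {mon d t | d t. \<Phi> d t}"
  unfolding mat_group_def
proof (intro conjI ballI)
  show "mat 1 \<in> {mon d t | d t. \<Phi> d t}" using assms(1) mat_eq_mon by blast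
next
  fix x y assume "x \<in> {mon d t | d t. \<Phi> d t}" "y \<in> {mon d t | d t. \<Phi> d t}"
  then obtain d t e r where "x = mon d t" "\<Phi> d t" "y = mon e r" "\<Phi> e r" by blast
  then show "x ** y \<in> {mon d t | d t. \<Phi> d t}" using assms(3)[of d t e r] mon_mult[of d t e r] by auto
next
  fix x assume "x \<in> {mon d t | d t. \<Phi> d t}"
  then show "invertible x" using invertible_mon nz by auto
next
  fix x assume "x \<in> {mon d t | d t. \<Phi> d t}"
  then show "matrix_inv x \<in> {mon d t | d t. \<Phi> d t}" using assms(4) nz matrix_inv_mon by force
qed

text \<open>Words are read from left to right, so that the letter acting first comes first: by \<open>mon_mult\<close>,
  the product of two monomial matrices composes their permutations in this order.\<close>
primrec word_perm :: "(nat \<Rightarrow> perm11) \<Rightarrow> nat list \<Rightarrow> perm11" where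
  "word_perm T [] = (\<lambda>i. i)"
| "word_perm T (l # w) = (\<lambda>i. word_perm T w (T l i))"

primrec word_coeff :: "(nat \<Rightarrow> 11 \<Rightarrow> complex) \<Rightarrow> (nat \<Rightarrow> perm11) \<Rightarrow> nat list \<Rightarrow> 11 \<Rightarrow> complex" where
  "word_coeff D T [] = (\<lambda>i. 1)"
| "word_coeff D T (l # w) = (\<lambda>i. D l i * word_coeff D T w (T l i))"

lemma word_in_group:
  assumes "mat_group G" "\<And>l. l \<in> set w \<Longrightarrow> mon (D l) (T l) \<in> G"
  shows "mon (word_coeff D T w) (word_perm T w) \<in> G"
  using assms(2)
proof (induction w)
  case Nil
  then show ?case using mat_groupD(1)[OF assms(1)] by (simp add: mat_eq_mon)
next
  case (Cons l w)
  then show ?case using mon_mult_in[OF assms(1)] by simp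
qed

subsection \<open>The permutation group $M_{11}$\<close>

lemma sigma11_simps [simp]:
  "sigma11 0 = 1" "sigma11 1 = 2" "sigma11 2 = 3" "sigma11 3 = 4" "sigma11 4 = 5" "sigma11 5 = 6" "sigma11 6 = 7" "sigma11 7 = 8" "sigma11 8 = 9" "sigma11 9 = 10" "sigma11 10 = 0"
  by (simp_all add: sigma11_def)

lemma tau11_simps [simp]:
  "tau11 0 = 2" "tau11 1 = 7" "tau11 2 = 0" "tau11 3 = 6" "tau11 4 = 5" "tau11 5 = 4" "tau11 6 = 3" "tau11 7 = 1" "tau11 8 = 8" "tau11 9 = 9" "tau11 10 = 10"
  by (simp_all add: tau11_def)

lemma bij_sigma11: "bij sigma11"
  unfolding sigma11_def by (rule bij_plus_right)

lemma tau11_involution: "tau11 (tau11 i) = i"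
proof -
  have "\<forall>i. tau11 (tau11 i) = i" unfolding all_11 by simp
  then show ?thesis by blast
qed

lemma bij_tau11: "bij tau11"
  by (rule o_bij[of tau11]) (auto simp: tau11_involution)

lemma M11_id: "(\<lambda>i. i) \<in> M11"
  using gp_id unfolding M11_def id_def .

lemma M11_gens: "sigma11 \<in> M11" "tau11 \<in> M11"
  unfolding M11_def by (auto intro: gp_gen)

lemma M11_comp: "p \<in> M11 \<Longrightarrow> q \<in> M11 \<Longrightarrow> (\<lambda>i. p (q i)) \<in> M11"
  using gp_comp[of p _ q] unfolding M11_def comp_def by blast

lemma M11_inv: "p \<in> M11 \<Longrightarrow> inv p \<in> M11"
  unfolding M11_def by (rule gp_inv)

lemma M11_least:
  assumes "p \<in> M11" "(\<lambda>i. i) \<in> P" "sigma11 \<in> P" "tau11 \<in> P"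
    and "\<And>p q. p \<in> P \<Longrightarrow> q \<in> P \<Longrightarrow> (\<lambda>i. p (q i)) \<in> P"
    and "\<And>p. p \<in> P \<Longrightarrow> inv p \<in> P"
  shows "p \<in> P"
  using assms(1) unfolding M11_def
proof induction
  case (gp_comp p q)
  then show ?case using assms(5) by (simp add: comp_def)
qed (use assms in \<open>auto simp: id_def\<close>)

lemma M11_bij: "p \<in> M11 \<Longrightarrow> bij p"
  using M11_least[of p "Collect bij"] bij_sigma11 bij_tau11
  by (simp add: bij_imp_bij_inv bij_comp[unfolded comp_def] bij_id[unfolded id_def])

text \<open>Defining permutations by words makes membership in \<open>M11\<close> immediate, and the
  same word later computes the coefficients of a lift, as in \<open>nu11_lift\<close>.\<close>

definition gen_letter :: "nat \<Rightarrow> perm11" where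
  "gen_letter l = (if l = 0 then sigma11 else tau11)"

lemma word_in_M11: "word_perm gen_letter w \<in> M11"
proof (induction w)
  case Nil
  then show ?case by (simp add: M11_id)
next
  case (Cons l w)
  have "gen_letter l \<in> M11" using M11_gens by (simp add: gen_letter_def)
  then show ?case using M11_comp[OF Cons] by simp
qed

text \<open>\<open>mu11\<close> is multiplication by 3 and \<open>nu11\<close> has order 4 and normalises it. \<open>kap11\<close> and \<open>lam11\<close>
  generate the elementary abelian group of order 9 fixing 0 and 1, and \<open>nu11\<close> and \<open>rho11\<close> the quaternion
  group fixing 0, 1 and 7; both act regularly on the remaining points.\<close>
definition mu11 :: perm11 where "mu11 = word_perm gen_letter [1,0,1,0,0,0,1,0,0,0,0,1]"

lemma mu11_simps [simp]:
  "mu11 0 = 0" "mu11 1 = 3" "mu11 2 = 6" "mu11 3 = 9" "mu11 4 = 1" "mu11 5 = 4" "mu11 6 = 7" "mu11 7 = 10" "mu11 8 = 2" "mu11 9 = 5" "mu11 10 = 8"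
  by (simp_all add: mu11_def gen_letter_def)

definition nu11 :: perm11 where "nu11 = word_perm gen_letter [0,0,0,1,0,0,1,0,0,1,0,0,1,0,0,1,0,0]"

lemma nu11_simps [simp]:
  "nu11 0 = 0" "nu11 1 = 1" "nu11 2 = 6" "nu11 3 = 5" "nu11 4 = 9" "nu11 5 = 4" "nu11 6 = 8" "nu11 7 = 7" "nu11 8 = 10" "nu11 9 = 3" "nu11 10 = 2"
  by (simp_all add: nu11_def gen_letter_def)

definition kap11 :: perm11 where "kap11 = word_perm gen_letter [0,0,0,0,0,0,0,0,1,0,1,0,0]"

lemma kap11_simps [simp]:
  "kap11 0 = 0" "kap11 1 = 1" "kap11 2 = 4" "kap11 3 = 8" "kap11 4 = 10" "kap11 5 = 9" "kap11 6 = 3" "kap11 7 = 5" "kap11 8 = 6" "kap11 9 = 7" "kap11 10 = 2"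
  by (simp_all add: kap11_def gen_letter_def)

definition lam11 :: perm11 where "lam11 = word_perm gen_letter [1,0,0,1,0,1,0,0,0,0,1,0,1]"

lemma lam11_simps [simp]:
  "lam11 0 = 0" "lam11 1 = 1" "lam11 2 = 6" "lam11 3 = 7" "lam11 4 = 3" "lam11 5 = 10" "lam11 6 = 9" "lam11 7 = 4" "lam11 8 = 5" "lam11 9 = 2" "lam11 10 = 8"
  by (simp_all add: lam11_def gen_letter_def)

definition rho11 :: perm11 where "rho11 = word_perm gen_letter [1,0,0,0,0,0,0,1,0,0,1,0]"

lemma rho11_simps [simp]:
  "rho11 0 = 0" "rho11 1 = 1" "rho11 2 = 5" "rho11 3 = 10" "rho11 4 = 6" "rho11 5 = 8" "rho11 6 = 3" "rho11 7 = 7" "rho11 8 = 9" "rho11 9 = 2" "rho11 10 = 4"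
  by (simp_all add: rho11_def gen_letter_def)

text \<open>An involution exchanging 0 and 1 and fixing 7, the point singled out by the quaternion
  group.\<close>

definition swap11 :: perm11 where "swap11 = word_perm gen_letter [0,0,0,0,1,0,0,0,0,1,0,1,0,0]"

lemma swap11_simps [simp]:
  "swap11 0 = 1" "swap11 1 = 0" "swap11 2 = 2" "swap11 3 = 6" "swap11 4 = 10" "swap11 5 = 9" "swap11 6 = 3" "swap11 7 = 7" "swap11 8 = 8" "swap11 9 = 5" "swap11 10 = 4"
  by (simp_all add: swap11_def gen_letter_def)

lemma special_in_M11: "mu11 \<in> M11" "nu11 \<in> M11" "kap11 \<in> M11" "lam11 \<in> M11" "rho11 \<in> M11" "swap11 \<in> M11"
  unfolding mu11_def nu11_def kap11_def lam11_def rho11_def swap11_def by (rule word_in_M11)+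

lemma M11_stab_transitive:
  assumes "j \<noteq> 0" shows "\<exists>m\<in>M11. m 0 = 0 \<and> m 1 = j"
proof -
  have "\<exists>m\<in>M11. m 0 = (0::11) \<and> m 1 = (1::11)" using M11_id by force
  moreover
  have "\<exists>m\<in>M11. m 0 = 0 \<and> m 1 = 2"
    by (rule bexI[OF _ word_in_M11[of "[0,1,0,0,1,0,0]"]]) (simp_all add: gen_letter_def)
  moreover
  have "\<exists>m\<in>M11. m 0 = 0 \<and> m 1 = 3"
    by (rule bexI[OF _ word_in_M11[of "[0,1,0,0,0,0,0,0,1]"]]) (simp_all add: gen_letter_def)
  moreover
  have "\<exists>m\<in>M11. m 0 = 0 \<and> m 1 = 4"
    by (rule bexI[OF _ word_in_M11[of "[0,1,0,0,0,0]"]]) (simp_all add: gen_letter_def)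
  moreover
  have "\<exists>m\<in>M11. m 0 = 0 \<and> m 1 = 5"
    by (rule bexI[OF _ word_in_M11[of "[0,0,0,1,0,1,0,1]"]]) (simp_all add: gen_letter_def)
  moreover
  have "\<exists>m\<in>M11. m 0 = 0 \<and> m 1 = 6"
    by (rule bexI[OF _ word_in_M11[of "[0,0,1]"]]) (simp_all add: gen_letter_def)
  moreover
  have "\<exists>m\<in>M11. m 0 = 0 \<and> m 1 = 7"
    by (rule bexI[OF _ word_in_M11[of "[0,1,0,0,0,1,0]"]]) (simp_all add: gen_letter_def)
  moreover
  have "\<exists>m\<in>M11. m 0 = 0 \<and> m 1 = 8"
    by (rule bexI[OF _ word_in_M11[of "[0,0,1,0,0,1]"]]) (simp_all add: gen_letter_def)
  moreover
  have "\<exists>m\<in>M11. m 0 = 0 \<and> m 1 = 9"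
    by (rule bexI[OF _ word_in_M11[of "[0,0,0,0,0,0,0,1,0,1]"]]) (simp_all add: gen_letter_def)
  moreover
  have "\<exists>m\<in>M11. m 0 = 0 \<and> m 1 = 10"
    by (rule bexI[OF _ word_in_M11[of "[0,1,0,1,0,0,0]"]]) (simp_all add: gen_letter_def)
  moreover
  have "\<forall>j::11. j = 0 \<or> j = 1 \<or> j = 2 \<or> j = 3 \<or> j = 4 \<or> j = 5 \<or> j = 6 \<or> j = 7 \<or> j = 8 \<or> j = 9 \<or> j = 10"
    unfolding all_11 by simp
  ultimately show ?thesis using assms by metis
qed

definition shift11 :: "11 \<Rightarrow> perm11" where
  "shift11 c = (\<lambda>i. i + c)"

lemma shift11_in_M11: "shift11 c \<in> M11"
proof -
  define A where "A = {c. shift11 c \<in> M11}"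
  have "0 \<in> A" using M11_id by (simp add: A_def shift11_def)
  have st: "c + 1 \<in> A" if "c \<in> A" for c
    using M11_comp[OF M11_gens(1), of "shift11 c"] that by (simp add: A_def shift11_def sigma11_def add.assoc)
  have "(0::11) \<in> A" by fact
  moreover from st[OF this] have "1 \<in> A" by simp
  moreover from st[OF this] have "2 \<in> A" by simp
  moreover from st[OF this] have "3 \<in> A" by simp
  moreover from st[OF this] have "4 \<in> A" by simp
  moreover from st[OF this] have "5 \<in> A" by simp
  moreover from st[OF this] have "6 \<in> A" by simp
  moreover from st[OF this] have "7 \<in> A" by simp
  moreover from st[OF this] have "8 \<in> A" by simp
  moreover from st[OF this] have "9 \<in> A" by simp
  moreover from st[OF this] have "10 \<in> A" by simp
  ultimately have "\<forall>c. c \<in> A" unfolding all_11 by simp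
  then show ?thesis unfolding A_def by blast
qed

lemma M11_doubly_transitive:
  assumes "i \<noteq> j" shows "\<exists>m\<in>M11. m 0 = i \<and> m 1 = j"
proof -
  have "j - i \<noteq> 0" using assms by simp
  then obtain m where m: "m \<in> M11" "m 0 = 0" "m 1 = j - i" using M11_stab_transitive by blast
  have "(\<lambda>k. shift11 i (m k)) \<in> M11" using M11_comp[OF shift11_in_M11 m(1)] .
  then show ?thesis using m by (intro bexI[of _ "\<lambda>k. shift11 i (m k)"]) (auto simp: shift11_def)
qed

subsection \<open>Invariant groups of diagonal matrices\<close>

definition diag_group :: "(11 \<Rightarrow> complex) set \<Rightarrow> bool" where
  "diag_group A \<longleftrightarrow> (\<lambda>_. 1) \<in> A \<and> (\<forall>a\<in>A. \<forall>b\<in>A. (\<lambda>i. a i * b i) \<in> A)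
     \<and> (\<forall>a\<in>A. (\<lambda>i. inverse (a i)) \<in> A) \<and> (\<forall>a\<in>A. \<forall>i. a i \<noteq> 0)"

lemma diag_groupD:
  assumes "diag_group A"
  shows "(\<lambda>_. 1) \<in> A" "a \<in> A \<Longrightarrow> b \<in> A \<Longrightarrow> (\<lambda>i. a i * b i) \<in> A"
    "a \<in> A \<Longrightarrow> (\<lambda>i. inverse (a i)) \<in> A" "a \<in> A \<Longrightarrow> a i \<noteq> 0"
    "a \<in> A \<Longrightarrow> b \<in> A \<Longrightarrow> (\<lambda>i. a i / b i) \<in> A"
proof -
  have i: "\<forall>a\<in>A. (\<lambda>i. inverse (a i)) \<in> A" and m: "\<forall>a\<in>A. \<forall>b\<in>A. (\<lambda>i. a i * b i) \<in> A"
    using assms by (simp_all add: diag_group_def)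
  show "(\<lambda>_. 1) \<in> A" "a \<in> A \<Longrightarrow> a i \<noteq> 0" using assms by (simp_all add: diag_group_def)
  show "a \<in> A \<Longrightarrow> (\<lambda>i. inverse (a i)) \<in> A" using i by simp
  show "a \<in> A \<Longrightarrow> b \<in> A \<Longrightarrow> (\<lambda>i. a i * b i) \<in> A" using m by simp
  assume "a \<in> A" "b \<in> A"
  then show "(\<lambda>i. a i / b i) \<in> A"
    using bspec[OF bspec[OF m, of a], of "\<lambda>i. inverse (b i)"] i by (simp add: divide_inverse)
qed

lemma diag_group_power: "diag_group A \<Longrightarrow> a \<in> A \<Longrightarrow> (\<lambda>i. a i ^ n) \<in> A"
  by (induction n) (auto intro: diag_groupD)

text \<open>For distinct indices this is a coroot element of the diagonal torus; those on
  neighbouring indices generate all vectors of product one.\<close>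

definition pair_vec :: "11 \<Rightarrow> 11 \<Rightarrow> complex \<Rightarrow> 11 \<Rightarrow> complex" where
  "pair_vec i j z = (\<lambda>k. if k = i then z else if k = j then inverse z else 1)"

text \<open>Averaging \<open>a\<close> multiplicatively over the group of order 9 gives
  \<open>a 0 ^ 9\<close>, \<open>a 1 ^ 9\<close> and a constant elsewhere; over the quaternion group
  it gives \<open>a 0 ^ 8\<close>, \<open>a 1 ^ 8\<close> and a constant off 0, 1, 7. The quotient
  is \<open>a 0\<close>, \<open>a 1\<close> and the constant \<open>a 7\<close> off 0, 1, 7.
  Dividing it by its copy under \<open>swap11\<close> cancels everything except the two
  ratios.\<close>

lemma pair_vec_in_M11_invariant:
  assumes A: "diag_group A" and inv: "\<And>p a. p \<in> M11 \<Longrightarrow> a \<in> A \<Longrightarrow> (\<lambda>i. a (p i)) \<in> A"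
    and a: "a \<in> A"
  shows "pair_vec 0 1 (a 0 / a 1) \<in> A"
proof -
  note mult = diag_groupD(2)[OF A] and dvd = diag_groupD(5)[OF A]
  have inv2: "(\<lambda>i. b (p (p i))) \<in> A" if "p \<in> M11" "b \<in> A" for p b
    using inv[OF that(1) inv[OF that]] .
  have inv3: "(\<lambda>i. b (p (p (p i)))) \<in> A" if "p \<in> M11" "b \<in> A" for p b
    using inv2[OF that(1) inv[OF that]] .
  define e where "e = (\<lambda>i. a i * a (kap11 i) * a (kap11 (kap11 i)))"
  \<comment> \<open>\<open>e\<close> runs over the powers of \<open>kap11\<close> and
    \<open>bK\<close> over those of \<open>lam11\<close>, so all nine group elements occur.\<close>
  define bK where "bK = (\<lambda>i. e i * e (lam11 i) * e (lam11 (lam11 i)))"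
  define f where "f = (\<lambda>i. a i * a (nu11 i) * a (nu11 (nu11 i)) * a (nu11 (nu11 (nu11 i))))"
  \<comment> \<open>\<open>rho11\<close> represents the second coset of the cyclic group of order 4
    generated by \<open>nu11\<close>.\<close>
  define bQ where "bQ = (\<lambda>i. f i * f (rho11 i))"
  define c where "c = (\<lambda>i. bK i / bQ i)"
  define h where "h = (\<lambda>i. c i / c (swap11 i))"
  note kap = special_in_M11(3) and lam = special_in_M11(4) and nu = special_in_M11(2)
  have e: "e \<in> A"
    unfolding e_def by (rule mult[OF mult[OF a inv[OF kap a]] inv2[OF kap a]])
  have bK: "bK \<in> A"
    unfolding bK_def by (rule mult[OF mult[OF e inv[OF lam e]] inv2[OF lam e]])
  have f: "f \<in> A"
    unfolding f_def by (rule mult[OF mult[OF mult[OF a inv[OF nu a]] inv2[OF nu a]] inv3[OF nu a]])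
  have bQ: "bQ \<in> A"
    unfolding bQ_def by (rule mult[OF f inv[OF special_in_M11(5) f]])
  have c: "c \<in> A" unfolding c_def by (rule dvd[OF bK bQ])
  have h: "h \<in> A" unfolding h_def by (rule dvd[OF c inv[OF special_in_M11(6) c]])
  \<comment> \<open>The product over the regular orbit of the quaternion group, that is, off 0, 1
    and 7.\<close>
  define C where "C = a 2 * a 3 * a 4 * a 5 * a 6 * a 8 * a 9 * a 10"
  have nz: "a i \<noteq> 0" for i using diag_groupD(4)[OF A a] .
  have C: "C \<noteq> 0" unfolding C_def using nz by simp
  have bKv: "bK 0 = a 0 ^ 9" "bK 1 = a 1 ^ 9" "\<forall>i. i = 0 \<or> i = 1 \<or> bK i = C * a 7"
    unfolding all_11 by (simp_all add: bK_def e_def C_def eval_nat_numeral mult_ac)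
  have bQv: "bQ 0 = a 0 ^ 8" "bQ 1 = a 1 ^ 8" "bQ 7 = a 7 ^ 8" "\<forall>i. i = 0 \<or> i = 1 \<or> i = 7 \<or> bQ i = C"
    unfolding all_11 by (simp_all add: bQ_def f_def C_def eval_nat_numeral mult_ac)
  have c0: "c 0 = a 0" "c 1 = a 1"
    using nz[of 0] nz[of 1] by (simp_all add: c_def bKv(1,2) bQv(1,2) eval_nat_numeral)
  have c7: "\<forall>i. i = 0 \<or> i = 1 \<or> i = 7 \<or> c i = a 7"
    using bKv(3) bQv(4) C unfolding c_def by (metis nonzero_mult_div_cancel_left)
  have cnz: "c i \<noteq> 0" for i using diag_groupD(4)[OF A c] .
  have "\<forall>i. h i = pair_vec 0 1 (a 0 / a 1) i"
    using c7 nz cnz unfolding all_11 by (simp add: h_def pair_vec_def c0)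
  then have "h = pair_vec 0 1 (a 0 / a 1)" by blast
  with h show ?thesis by simp
qed

text \<open>With all of Sym(11) available, dividing \<open>a\<close> by a transposed copy replaces
  the averaging.\<close>

lemma pair_vec_in_Sym_invariant:
  assumes A: "diag_group A" and inv: "\<And>p a. bij p \<Longrightarrow> a \<in> A \<Longrightarrow> (\<lambda>i. a (p i)) \<in> A"
    and a: "a \<in> A" and ij: "i \<noteq> j"
  shows "pair_vec i j (a i / a j) \<in> A"
proof -
  define p where "p = Transposition.transpose i j"
  have "(\<lambda>k. a (p k)) \<in> A" by (rule inv[OF _ a]) (simp add: p_def)
  then have "(\<lambda>k. a k / a (p k)) \<in> A" using diag_groupD(5)[OF A a] by blast
  moreover have "(\<lambda>k. a k / a (p k)) = pair_vec i j (a i / a j)"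
    using ij diag_groupD(4)[OF A a] by (auto simp: p_def pair_vec_def Transposition.transpose_def)
  ultimately show ?thesis by simp
qed

text \<open>Multiplication by \<open>z\<close> permutes \<open>R\<close>; comparing the product over
  \<open>R\<close> before and after gives exponent \<open>card R\<close>, and the polynomial
  $X^{|R|}-1$ has no more roots than that.\<close>

lemma finite_mult_group_roots:
  fixes R :: "complex set"
  assumes fin: "finite R" and one: "1 \<in> R" and mult: "\<And>x y. x \<in> R \<Longrightarrow> y \<in> R \<Longrightarrow> x * y \<in> R"
    and nz: "0 \<notin> R"
  shows "card R > 0 \<and> R = {z. z ^ card R = 1}"
proof
  show c: "card R > 0" using fin one by (auto simp: card_gt_0_iff)
  have sub: "z ^ card R = 1" if z: "z \<in> R" for z
  proof -
    have z0: "z \<noteq> 0" using z nz by blast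
    have inj: "inj_on ((*) z) R" using z0 by (simp add: inj_on_def)
    have "(*) z ` R = R"
      by (rule card_subset_eq[OF fin]) (use mult z inj in \<open>auto simp: card_image\<close>)
    then have "(\<Prod>x\<in>R. x) = (\<Prod>x\<in>(*) z ` R. x)" by simp
    also have "\<dots> = (\<Prod>x\<in>R. z * x)" using inj by (simp add: prod.reindex)
    also have "\<dots> = z ^ card R * (\<Prod>x\<in>R. x)" by (simp add: prod.distrib)
    finally show ?thesis using nz fin by (auto simp: prod_zero_iff)
  qed
  show "R = {z. z ^ card R = 1}"
    using c sub by (intro card_subset_eq finite_roots_unity) (auto simp: card_roots_unity_eq)
qed

text \<open>The conclusion says $X[N] \le A \le Z\,D[N]$, where $Z$ denotes the scalars, $D[N]$ the diagonal
  matrices of exponent $N$ and $X[N]$ those of determinant one.\<close>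
lemma diag_group_exponent:
  assumes A: "diag_group A" and fin: "finite A"
    and sh: "\<And>a. a \<in> A \<Longrightarrow> (\<lambda>i. a (i + 1)) \<in> A"
    and pv: "\<And>a. a \<in> A \<Longrightarrow> pair_vec 0 1 (a 0 / a 1) \<in> A"
  obtains N where "N > 0"
    "\<And>x. (\<forall>i. x i ^ N = 1) \<Longrightarrow> (\<Prod>i\<in>UNIV. x i) = 1 \<Longrightarrow> x \<in> A"
    "\<And>a i j. a \<in> A \<Longrightarrow> a i ^ N = a j ^ N"
proof -
  define R where "R = (\<lambda>a. a 0 / a 1) ` A"
  define N where "N = card R"
  have R: "N > 0 \<and> R = {z. z ^ N = 1}"
    unfolding N_def
  proof (rule finite_mult_group_roots)
    show "finite R" using fin by (simp add: R_def)
    show "1 \<in> R" unfolding R_def using image_eqI[of 1 "\<lambda>a. a 0 / a 1" "\<lambda>_. 1" A] diag_groupD(1)[OF A] by simp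
    show "0 \<notin> R" unfolding R_def using diag_groupD(4)[OF A] by auto
    fix x y assume "x \<in> R" "y \<in> R"
    then obtain a b where ab: "a \<in> A" "b \<in> A" "x = a 0 / a 1" "y = b 0 / b 1" unfolding R_def by blast
    show "x * y \<in> R" unfolding R_def
      using image_eqI[OF _ diag_groupD(2)[OF A ab(1,2)], of "x * y" "\<lambda>a. a 0 / a 1"] by (simp add: ab)
  qed
  have pz: "pair_vec i (i - 1) z \<in> A" if z: "z ^ N = 1" for z i
  \<comment> \<open>\<open>pair_vec 1 0 z\<close> is \<open>pair_vec 0 1\<close> at the inverse of
    \<open>z\<close>; from there downward shifts reach every neighbouring pair.\<close>
  proof -
    have "inverse z ^ N = 1" using z by (simp add: power_inverse)
    then obtain a where "a \<in> A" "inverse z = a 0 / a 1" using R unfolding R_def by blast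
    then have p0: "pair_vec 0 1 (inverse z) \<in> A" using pv by simp
    have "pair_vec 1 0 z = pair_vec 0 1 (inverse z)" by (auto simp: pair_vec_def)
    with p0 have "pair_vec 1 0 z \<in> A" by simp
    define P where "P i \<longleftrightarrow> pair_vec i (i - 1) z \<in> A" for i
    have st: "P (i - 1)" if "P i" for i
    proof -
      have "(\<lambda>k. pair_vec i (i - 1) z (k + 1)) = pair_vec (i - 1) (i - 1 - 1) z"
        by (auto simp: pair_vec_def eq_diff_eq fun_eq_iff)
      with sh[OF that[unfolded P_def]] show ?thesis by (simp add: P_def)
    qed
    have "P 1" using \<open>pair_vec 1 0 z \<in> A\<close> by (simp add: P_def)
    then have "P i" using st by (rule cyclic_induct_down)
    then show ?thesis by (simp add: P_def)
  qed
  show thesis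
  proof
    show "N > 0" using R by blast
  next
    fix x :: "11 \<Rightarrow> complex"
    assume xN: "\<forall>i. x i ^ N = 1" and px: "(\<Prod>i\<in>UNIV. x i) = 1"
    note px = px[unfolded prod_11]
    have nz: "x i \<noteq> 0" for i using xN R by (metis power_0_left zero_neq_one neq0_conv)
    \<comment> \<open>Telescoping: with the partial products \<open>zj\<close> of \<open>x\<close>,
      the pair vectors on \<open>j\<close> and \<open>j - 1\<close> with value
      \<open>inverse zj\<close> multiply to $z_{j+1}/z_j = x_j$ at an inner index \<open>j\<close>.
      The last index comes out right because the full product is one.\<close>
    define z1 where "z1 = x 0"
    define z2 where "z2 = z1 * x 1"
    define z3 where "z3 = z2 * x 2"
    define z4 where "z4 = z3 * x 3"
    define z5 where "z5 = z4 * x 4"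
    define z6 where "z6 = z5 * x 5"
    define z7 where "z7 = z6 * x 6"
    define z8 where "z8 = z7 * x 7"
    define z9 where "z9 = z8 * x 8"
    define z10 where "z10 = z9 * x 9"
    note zs = z1_def z2_def z3_def z4_def z5_def z6_def z7_def z8_def z9_def z10_def
    have zN: "z1 ^ N = 1" "z2 ^ N = 1" "z3 ^ N = 1" "z4 ^ N = 1" "z5 ^ N = 1" "z6 ^ N = 1" "z7 ^ N = 1"
      "z8 ^ N = 1" "z9 ^ N = 1" "z10 ^ N = 1"
      using xN by (simp_all add: zs power_mult_distrib)
    have zz: "z1 \<noteq> 0" "z2 \<noteq> 0" "z3 \<noteq> 0" "z4 \<noteq> 0" "z5 \<noteq> 0" "z6 \<noteq> 0" "z7 \<noteq> 0" "z8 \<noteq> 0" "z9 \<noteq> 0" "z10 \<noteq> 0"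
      using nz by (simp_all add: zs)
    have last: "inverse z10 = x 10"
      using px zz(10) by (simp add: zs inverse_eq_divide field_simps)
    have zi: "inverse (z ^ 1) ^ N = 1" if "z ^ N = 1" for z :: complex
      using that by (simp add: power_inverse)
    let ?q = "\<lambda>j z. pair_vec j (j - 1) (inverse (z ^ 1))"
    define y where "y = (\<lambda>i. ?q 1 z1 i * (?q 2 z2 i * (?q 3 z3 i * (?q 4 z4 i * (?q 5 z5 i * (?q 6 z6 i *
       (?q 7 z7 i * (?q 8 z8 i * (?q 9 z9 i * ?q 10 z10 i)))))))))"
    note m = diag_groupD(2)[OF A] and p = pz[OF zi]
    have "y \<in> A" unfolding y_def
      by (rule m[OF p[OF zN(1)] m[OF p[OF zN(2)] m[OF p[OF zN(3)] m[OF p[OF zN(4)] m[OF p[OF zN(5)]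
        m[OF p[OF zN(6)] m[OF p[OF zN(7)] m[OF p[OF zN(8)] m[OF p[OF zN(9)] p[OF zN(10)]]]]]]]]]])
    moreover have "\<forall>i. y i = x i"
      unfolding all_11 using last zz nz
      by (simp add: y_def pair_vec_def) (simp add: zs field_simps)
    then have "y = x" by blast
    ultimately show "x \<in> A" by simp
  next
    fix a i j assume a: "a \<in> A"
    have h1: "b 0 ^ N = b 1 ^ N" if "b \<in> A" for b
    proof -
      have "(b 0 / b 1) ^ N = 1" using that R unfolding R_def by blast
      then show ?thesis using diag_groupD(4)[OF A that] by (simp add: power_divide)
    qed
    \<comment> \<open>Comparing positions 0 and 1 of every translate shows that the
      \<open>N\<close>-th powers are shift invariant.\<close>
    have h2: "(\<lambda>k. a (k + c)) \<in> A" for c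
      by (rule cyclic_induct[of _ 0]) (use a sh in \<open>simp_all add: add_ac\<close>)
    have "a c ^ N = a (1 + c) ^ N" for c using h1[OF h2[of c]] by simp
    then have "\<And>c. (\<lambda>k. a k ^ N) (c + 1) = (\<lambda>k. a k ^ N) c" by (simp add: add.commute)
    from shift_invariant_const[of "\<lambda>k. a k ^ N", OF this] show "a i ^ N = a j ^ N" by metis
  qed
qed

subsection \<open>The groups $\langle s, w_2 d, A\rangle$\<close>

text \<open>The coefficients of \<open>w2_mat ** d_mat (n + 1)\<close>: the diagonal of $d_{n+1}$
  reindexed by \<open>tau11\<close>. Entrywise it is a $2^n$-th root of the sign vector
  \<open>xvec 0\<close>.\<close>

definition xvec :: "nat \<Rightarrow> 11 \<Rightarrow> complex" where
  "xvec n i = (if i = 1 \<or> i = 2 \<or> i = 4 then eps (n + 1)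
     else if i = 0 \<or> i = 5 \<or> i = 7 then inverse (eps (n + 1)) else 1)"

lemma eps_nonzero: "eps n \<noteq> 0"
  by (simp add: eps_def)

lemma eps_power: "eps (n + 1) ^ (2 ^ n) = -1"
proof -
  have "of_nat (2 ^ n) * (complex_of_real pi * \<i> / 2 ^ n) = complex_of_real pi * \<i>" by simp
  then show ?thesis unfolding eps_def exp_of_nat_mult[symmetric] by simp
qed

lemma eps_1: "eps (Suc 0) = -1"
  using eps_power[of 0] by simp

lemma xvec_nonzero: "xvec n i \<noteq> 0"
  by (simp add: xvec_def eps_nonzero)

lemma xvec_power: "xvec n i ^ (2 ^ n) = xvec 0 i"
  using eps_power[of n] by (simp add: xvec_def eps_1 power_inverse)

lemma prod_xvec: "(\<Prod>i\<in>UNIV. xvec n i) = 1"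
  by (simp add: prod_11 xvec_def eps_nonzero field_simps)

lemma s_mat_mon: "s_mat = mon (\<lambda>_. 1) sigma11"
  by (simp add: s_mat_def perm_mat_eq_mon)

lemma w2_mat_mon: "w2_mat = mon (\<lambda>_. 1) tau11"
  by (simp add: w2_mat_def perm_mat_eq_mon)

lemma w2_d_mat_mon: "w2_mat ** d_mat (n + 1) = mon (xvec n) tau11"
proof -
  define dv where "dv = (\<lambda>i::11. if i = 0 \<or> i = 5 \<or> i = 7 then eps (n + 1)
        else if i = 1 \<or> i = 2 \<or> i = 4 then inverse (eps (n + 1)) else 1)"
  have "d_mat (n + 1) = mon dv (\<lambda>i. i)" by (simp add: vec_eq_iff d_mat_def dv_def)
  moreover have "\<forall>i. dv (tau11 i) = xvec n i" unfolding all_11 by (simp add: dv_def xvec_def)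
  ultimately show ?thesis by (simp add: w2_mat_mon mon_mult)
qed

section \<open>Groups generated by a lift of each generator and by diagonal matrices\<close>

definition base_gens :: "(11 \<Rightarrow> complex) \<Rightarrow> cmat11 set" where
  "base_gens x = {mon (\<lambda>_. 1) sigma11, mon x tau11}"

definition base_group :: "(11 \<Rightarrow> complex) \<Rightarrow> cmat11 set" where
  "base_group x = gen_mat_group (base_gens x)"

definition ext_group :: "(11 \<Rightarrow> complex) \<Rightarrow> (11 \<Rightarrow> complex) set \<Rightarrow> cmat11 set" where
  "ext_group x A = gen_mat_group (base_gens x \<union> (\<lambda>a. mon a (\<lambda>i. i)) ` A)"

lemma mat_group_base_group: "(\<And>i. x i \<noteq> 0) \<Longrightarrow> mat_group (base_group x)"
  unfolding base_group_def base_gens_def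
  by (rule mat_group_gen) (auto intro!: invertible_mon bij_sigma11 bij_tau11)

lemma base_group_gens: "mon (\<lambda>_. 1) sigma11 \<in> base_group x" "mon x tau11 \<in> base_group x"
  using gen_mat_group_incl unfolding base_group_def base_gens_def by blast+

lemma base_group_least:
  assumes "mat_group G" "mon (\<lambda>_. 1) sigma11 \<in> G" "mon x tau11 \<in> G"
  shows "base_group x \<subseteq> G"
  unfolding base_group_def using assms by (intro gen_mat_group_least) (auto simp: base_gens_def)

lemma mon_inv_in:
  assumes "mat_group G" "mon d t \<in> G" "\<And>i. d i \<noteq> 0" "bij t"
  shows "mon (\<lambda>i. inverse (d (inv t i))) (inv t) \<in> G"
  using mat_groupD(4)[OF assms(1,2)] matrix_inv_mon[OF assms(3,4)] by simp

lemma bij_inv_simps [simp]: "bij t \<Longrightarrow> t (inv t i) = i" "bij t \<Longrightarrow> inv t (t i) = i"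
  by (simp_all add: bij_is_surj bij_is_inj surj_f_inv_f)

lemma bij_compose: "bij t \<Longrightarrow> bij r \<Longrightarrow> bij (\<lambda>i. r (t i))"
  using bij_comp[of t r] by (simp add: comp_def)

lemma prod_bij: "bij t \<Longrightarrow> (\<Prod>i\<in>UNIV. f (t i)) = (\<Prod>i\<in>UNIV. f i)"
  by (rule prod.reindex_bij_betw)

lemma M11_lifts:
  assumes "mat_group G" "mon d sigma11 \<in> G" "\<And>i. d i \<noteq> 0" "mon x tau11 \<in> G" "\<And>i. x i \<noteq> 0"
    and t: "t \<in> M11"
  obtains y where "\<And>i. y i \<noteq> 0" "mon y t \<in> G"
proof -
  define P where "P = {t. bij t \<and> (\<exists>y. (\<forall>i. y i \<noteq> 0) \<and> mon y t \<in> G)}"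
  have "t \<in> P"
  proof (rule M11_least[OF t])
    show "(\<lambda>i. i) \<in> P" unfolding P_def using mat_groupD(1)[OF assms(1)] unfolding mat_eq_mon
      by (auto intro!: exI[of _ "\<lambda>_. 1"] simp: bij_id[unfolded id_def])
    show "sigma11 \<in> P" "tau11 \<in> P" unfolding P_def using assms bij_sigma11 bij_tau11 by blast+
  next
    fix p q assume "p \<in> P" "q \<in> P"
    then obtain y z where y: "bij p" "\<forall>i. y i \<noteq> 0" "mon y p \<in> G" and z: "bij q" "\<forall>i. z i \<noteq> 0" "mon z q \<in> G"
      unfolding P_def by blast
    have "mon (\<lambda>i. z i * y (q i)) (\<lambda>i. p (q i)) \<in> G" using mon_mult_in[OF assms(1) z(3) y(3)] .
    then show "(\<lambda>i. p (q i)) \<in> P" unfolding P_def using bij_compose[OF z(1) y(1)] y(2) z(2)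
      by (auto intro!: exI[of _ "\<lambda>i. z i * y (q i)"])
  next
    fix p assume "p \<in> P"
    then obtain y where y: "bij p" "\<forall>i. y i \<noteq> 0" "mon y p \<in> G" unfolding P_def by blast
    then show "inv p \<in> P" unfolding P_def using mon_inv_in[OF assms(1) y(3)] bij_imp_bij_inv[OF y(1)]
      by (auto intro!: exI[of _ "\<lambda>i. inverse (y (inv p i))"])
  qed
  then show thesis using that unfolding P_def by blast
qed

lemma base_group_one:
  assumes "mon y t \<in> base_group (\<lambda>_. 1)" shows "y = (\<lambda>_. 1)"
proof -
  have "base_group (\<lambda>_. 1) \<subseteq> {mon d t | d t. d = (\<lambda>_. 1) \<and> bij t}"
  proof (rule base_group_least)
    show "mat_group {mon d t | d t. d = (\<lambda>_. 1) \<and> bij t}"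
      by (rule mat_group_mon) (auto simp: bij_imp_bij_inv bij_compose bij_id[unfolded id_def])
  qed (use bij_sigma11 bij_tau11 in blast)+
  then obtain r where "mon (\<lambda>_. 1) r = mon y t" using assms by force
  then show ?thesis using mon_eq_iff[of "\<lambda>_. 1" r y t] by simp
qed

text \<open>The columns of a normalised Hadamard matrix of order 12, with the constant row removed:
  $\langle s, w_2 d_1\rangle$ permutes these twelve sign vectors, and this is why it meets the
  diagonal matrices trivially.\<close>
definition hadamard :: "(11 \<Rightarrow> complex) set" where
  "hadamard = insert (\<lambda>_. 1) (range (\<lambda>k i. xvec 0 (i + k)))"

text \<open>The twelve images are tabulated: the constant column and the translate by 0 are
  exchanged, the translates by 1, 3, 9, 10 are fixed, and 2, 6 and 4, 7 and 5, 8 are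
  interchanged.\<close>

lemma hadamard_tau11:
  assumes "c \<in> hadamard" shows "(\<lambda>i. xvec 0 i * c (tau11 i)) \<in> hadamard"
proof -
  define F where "F c = (\<lambda>i. xvec 0 i * c (tau11 i))" for c
  have "(\<lambda>i. xvec 0 (i + 0)) \<in> hadamard" unfolding hadamard_def by blast
  then have one: "F (\<lambda>_. 1) \<in> hadamard" by (simp add: F_def)
  have "\<forall>i. xvec 0 i * xvec 0 (tau11 i + 0) = 1"
    unfolding all_11 by (simp add: xvec_def eps_1)
  then have k0: "F (\<lambda>i. xvec 0 (i + 0)) \<in> hadamard" by (simp add: F_def hadamard_def)
  have "\<forall>i. xvec 0 i * xvec 0 (tau11 i + 1) = xvec 0 (i + 1)"
    unfolding all_11 by (simp add: xvec_def eps_1)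
  then have k1: "F (\<lambda>i. xvec 0 (i + 1)) \<in> hadamard" by (simp add: F_def hadamard_def)
  have "\<forall>i. xvec 0 i * xvec 0 (tau11 i + 2) = xvec 0 (i + 6)"
    unfolding all_11 by (simp add: xvec_def eps_1)
  then have k2: "F (\<lambda>i. xvec 0 (i + 2)) \<in> hadamard" by (simp add: F_def hadamard_def)
  have "\<forall>i. xvec 0 i * xvec 0 (tau11 i + 3) = xvec 0 (i + 3)"
    unfolding all_11 by (simp add: xvec_def eps_1)
  then have k3: "F (\<lambda>i. xvec 0 (i + 3)) \<in> hadamard" by (simp add: F_def hadamard_def)
  have "\<forall>i. xvec 0 i * xvec 0 (tau11 i + 4) = xvec 0 (i + 7)"
    unfolding all_11 by (simp add: xvec_def eps_1)
  then have k4: "F (\<lambda>i. xvec 0 (i + 4)) \<in> hadamard" by (simp add: F_def hadamard_def)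
  have "\<forall>i. xvec 0 i * xvec 0 (tau11 i + 5) = xvec 0 (i + 8)"
    unfolding all_11 by (simp add: xvec_def eps_1)
  then have k5: "F (\<lambda>i. xvec 0 (i + 5)) \<in> hadamard" by (simp add: F_def hadamard_def)
  have "\<forall>i. xvec 0 i * xvec 0 (tau11 i + 6) = xvec 0 (i + 2)"
    unfolding all_11 by (simp add: xvec_def eps_1)
  then have k6: "F (\<lambda>i. xvec 0 (i + 6)) \<in> hadamard" by (simp add: F_def hadamard_def)
  have "\<forall>i. xvec 0 i * xvec 0 (tau11 i + 7) = xvec 0 (i + 4)"
    unfolding all_11 by (simp add: xvec_def eps_1)
  then have k7: "F (\<lambda>i. xvec 0 (i + 7)) \<in> hadamard" by (simp add: F_def hadamard_def)
  have "\<forall>i. xvec 0 i * xvec 0 (tau11 i + 8) = xvec 0 (i + 5)"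
    unfolding all_11 by (simp add: xvec_def eps_1)
  then have k8: "F (\<lambda>i. xvec 0 (i + 8)) \<in> hadamard" by (simp add: F_def hadamard_def)
  have "\<forall>i. xvec 0 i * xvec 0 (tau11 i + 9) = xvec 0 (i + 9)"
    unfolding all_11 by (simp add: xvec_def eps_1)
  then have k9: "F (\<lambda>i. xvec 0 (i + 9)) \<in> hadamard" by (simp add: F_def hadamard_def)
  have "\<forall>i. xvec 0 i * xvec 0 (tau11 i + 10) = xvec 0 (i + 10)"
    unfolding all_11 by (simp add: xvec_def eps_1)
  then have k10: "F (\<lambda>i. xvec 0 (i + 10)) \<in> hadamard" by (simp add: F_def hadamard_def)
  have "\<forall>k. F (\<lambda>i. xvec 0 (i + k)) \<in> hadamard" unfolding all_11
    by (intro conjI k0 k1 k2 k3 k4 k5 k6 k7 k8 k9 k10)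
  then have "F c \<in> hadamard" using assms one unfolding hadamard_def by blast
  then show ?thesis by (simp add: F_def)
qed

lemma hadamard_shift:
  assumes "c \<in> hadamard" shows "(\<lambda>i. c (i + k)) \<in> hadamard"
  using assms unfolding hadamard_def by (auto simp: add.assoc)

text \<open>If \<open>d\<close> were a translate of the sign vector, multiplying it by the next
  translate and shifting back would make the product of \<open>xvec 0\<close> with its shift by 1 a
  column; inspection of all twelve rules this out.\<close>

lemma hadamard_products:
  assumes d: "d \<in> hadamard" and closed: "\<And>c. c \<in> hadamard \<Longrightarrow> (\<lambda>i. d i * c i) \<in> hadamard"
  shows "d = (\<lambda>_. 1)"
proof (rule ccontr)
  assume "d \<noteq> (\<lambda>_. 1)"
  then obtain k where k: "d = (\<lambda>i. xvec 0 (i + k))" using d unfolding hadamard_def by blast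
  have "(\<lambda>i. xvec 0 (i + (k + 1))) \<in> hadamard" unfolding hadamard_def by blast
  from hadamard_shift[OF closed[OF this], of "- k"]
  have "(\<lambda>i. xvec 0 i * xvec 0 (i + 1)) \<in> hadamard" by (simp add: k)
  moreover have "(\<lambda>i. xvec 0 i * xvec 0 (i + 1)) \<noteq> (\<lambda>_. 1)"
    unfolding fun_eq_iff all_11 by (simp add: xvec_def eps_1)
  moreover have "\<forall>m. (\<lambda>i. xvec 0 i * xvec 0 (i + 1)) \<noteq> (\<lambda>i. xvec 0 (i + m))"
    unfolding fun_eq_iff all_11[where P = "\<lambda>i. xvec 0 i * xvec 0 (i + 1) = xvec 0 (i + _)"] all_11
    by (simp add: xvec_def eps_1)
  ultimately show False unfolding hadamard_def by blast
qed

text \<open>The invariant is stability of the set of columns. A diagonal element sends the constant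
  column to its own diagonal, so this diagonal is a column, and \<open>hadamard_products\<close>
  applies.\<close>

lemma base_group_sign_diag:
  assumes "mon y (\<lambda>i. i) \<in> base_group (xvec 0)"
  shows "y = (\<lambda>_. 1)"
proof -
  define \<Phi> where "\<Phi> d t \<longleftrightarrow> (\<forall>i. d i \<noteq> 0) \<and> bij t \<and> (\<forall>c\<in>hadamard. (\<lambda>i. d i * c (t i)) \<in> hadamard)"
    for d and t :: perm11
  have "base_group (xvec 0) \<subseteq> {mon d t | d t. \<Phi> d t}"
  proof (rule base_group_least)
    show "mat_group {mon d t | d t. \<Phi> d t}"
    proof (rule mat_group_mon)
      show "\<Phi> (\<lambda>_. 1) (\<lambda>i. i)" by (simp add: \<Phi>_def bij_id[unfolded id_def])
      show "\<Phi> d t \<Longrightarrow> (\<forall>i. d i \<noteq> 0) \<and> bij t" for d t by (simp add: \<Phi>_def)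
    next
      fix d t e r assume h: "\<Phi> d t" "\<Phi> e r"
      have "(\<lambda>i. d i * e (t i) * c (r (t i))) \<in> hadamard" if "c \<in> hadamard" for c
      proof -
        have "(\<lambda>i. e i * c (r i)) \<in> hadamard" using h(2) that by (simp add: \<Phi>_def)
        moreover have "\<forall>c\<in>hadamard. (\<lambda>i. d i * c (t i)) \<in> hadamard" using h(1) by (simp add: \<Phi>_def)
        ultimately show ?thesis unfolding mult.assoc by (rule bspec[rotated])
      qed
      then show "\<Phi> (\<lambda>i. d i * e (t i)) (\<lambda>i. r (t i))"
        using h bij_compose[of t r] unfolding \<Phi>_def by simp
    next
      fix d t assume h: "\<Phi> d t"
      then have d: "\<And>i. d i \<noteq> 0" and t: "bij t" by (simp_all add: \<Phi>_def)
      define F where "F c = (\<lambda>i. d i * c (t i))" for c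
      have inj: "inj_on F hadamard"
      proof (rule inj_onI)
        fix c c' assume "F c = F c'"
        then have "c (t i) = c' (t i)" for i using d[of i] unfolding F_def fun_eq_iff
          by (metis mult_left_cancel)
        then show "c = c'" using bij_inv_simps(1)[OF t] by (metis ext)
      qed
      \<comment> \<open>Finiteness makes the injective self-map onto, so the inverse preserves the
        columns as well.\<close>
      have fin: "finite hadamard" by (simp add: hadamard_def)
      have "F ` hadamard \<subseteq> hadamard" using h unfolding \<Phi>_def F_def by blast
      then have surj: "F ` hadamard = hadamard" using endo_inj_surj[OF fin _ inj] by blast
      have "(\<lambda>i. inverse (d (inv t i)) * c (inv t i)) \<in> hadamard" if c: "c \<in> hadamard" for c
      proof -
        obtain c' where c': "c' \<in> hadamard" "c = F c'" using c surj by blast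
        have "(\<lambda>i. inverse (d (inv t i)) * c (inv t i)) = c'"
          using d t by (simp add: c'(2) F_def fun_eq_iff)
        then show ?thesis using c'(1) by simp
      qed
      then show "\<Phi> (\<lambda>i. inverse (d (inv t i))) (inv t)"
        using d t bij_imp_bij_inv unfolding \<Phi>_def by simp
    qed
    have "\<Phi> (\<lambda>_. 1) sigma11" using hadamard_shift bij_sigma11 by (simp add: \<Phi>_def sigma11_def)
    then show "mon (\<lambda>_. 1) sigma11 \<in> {mon d t | d t. \<Phi> d t}" by blast
    have "\<Phi> (xvec 0) tau11" using hadamard_tau11 bij_tau11 xvec_nonzero by (simp add: \<Phi>_def)
    then show "mon (xvec 0) tau11 \<in> {mon d t | d t. \<Phi> d t}" by blast
  qed
  then obtain d t where dt: "mon y (\<lambda>i. i) = mon d t" "\<Phi> d t" using assms by blast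
  have d: "\<And>i. d i \<noteq> 0" using dt(2) by (simp add: \<Phi>_def)
  from mon_eq_iff[of d t y "\<lambda>i. i", OF d] dt(1) have yt: "y = d" "t = (\<lambda>i. i)" by simp_all
  have closed: "\<And>c. c \<in> hadamard \<Longrightarrow> (\<lambda>i. d i * c i) \<in> hadamard" using dt(2) by (simp add: \<Phi>_def yt)
  have "(\<lambda>_. 1) \<in> hadamard" by (simp add: hadamard_def)
  from hadamard_products[OF _ closed] closed[OF this] show ?thesis by (simp add: yt)
qed


text \<open>Entrywise $2^n$-th powers map this group into \<open>base_group (xvec 0)\<close>, whose
  diagonal part is trivial. The product of the coefficients is multiplicative and equals one on both
  generators.\<close>

lemma xvec_diag:
  assumes "mon y (\<lambda>i. i) \<in> base_group (xvec n)"
  shows "(\<forall>i. y i ^ (2 ^ n) = 1) \<and> (\<Prod>i\<in>UNIV. y i) = 1"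
proof -
  let ?G = "base_group (xvec 0)"
  define \<Phi> where "\<Phi> d t \<longleftrightarrow> (\<forall>i. d i \<noteq> 0) \<and> bij t \<and> (\<Prod>i\<in>UNIV. d i) = 1 \<and> mon (\<lambda>i. d i ^ (2 ^ n)) t \<in> ?G"
    for d and t :: perm11
  have G: "mat_group ?G" by (rule mat_group_base_group) (rule xvec_nonzero)
  have "base_group (xvec n) \<subseteq> {mon d t | d t. \<Phi> d t}"
  proof (rule base_group_least)
    show "mat_group {mon d t | d t. \<Phi> d t}"
    proof (rule mat_group_mon)
      show "\<Phi> (\<lambda>_. 1) (\<lambda>i. i)"
        using mat_groupD(1)[OF G] by (simp add: \<Phi>_def bij_id[unfolded id_def] mat_eq_mon)
      show "\<Phi> d t \<Longrightarrow> (\<forall>i. d i \<noteq> 0) \<and> bij t" for d t by (simp add: \<Phi>_def)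
    next
      fix d t e r assume h: "\<Phi> d t" "\<Phi> e r"
      then have "mon (\<lambda>i. d i ^ (2 ^ n) * e (t i) ^ (2 ^ n)) (\<lambda>i. r (t i)) \<in> ?G"
        using mon_mult_in[OF G] unfolding \<Phi>_def by blast
      moreover have "(\<Prod>i\<in>UNIV. d i * e (t i)) = 1"
        using h prod_bij[of t e] by (simp add: \<Phi>_def prod.distrib)
      ultimately show "\<Phi> (\<lambda>i. d i * e (t i)) (\<lambda>i. r (t i))"
        using h bij_compose[of t r] unfolding \<Phi>_def by (simp add: power_mult_distrib)
    next
      fix d t assume h: "\<Phi> d t"
      then have t: "bij t" by (simp add: \<Phi>_def)
      have "(\<Prod>i\<in>UNIV. inverse (d (inv t i))) = inverse (\<Prod>i\<in>UNIV. d i)"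
        using prod_bij[OF bij_imp_bij_inv[OF t], of "\<lambda>i. inverse (d i)"] by (simp add: prod_inversef[symmetric] comp_def)
      then show "\<Phi> (\<lambda>i. inverse (d (inv t i))) (inv t)"
        using h mon_inv_in[OF G, of "\<lambda>i. d i ^ (2 ^ n)" t] bij_imp_bij_inv[OF t]
        unfolding \<Phi>_def by (simp add: power_inverse)
    qed
    have "\<Phi> (\<lambda>_. 1) sigma11" using bij_sigma11 base_group_gens(1) by (simp add: \<Phi>_def)
    then show "mon (\<lambda>_. 1) sigma11 \<in> {mon d t | d t. \<Phi> d t}" by blast
    have "\<Phi> (xvec n) tau11" using bij_tau11 xvec_nonzero base_group_gens(2)
      by (simp add: \<Phi>_def xvec_power prod_xvec)
    then show "mon (xvec n) tau11 \<in> {mon d t | d t. \<Phi> d t}" by blast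
  qed
  then obtain d t where dt: "mon y (\<lambda>i. i) = mon d t" "\<Phi> d t" using assms by blast
  have d: "\<And>i. d i \<noteq> 0" using dt(2) by (simp add: \<Phi>_def)
  from mon_eq_iff[of d t y "\<lambda>i. i", OF d] dt(1) have yt: "y = d" "t = (\<lambda>i. i)" by simp_all
  have "mon (\<lambda>i. y i ^ (2 ^ n)) (\<lambda>i. i) \<in> ?G" "(\<Prod>i\<in>UNIV. y i) = 1" using dt(2) by (simp_all add: \<Phi>_def yt)
  then show ?thesis using base_group_sign_diag[of "\<lambda>i. y i ^ (2 ^ n)"] by (simp add: fun_eq_iff)
qed

text \<open>The conditions that make \<open>A\<close> the full diagonal part of
  \<open>ext_group x A\<close> (see \<open>ext_group_diag\<close>): \<open>A\<close> is normalised,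
  and the two generators alone create no diagonal element outside it.\<close>

definition admissible :: "(11 \<Rightarrow> complex) \<Rightarrow> (11 \<Rightarrow> complex) set \<Rightarrow> bool" where
  "admissible x A \<longleftrightarrow> (\<forall>i. x i \<noteq> 0) \<and> diag_group A \<and> (\<forall>p\<in>M11. \<forall>a\<in>A. (\<lambda>i. a (p i)) \<in> A)
     \<and> (\<forall>y. mon y (\<lambda>i. i) \<in> base_group x \<longrightarrow> y \<in> A)"

lemma mat_group_ext_group: "admissible x A \<Longrightarrow> mat_group (ext_group x A)"
  unfolding ext_group_def base_gens_def
  by (rule mat_group_gen)
    (auto intro!: invertible_mon bij_sigma11 bij_tau11 bij_id[unfolded id_def] simp: admissible_def diag_group_def)

lemma ext_group_incl:
  "mon (\<lambda>_. 1) sigma11 \<in> ext_group x A" "mon x tau11 \<in> ext_group x A" "a \<in> A \<Longrightarrow> mon a (\<lambda>i. i) \<in> ext_group x A"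
  using gen_mat_group_incl[of "base_gens x \<union> (\<lambda>a. mon a (\<lambda>i. i)) ` A"]
  unfolding ext_group_def base_gens_def by blast+

lemma ext_group_least:
  assumes "mat_group G" "mon (\<lambda>_. 1) sigma11 \<in> G" "mon x tau11 \<in> G" "\<And>a. a \<in> A \<Longrightarrow> mon a (\<lambda>i. i) \<in> G"
  shows "ext_group x A \<subseteq> G"
  unfolding ext_group_def using assms by (intro gen_mat_group_least) (auto simp: base_gens_def)

text \<open>Since \<open>A\<close> is invariant under \<open>M11\<close>, the products of an element
  of \<open>A\<close> with one of \<open>base_group x\<close> already form a group.\<close>

lemma ext_group_elems:
  assumes "admissible x A" "g \<in> ext_group x A"
  obtains a y t where "g = mon (\<lambda>i. a i * y i) t" "a \<in> A" "mon y t \<in> base_group x" "\<forall>i. y i \<noteq> 0" "t \<in> M11"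
proof -
  define \<Phi> where "\<Phi> d t \<longleftrightarrow> (\<exists>a\<in>A. \<exists>y. (\<forall>i. y i \<noteq> 0) \<and> t \<in> M11 \<and> mon y t \<in> base_group x \<and> d = (\<lambda>i. a i * y i))"
    for d and t :: perm11
  have x: "\<And>i. x i \<noteq> 0" and A: "diag_group A" and inv: "\<And>p a. p \<in> M11 \<Longrightarrow> a \<in> A \<Longrightarrow> (\<lambda>i. a (p i)) \<in> A"
    using assms(1) by (auto simp: admissible_def)
  have B: "mat_group (base_group x)" by (rule mat_group_base_group) (rule x)
  have \<Phi>I: "\<Phi> (\<lambda>i. a i * y i) t" if "a \<in> A" "\<And>i. y i \<noteq> 0" "t \<in> M11" "mon y t \<in> base_group x" for a y t
    unfolding \<Phi>_def using that by blast
  have one: "mon (\<lambda>_. 1) (\<lambda>i. i) \<in> base_group x" using mat_groupD(1)[OF B] by (simp add: mat_eq_mon)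
  have "mat_group {mon d t | d t. \<Phi> d t}"
  proof (rule mat_group_mon)
    show "\<Phi> (\<lambda>_. 1) (\<lambda>i. i)" using \<Phi>I[OF diag_groupD(1)[OF A] _ M11_id one] by simp
    show "\<Phi> d t \<Longrightarrow> (\<forall>i. d i \<noteq> 0) \<and> bij t" for d t
      unfolding \<Phi>_def using diag_groupD(4)[OF A] M11_bij by auto
  next
    fix d t e r assume "\<Phi> d t" "\<Phi> e r"
    then obtain a y b z where a: "a \<in> A" "\<forall>i. y i \<noteq> 0" "t \<in> M11" "mon y t \<in> base_group x" "d = (\<lambda>i. a i * y i)"
      and b: "b \<in> A" "\<forall>i. z i \<noteq> 0" "r \<in> M11" "mon z r \<in> base_group x" "e = (\<lambda>i. b i * z i)"
      unfolding \<Phi>_def by blast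
    have "\<Phi> (\<lambda>i. (a i * b (t i)) * (y i * z (t i))) (\<lambda>i. r (t i))"
      by (rule \<Phi>I[OF diag_groupD(2)[OF A a(1) inv[OF a(3) b(1)]] _ M11_comp[OF b(3) a(3)] mon_mult_in[OF B a(4) b(4)]])
        (simp add: a b)
    then show "\<Phi> (\<lambda>i. d i * e (t i)) (\<lambda>i. r (t i))" by (simp add: a(5) b(5) mult_ac)
  next
    fix d t assume "\<Phi> d t"
    then obtain a y where a: "a \<in> A" "\<forall>i. y i \<noteq> 0" "t \<in> M11" "mon y t \<in> base_group x" "d = (\<lambda>i. a i * y i)"
      unfolding \<Phi>_def by blast
    have m: "mon (\<lambda>i. inverse (y (inv t i))) (inv t) \<in> base_group x"
      by (rule mon_inv_in[OF B a(4)]) (use a M11_bij in auto)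
    have "\<Phi> (\<lambda>i. inverse (a (inv t i)) * inverse (y (inv t i))) (inv t)"
      by (rule \<Phi>I[OF diag_groupD(3)[OF A inv[OF M11_inv[OF a(3)] a(1)]] _ M11_inv[OF a(3)] m]) (simp add: a)
    then show "\<Phi> (\<lambda>i. inverse (d (inv t i))) (inv t)" by (simp add: a(5))
  qed
  moreover have "\<Phi> (\<lambda>_. 1) sigma11"
    using \<Phi>I[OF diag_groupD(1)[OF A] _ M11_gens(1) base_group_gens(1)] by simp
  moreover have "\<Phi> x tau11"
    using \<Phi>I[OF diag_groupD(1)[OF A] _ M11_gens(2) base_group_gens(2)] x by simp
  moreover have "\<Phi> a (\<lambda>i. i)" if "a \<in> A" for a
    using \<Phi>I[OF that _ M11_id one] by simp
  ultimately have "ext_group x A \<subseteq> {mon d t | d t. \<Phi> d t}"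
    by (intro ext_group_least) blast+
  then obtain d t where "g = mon d t" "\<Phi> d t" using assms(2) by blast
  then show thesis using that unfolding \<Phi>_def by blast
qed

lemma ext_group_monE:
  assumes "admissible x A" "g \<in> ext_group x A"
  obtains d t where "g = mon d t" "\<And>i. d i \<noteq> 0" "t \<in> M11"
proof -
  obtain a y t where h: "g = mon (\<lambda>i. a i * y i) t" "a \<in> A" "mon y t \<in> base_group x" "\<forall>i. y i \<noteq> 0" "t \<in> M11"
    by (rule ext_group_elems[OF assms])
  have "diag_group A" using assms(1) by (simp add: admissible_def)
  then have "\<And>i. a i \<noteq> 0" using diag_groupD(4) h(2) by blast
  then show thesis using that[OF h(1) _ h(5)] h(4) by simp
qed

lemma ext_group_diag:
  assumes adm: "admissible x A"
  shows "mon d (\<lambda>i. i) \<in> ext_group x A \<longleftrightarrow> d \<in> A"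
proof
  assume "mon d (\<lambda>i. i) \<in> ext_group x A"
  then obtain a y t where h: "mon d (\<lambda>i. i) = mon (\<lambda>i. a i * y i) t" "a \<in> A" "mon y t \<in> base_group x"
    "\<forall>i. y i \<noteq> 0" "t \<in> M11" by (rule ext_group_elems[OF adm])
  have A: "diag_group A" using adm by (simp add: admissible_def)
  have nz: "a i * y i \<noteq> 0" for i using diag_groupD(4)[OF A h(2)] h(4) by simp
  have "t = (\<lambda>i. i)" "d = (\<lambda>i. a i * y i)"
    using mon_eq_iff[of "\<lambda>i. a i * y i" t d "\<lambda>i. i", OF nz] h(1) by simp_all
  moreover have "y \<in> A" using adm h(3) \<open>t = _\<close> by (simp add: admissible_def)
  ultimately show "d \<in> A" using diag_groupD(2)[OF A h(2)] by simp
qed (rule ext_group_incl)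

lemma mon_divide_in:
  assumes "mat_group G" "mon d t \<in> G" "mon e t \<in> G" "\<And>i. e i \<noteq> 0" "bij t"
  shows "mon (\<lambda>i. d i / e i) (\<lambda>i. i) \<in> G"
  using mon_mult_in[OF assms(1,2) mon_inv_in[OF assms(1,3,4,5)]] assms(5) by (simp add: divide_inverse)

text \<open>One group contains the other, and both have the same permutations and the same diagonal
  part; two lifts of one permutation differ by a diagonal element.\<close>

lemma eq_ext_groupI:
  assumes adm: "admissible x A" and G: "mat_group G"
    and perm: "\<And>g. g \<in> G \<Longrightarrow> \<exists>d t. g = mon d t \<and> (\<forall>i. d i \<noteq> 0) \<and> t \<in> M11"
    and diag: "\<And>d. mon d (\<lambda>i. i) \<in> G \<longleftrightarrow> d \<in> A"
    and gens: "mon (\<lambda>_. 1) sigma11 \<in> G" "mon x tau11 \<in> G"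
  shows "G = ext_group x A"
proof
  show sub: "ext_group x A \<subseteq> G" using ext_group_least[OF G gens] diag by blast
  have E: "mat_group (ext_group x A)" by (rule mat_group_ext_group[OF adm])
  have x: "\<And>i. x i \<noteq> 0" using adm by (simp add: admissible_def)
  show "G \<subseteq> ext_group x A"
  proof
    fix g assume g: "g \<in> G"
    then obtain d t where dt: "g = mon d t" "\<forall>i. d i \<noteq> 0" "t \<in> M11" using perm by blast
    obtain y where y: "\<And>i. y i \<noteq> 0" "mon y t \<in> ext_group x A"
      using M11_lifts[OF E ext_group_incl(1) _ ext_group_incl(2) x dt(3)] by (metis zero_neq_one)
    have "mon (\<lambda>i. d i / y i) (\<lambda>i. i) \<in> G"
      by (rule mon_divide_in[OF G _ _ y(1) M11_bij[OF dt(3)]]) (use g dt(1) y(2) sub in auto)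
    then have "mon (\<lambda>i. d i / y i) (\<lambda>i. i) \<in> ext_group x A" using diag ext_group_incl(3) by blast
    from mon_mult_in[OF E this y(2)] show "g \<in> ext_group x A" using y(1) by (simp add: dt(1))
  qed
qed

subsection \<open>The groups in the classification list\<close>

definition sym_diag :: "(11 \<Rightarrow> complex) set \<Rightarrow> bool" where
  "sym_diag A \<longleftrightarrow> diag_group A \<and> finite A \<and> (\<forall>p. bij p \<longrightarrow> (\<forall>a\<in>A. (\<lambda>i. a (p i)) \<in> A))"

definition two_part :: "nat \<Rightarrow> (11 \<Rightarrow> complex) set \<Rightarrow> bool" where
  "two_part n A \<longleftrightarrow> (\<forall>a. a \<in> A \<and> (\<Prod>i\<in>UNIV. a i) = 1 \<and> (\<exists>k. \<forall>i. a i ^ (2 ^ k) = 1)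
     \<longleftrightarrow> (\<forall>i. a i ^ (2 ^ n) = 1) \<and> (\<Prod>i\<in>UNIV. a i) = 1)"

abbreviation diag_mats :: "(11 \<Rightarrow> complex) set \<Rightarrow> cmat11 set" where
  "diag_mats A \<equiv> (\<lambda>a. mon a (\<lambda>i. i)) ` A"

lemma mon_diag_eq_iff: "mon a (\<lambda>i. i) = mon b (\<lambda>i. i) \<longleftrightarrow> a = b"
proof
  assume h: "mon a (\<lambda>i. i) = mon b (\<lambda>i. i)"
  show "a = b"
  proof
    fix i show "a i = b i" using arg_cong[OF h, of "\<lambda>M. M $ i $ i"] by simp
  qed
qed simp

lemma mon_diag_in_diag_mats: "mon a (\<lambda>i. i) \<in> diag_mats A \<longleftrightarrow> a \<in> A"
  by (auto simp: mon_diag_eq_iff)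

lemma matrix_inv_diag: "(\<And>i. a i \<noteq> 0) \<Longrightarrow> matrix_inv (mon a (\<lambda>i. i)) = mon (\<lambda>i. inverse (a i)) (\<lambda>i. i)"
  by (rule matrix_inv_unique_right) (simp add: mon_mult mat_eq_mon)

lemma diag_group_of_mat_group:
  assumes "mat_group G" "\<And>a i. mon a (\<lambda>i. i) \<in> G \<Longrightarrow> a i \<noteq> 0"
  shows "diag_group {a. mon a (\<lambda>i. i) \<in> G}"
proof -
  have one: "mon (\<lambda>_. 1) (\<lambda>i. i) \<in> G" using mat_groupD(1)[OF assms(1)] by (simp add: mat_eq_mon)
  have mult: "mon (\<lambda>i. a i * b i) (\<lambda>i. i) \<in> G" if "mon a (\<lambda>i. i) \<in> G" "mon b (\<lambda>i. i) \<in> G" for a b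
    using mon_mult_in[OF assms(1) that] .
  have inv: "mon (\<lambda>i. inverse (a i)) (\<lambda>i. i) \<in> G" if "mon a (\<lambda>i. i) \<in> G" for a
    using mat_groupD(4)[OF assms(1) that] matrix_inv_diag[of a] assms(2)[OF that] by simp
  show ?thesis using one mult inv assms(2) by (simp add: diag_group_def)
qed

lemma mat_group_diag_mats:
  assumes "diag_group A" shows "mat_group (diag_mats A)"
  unfolding mat_group_def
proof (intro conjI ballI)
  show "mat 1 \<in> diag_mats A" using diag_groupD(1)[OF assms] by (simp add: mat_eq_mon mon_diag_in_diag_mats)
next
  fix x y assume "x \<in> diag_mats A" "y \<in> diag_mats A"
  then show "x ** y \<in> diag_mats A"
    using diag_groupD(2)[OF assms] by (auto simp: mon_mult)
next
  fix x assume "x \<in> diag_mats A"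
  then obtain a where a: "a \<in> A" "x = mon a (\<lambda>i. i)" by blast
  have nz: "\<And>i. a i \<noteq> 0" using diag_groupD(4)[OF assms a(1)] .
  show "invertible x" unfolding a(2) using nz by (rule invertible_mon) (rule bij_id[unfolded id_def])
  show "matrix_inv x \<in> diag_mats A"
    using diag_groupD(3)[OF assms a(1)] by (simp add: a(2) matrix_inv_diag nz mon_diag_in_diag_mats)
qed

lemma perm_conj_diag:
  assumes "bij p"
  shows "perm_mat p ** mon a (\<lambda>i. i) ** perm_mat (inv p) = mon (\<lambda>i. a (p i)) (\<lambda>i. i)"
  using assms by (simp add: perm_mat_eq_mon mon_mult)

lemma sym_inv_diag_iff: "sym_inv_diag B \<longleftrightarrow> (\<exists>A. sym_diag A \<and> B = diag_mats A)"
proof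
  assume h: "sym_inv_diag B"
  define A where "A = {a. mon a (\<lambda>i. i) \<in> B}"
  have B: "\<And>b. b \<in> B \<Longrightarrow> \<exists>d. b = mon d (\<lambda>i. i) \<and> (\<forall>i. d i \<noteq> 0)"
    using h unfolding sym_inv_diag_def diag_inv_iff by blast
  have eq: "B = diag_mats A"
    unfolding A_def using B by blast
  have "diag_group A" unfolding A_def
  proof (rule diag_group_of_mat_group)
    show "mat_group B" using h by (simp add: sym_inv_diag_def)
    show "mon a (\<lambda>i. i) \<in> B \<Longrightarrow> a i \<noteq> 0" for a i using B mon_diag_eq_iff by metis
  qed
  moreover have "finite A"
  proof (rule finite_imageD)
    show "finite (diag_mats A)" using h eq by (simp add: sym_inv_diag_def)
    show "inj_on (\<lambda>a. mon a (\<lambda>i. i)) A" by (simp add: inj_on_def mon_diag_eq_iff)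
  qed
  moreover have "(\<lambda>i. a (p i)) \<in> A" if "bij p" "a \<in> A" for p a
  proof -
    have "perm_mat p ** mon a (\<lambda>i. i) ** perm_mat (inv p) \<in> B"
      using h that unfolding sym_inv_diag_def A_def by blast
    then show ?thesis by (simp add: perm_conj_diag[OF that(1)] A_def)
  qed
  ultimately show "\<exists>A. sym_diag A \<and> B = diag_mats A" using eq unfolding sym_diag_def by blast
next
  assume "\<exists>A. sym_diag A \<and> B = diag_mats A"
  then obtain A where A: "sym_diag A" "B = diag_mats A" by blast
  then have D: "diag_group A" by (simp add: sym_diag_def)
  have "diag_mats A \<subseteq> Collect diag_inv" using diag_groupD(4)[OF D] by (auto simp: diag_inv_def)
  moreover have "perm_mat p ** x ** perm_mat (inv p) \<in> diag_mats A" if "bij p" "x \<in> diag_mats A" for p x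
    using that A(1) perm_conj_diag[OF that(1)] by (auto simp: sym_diag_def)
  ultimately show "sym_inv_diag B"
    using mat_group_diag_mats[OF D] A by (simp add: sym_inv_diag_def sym_diag_def)
qed

lemma Omega_iff: "mon a (\<lambda>i. i) \<in> Omega n \<longleftrightarrow> (\<forall>i. a i ^ (2 ^ n) = 1) \<and> (\<Prod>i\<in>UNIV. a i) = 1"
proof -
  have "a i \<noteq> 0" if "a i ^ (2 ^ n) = 1" for i using that by (metis power_0_left zero_neq_one power_eq_0_iff zero_neq_numeral)
  moreover have "mat 1 = mon (\<lambda>_. 1) (\<lambda>i. i)" by (rule mat_eq_mon)
  ultimately show ?thesis
    by (auto simp: Omega_def X2_def X_grp_def mon_power mon_diag_eq_iff det_mon_diag diag_inv_def fun_eq_iff)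
qed

lemma X2_iff: "mon a (\<lambda>i. i) \<in> X2 \<longleftrightarrow> (\<exists>k. \<forall>i. a i ^ (2 ^ k) = 1) \<and> (\<Prod>i\<in>UNIV. a i) = 1"
proof -
  have "M \<in> X2 \<longleftrightarrow> (\<exists>k. M \<in> Omega k)" for M unfolding Omega_def X2_def by blast
  then show ?thesis by (simp add: Omega_iff)
qed

lemma diag_mats_X2_Omega: "diag_mats A \<inter> X2 = Omega n \<longleftrightarrow> two_part n A"
proof -
  have "M \<in> X2 \<Longrightarrow> \<exists>a. M = mon a (\<lambda>i. i)" for M
    unfolding X2_def X_grp_def diag_inv_iff by blast
  moreover have "Omega n \<subseteq> X2" unfolding Omega_def by blast
  ultimately have "diag_mats A \<inter> X2 = Omega n \<longleftrightarrow>
      (\<forall>a. mon a (\<lambda>i. i) \<in> diag_mats A \<inter> X2 \<longleftrightarrow> mon a (\<lambda>i. i) \<in> Omega n)"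
    by blast
  also have "\<dots> \<longleftrightarrow> two_part n A"
    unfolding Int_iff X2_iff Omega_iff mon_diag_in_diag_mats two_part_def by blast
  finally show ?thesis .
qed

text \<open>Parameters instead of groups: later arguments work with the pair of \<open>x\<close> and
  \<open>A\<close>, and \<open>Qstar_iff\<close> translates back.\<close>

definition classified :: "(11 \<Rightarrow> complex) \<Rightarrow> (11 \<Rightarrow> complex) set \<Rightarrow> bool" where
  "classified x A \<longleftrightarrow> sym_diag A \<and> (x = (\<lambda>_. 1) \<and> (\<exists>a\<in>A. \<exists>i j. a i \<noteq> a j) \<or> (\<exists>n. x = xvec n \<and> two_part n A))"

lemma Qstar_iff: "G \<in> Qstar \<longleftrightarrow> (\<exists>x A. G = ext_group x A \<and> classified x A)"
proof -
  have sc: "diag_mats A \<subseteq> Collect scalar_mat \<longleftrightarrow> \<not> (\<exists>a\<in>A. \<exists>i j. a i \<noteq> a j)" for A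
    by (auto simp: scalar_mat_mon)
  have 1: "{s_mat, w2_mat} = base_gens (\<lambda>_. 1)" by (simp add: base_gens_def s_mat_mon w2_mat_mon)
  have 2: "{s_mat, w2_mat ** d_mat (n + 1)} = base_gens (xvec n)" for n
    unfolding base_gens_def s_mat_mon w2_d_mat_mon ..
  have ex: "(\<exists>B. P B \<and> (\<exists>A. S A \<and> B = diag_mats A) \<and> Q B) \<longleftrightarrow> (\<exists>A. P (diag_mats A) \<and> S A \<and> Q (diag_mats A))"
    for P S Q by blast
  have "G \<in> Qstar \<longleftrightarrow>
     (\<exists>B. G = gen_mat_group ({s_mat, w2_mat} \<union> B) \<and> sym_inv_diag B \<and> \<not> (B \<subseteq> Collect scalar_mat)) \<or>
     (\<exists>n B. G = gen_mat_group ({s_mat, w2_mat ** d_mat (n + 1)} \<union> B) \<and> sym_inv_diag B \<and> B \<inter> X2 = Omega n)"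
    unfolding Qstar_def by blast
  also have "\<dots> \<longleftrightarrow> (\<exists>A. G = ext_group (\<lambda>_. 1) A \<and> sym_diag A \<and> (\<exists>a\<in>A. \<exists>i j. a i \<noteq> a j)) \<or>
     (\<exists>n A. G = ext_group (xvec n) A \<and> sym_diag A \<and> two_part n A)"
    unfolding sym_inv_diag_iff 1 2 ext_group_def ex sc not_not diag_mats_X2_Omega ..
  finally show ?thesis unfolding classified_def by blast
qed

lemma classified_admissible:
  assumes "classified x A" shows "admissible x A"
proof -
  have S: "sym_diag A" using assms by (simp add: classified_def)
  then have D: "diag_group A" by (simp add: sym_diag_def)
  have inv: "\<forall>p\<in>M11. \<forall>a\<in>A. (\<lambda>i. a (p i)) \<in> A" using S M11_bij by (simp add: sym_diag_def)
  from assms consider "x = (\<lambda>_. 1)" | n where "x = xvec n" "two_part n A" unfolding classified_def by blast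
  then show ?thesis
  proof cases
    case 1
    then show ?thesis using D inv base_group_one diag_groupD(1)[OF D] by (auto simp: admissible_def)
  next
    case 2
    have "y \<in> A" if "mon y (\<lambda>i. i) \<in> base_group (xvec n)" for y
      using xvec_diag[OF that] 2(2) unfolding two_part_def by blast
    then show ?thesis using 2(1) D inv xvec_nonzero by (auto simp: admissible_def)
  qed
qed

subsection \<open>Irreducibility\<close>

lemma csubspaceD:
  assumes "csubspace W"
  shows "0 \<in> W" "x \<in> W \<Longrightarrow> y \<in> W \<Longrightarrow> x + y \<in> W" "x \<in> W \<Longrightarrow> c *s x \<in> W" "x \<in> W \<Longrightarrow> y \<in> W \<Longrightarrow> x - y \<in> W"
proof -
  show "0 \<in> W" "x \<in> W \<Longrightarrow> y \<in> W \<Longrightarrow> x + y \<in> W" "x \<in> W \<Longrightarrow> c *s x \<in> W" for x y c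
    using assms unfolding csubspace_def by blast+
  note h = this
  assume "x \<in> W" "y \<in> W"
  from h(2)[OF this(1) h(3)[OF this(2), of "-1"]] show "x - y \<in> W" by simp
qed

lemma csubspace_sum: "csubspace W \<Longrightarrow> (\<And>i. i \<in> I \<Longrightarrow> f i \<in> W) \<Longrightarrow> finite I \<Longrightarrow> sum f I \<in> W"
  by (induction I rule: infinite_finite_induct) (auto intro: csubspaceD)

lemma csubspace_shift:
  fixes v :: "complex^11"
  assumes "\<And>v. v \<in> W \<Longrightarrow> mon (\<lambda>_. 1) sigma11 *v v \<in> W" "v \<in> W"
  shows "(\<chi> i. v $ (i + c)) \<in> W"
proof (rule cyclic_induct[of _ 0])
  show "(\<chi> i. v $ (i + 0)) \<in> W" using assms(2) by simp
  fix c assume "(\<chi> i. v $ (i + c)) \<in> W"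
  from assms(1)[OF this] show "(\<chi> i. v $ (i + (c + 1))) \<in> W"
    by (rule back_subst[of "\<lambda>x. x \<in> W"]) (simp add: vec_eq_iff mon_mult_vec sigma11_def add_ac)
qed

lemma csubspace_UNIV:
  fixes W :: "(complex^11) set"
  assumes W: "csubspace W" and s: "\<And>v. v \<in> W \<Longrightarrow> mon (\<lambda>_. 1) sigma11 *v v \<in> W"
    and e: "axis i 1 \<in> W"
  shows "W = UNIV"
proof -
  have ax: "axis j 1 \<in> W" for j :: 11
    using csubspace_shift[OF s e, of "i - j"]
    by (rule back_subst[of "\<lambda>x. x \<in> W"]) (auto simp: vec_eq_iff axis_def algebra_simps)
  have "v \<in> W" for v
  proof -
    have "(\<Sum>j\<in>UNIV. v $ j *s axis j 1) \<in> W"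
      by (intro csubspace_sum[OF W] csubspaceD(3)[OF W] ax) simp
    then show ?thesis by (simp add: basis_expansion)
  qed
  then show ?thesis by blast
qed

lemma irreducible_nonscalar:
  assumes "mon (\<lambda>_. 1) sigma11 \<in> G" and A: "\<And>a. a \<in> A \<Longrightarrow> mon a (\<lambda>i. i) \<in> G"
    and sym: "sym_diag A" and ns: "\<exists>a\<in>A. \<exists>i j. a i \<noteq> a j"
  shows "irreducible_mat_group G"
  unfolding irreducible_mat_group_def
proof (intro allI impI)
  fix W assume h: "csubspace W \<and> (\<forall>g\<in>G. \<forall>v\<in>W. g *v v \<in> W)"
  then have W: "csubspace W" by blast
  have D: "diag_group A" using sym by (simp add: sym_diag_def)
  have symp: "\<And>p a. bij p \<Longrightarrow> a \<in> A \<Longrightarrow> (\<lambda>i. a (p i)) \<in> A" using sym by (simp add: sym_diag_def)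
  obtain N where N: "N > 0"
    "\<And>x. (\<forall>i. x i ^ N = 1) \<Longrightarrow> (\<Prod>i\<in>UNIV. x i) = 1 \<Longrightarrow> x \<in> A"
    "\<And>a i j. a \<in> A \<Longrightarrow> a i ^ N = a j ^ N"
  proof (rule diag_group_exponent[OF D])
    show "finite A" using sym by (simp add: sym_diag_def)
    show "(\<lambda>i. a (i + 1)) \<in> A" if "a \<in> A" for a using symp[OF bij_plus_right that, of 1] .
    show "pair_vec 0 1 (a 0 / a 1) \<in> A" if "a \<in> A" for a
      by (rule pair_vec_in_Sym_invariant[OF D _ that]) (simp_all add: symp)
  qed blast
  obtain a i0 j0 where a: "a \<in> A" "a i0 \<noteq> a j0" using ns by blast
  \<comment> \<open>A nontrivial \<open>N\<close>-th root of unity, so its pair vectors on any two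
    distinct indices lie in \<open>A\<close>.\<close>
  define z where "z = a i0 / a j0"
  have z: "z ^ N = 1" "z \<noteq> 1" "z \<noteq> 0"
    using N(3)[OF a(1), of i0 j0] diag_groupD(4)[OF D a(1)] a(2) by (simp_all add: z_def power_divide)
  have pv: "mon (pair_vec i j z) (\<lambda>i. i) *v v \<in> W" if "v \<in> W" "i \<noteq> j" for i j v
  proof -
    have "(\<Prod>k\<in>UNIV. pair_vec i j z k) = (\<Prod>k\<in>{i, j}. pair_vec i j z k)"
      by (rule prod.mono_neutral_right) (auto simp: pair_vec_def)
    then have "(\<Prod>k\<in>UNIV. pair_vec i j z k) = 1" using that z by (simp add: pair_vec_def)
    moreover have "\<forall>k. pair_vec i j z k ^ N = 1" using z by (simp add: pair_vec_def power_inverse)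
    ultimately have "pair_vec i j z \<in> A" using N(2) by blast
    then show ?thesis using A h that by blast
  qed
  show "W = {0} \<or> W = UNIV"
  proof (cases "W = {0}")
    case False
    then obtain v where v: "v \<in> W" "v \<noteq> 0" using csubspaceD(1)[OF W] by blast
    then obtain i where i: "v $ i \<noteq> 0" by (metis vec_eq_iff zero_index)
    have ne: "i \<noteq> i + 1" "i \<noteq> i + 2" "i + 1 \<noteq> i + 2" by simp_all
    \<comment> \<open>Applying $g-1$ for the pair vectors on \<open>i\<close>, \<open>i + 1\<close>
      and then on \<open>i\<close>, \<open>i + 2\<close> annihilates every coordinate except
      \<open>i\<close>, the only index that both move, and multiplies that one by $(z-1)^2$.\<close>
    define w where "w = mon (pair_vec i (i + 1) z) (\<lambda>i. i) *v v - v"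
    have w: "w \<in> W" unfolding w_def by (intro csubspaceD(4)[OF W] pv v ne)
    have "mon (pair_vec i (i + 2) z) (\<lambda>i. i) *v w - w \<in> W" by (intro csubspaceD(4)[OF W] pv w ne)
    then have "inverse ((z - 1)\<^sup>2 * v $ i) *s (mon (pair_vec i (i + 2) z) (\<lambda>i. i) *v w - w) \<in> W"
      by (rule csubspaceD(3)[OF W])
    moreover have "inverse ((z - 1)\<^sup>2 * v $ i) *s (mon (pair_vec i (i + 2) z) (\<lambda>i. i) *v w - w) = axis i 1"
      unfolding vec_eq_iff
    proof
      fix k
      consider "k = i" | "k = i + 1" | "k = i + 2" | "k \<noteq> i" "k \<noteq> i + 1" "k \<noteq> i + 2" by blast
      then show "(inverse ((z - 1)\<^sup>2 * v $ i) *s (mon (pair_vec i (i + 2) z) (\<lambda>i. i) *v w - w)) $ k = axis i 1 $ k"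
      proof cases
        case 1
        then have "(mon (pair_vec i (i + 2) z) (\<lambda>i. i) *v w - w) $ k = (z - 1)\<^sup>2 * v $ i"
          by (simp add: mon_mult_vec w_def pair_vec_def power2_eq_square algebra_simps)
        then show ?thesis using i z(2) 1 unfolding vector_smult_component by (simp add: axis_def field_simps del: vector_minus_component)
      qed (simp_all add: mon_mult_vec w_def pair_vec_def axis_def right_diff_distrib)
    qed
    ultimately have "axis i 1 \<in> W" by simp
    then show ?thesis using csubspace_UNIV[OF W] h assms(1) by blast
  qed simp
qed


text \<open>The support of the sign vector is the complement of a translate of the Paley difference set
  modulo 11, so its translates form an invertible circulant matrix.\<close>
lemma xvec_circulant:
  "xvec 0 i + xvec 0 (i + 1) + xvec 0 (i + 2) + xvec 0 (i + 4) + xvec 0 (i + 5) + xvec 0 (i + 7) =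
    (if i = 0 then - 6 else 0)"
proof -
  have "\<forall>i. xvec 0 i + xvec 0 (i + 1) + xvec 0 (i + 2) + xvec 0 (i + 4) + xvec 0 (i + 5) + xvec 0 (i + 7) =
    (if i = 0 then - 6 else 0)"
    unfolding all_11 by (simp add: xvec_def eps_1)
  then show ?thesis by blast
qed

text \<open>If all vectors of \<open>W\<close> have coordinate sum zero, applying the signed
  generator to their shifts makes them orthogonal to every translate of the sign vector, hence zero.
  Otherwise summing shifts yields the constant vector, whose image is the sign vector; its
  translates span everything. Both halves invert the circulant of
  \<open>xvec_circulant\<close>.\<close>

lemma irreducible_signed:
  assumes "mon (\<lambda>_. 1) sigma11 \<in> G" "mon (xvec 0) tau11 \<in> G"
  shows "irreducible_mat_group G"
  unfolding irreducible_mat_group_def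
proof (intro allI impI)
  fix W assume h: "csubspace W \<and> (\<forall>g\<in>G. \<forall>v\<in>W. g *v v \<in> W)"
  then have W: "csubspace W" by blast
  have s: "\<And>v. v \<in> W \<Longrightarrow> mon (\<lambda>_. 1) sigma11 *v v \<in> W"
    and w: "\<And>v. v \<in> W \<Longrightarrow> mon (xvec 0) tau11 *v v \<in> W" using h assms by blast+
  show "W = {0} \<or> W = UNIV"
  proof (cases "\<forall>v\<in>W. (\<Sum>i\<in>UNIV. v $ i) = 0")
    case True
    have "v $ 0 = 0" if v: "v \<in> W" for v
    proof -
      have "(\<Sum>i\<in>UNIV. xvec 0 i * v $ (i + c)) = 0" for c
      proof -
        have "(\<Sum>i\<in>UNIV. (mon (xvec 0) tau11 *v (\<chi> i. v $ (i + c))) $ i) = 0"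
          using True w[OF csubspace_shift[OF s v]] by blast
        then have "(\<Sum>i\<in>UNIV. xvec 0 i * v $ (tau11 i + c)) = 0" by (simp add: mon_mult_vec)
        moreover have "(\<Sum>i\<in>UNIV. xvec 0 i * v $ (tau11 i + c)) = (\<Sum>i\<in>UNIV. xvec 0 i * v $ (i + c))"
          by (simp add: sum_11 xvec_def eps_1 add_ac)
        ultimately show ?thesis by simp
      qed
      moreover have "(\<Sum>i\<in>UNIV. xvec 0 i * v $ (i + c)) = (\<Sum>m\<in>UNIV. xvec 0 (m - c) * v $ m)" for c
        using sum.reindex_bij_betw[OF bij_plus_right[of c], of "\<lambda>m. xvec 0 (m - c) * v $ m"] by simp
      ultimately have "(\<Sum>m\<in>UNIV. xvec 0 (m - c) * v $ m) = 0" for c by simp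
      from this[of "- c" for c] have e: "(\<Sum>m\<in>UNIV. xvec 0 (m + c) * v $ m) = 0" for c by simp
      have "(\<Sum>m\<in>UNIV. (if m = 0 then - 6 else 0) * v $ m) = 0"
        unfolding xvec_circulant[symmetric]
        using e[of 0] e[of 1] e[of 2] e[of 4] e[of 5] e[of 7]
        by (simp add: distrib_right sum.distrib)
      then show ?thesis by (simp add: if_distrib[of "\<lambda>x. x * _"] cong: if_cong)
    qed
    from this[OF csubspace_shift[OF s]] have "v $ (0 + c) = 0" if "v \<in> W" for v c using that by auto
    then have "v = 0" if "v \<in> W" for v using that by (simp add: vec_eq_iff)
    then show ?thesis using csubspaceD(1)[OF W] by blast
  next
    case False
    then obtain v where v: "v \<in> W" "(\<Sum>i\<in>UNIV. v $ i) \<noteq> 0" by blast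
    define S where "S = (\<Sum>i\<in>UNIV. v $ i)"
    have "(\<Sum>c\<in>UNIV. \<chi> i. v $ (i + c)) \<in> W"
      by (rule csubspace_sum[OF W csubspace_shift[OF s v(1)] finite])
    then have "inverse S *s (\<Sum>c\<in>UNIV. \<chi> i. v $ (i + c)) \<in> W" by (rule csubspaceD(3)[OF W])
    moreover have "(\<Sum>c\<in>UNIV. v $ (i + c)) = S" for i
      using sum.reindex_bij_betw[OF bij_plus_right[of i], of "\<lambda>c. v $ c"] by (simp add: S_def add.commute)
    then have "inverse S *s (\<Sum>c\<in>UNIV. \<chi> i. v $ (i + c)) = (\<chi> i. 1)"
      using v(2) by (simp add: vec_eq_iff S_def[symmetric])
    ultimately have "(\<chi> i. 1) \<in> W" by simp
    from w[OF this] have "(\<chi> i. xvec 0 i) \<in> W"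
      by (rule back_subst[of "\<lambda>x. x \<in> W"]) (simp add: vec_eq_iff mon_mult_vec)
    from csubspace_shift[OF s this] have x: "(\<chi> i. xvec 0 (i + c)) \<in> W" for c by simp
    have "inverse (- 6) *s ((\<chi> i. xvec 0 (i + 0)) + (\<chi> i. xvec 0 (i + 1)) + (\<chi> i. xvec 0 (i + 2)) + (\<chi> i. xvec 0 (i + 4))
        + (\<chi> i. xvec 0 (i + 5)) + (\<chi> i. xvec 0 (i + 7))) \<in> W"
      by (intro csubspaceD(2,3)[OF W] x)
    moreover have "inverse (- 6) *s ((\<chi> i. xvec 0 (i + 0)) + (\<chi> i. xvec 0 (i + 1)) + (\<chi> i. xvec 0 (i + 2)) + (\<chi> i. xvec 0 (i + 4))
        + (\<chi> i. xvec 0 (i + 5)) + (\<chi> i. xvec 0 (i + 7))) = axis 0 1"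
      unfolding vec_eq_iff all_11 by (simp add: xvec_def eps_1 axis_def)
    ultimately have "axis 0 1 \<in> W" by simp
    then show ?thesis using csubspace_UNIV[OF W s] by blast
  qed
qed

lemma nonscalar_if_two_part:
  assumes "two_part n A" "n > 0"
  shows "\<exists>a\<in>A. \<exists>i j. a i \<noteq> a j"
proof -
  define a where "a = pair_vec 0 1 (-1)"
  have "(\<Prod>i\<in>UNIV. a i) = 1" by (simp add: prod_11 a_def pair_vec_def)
  moreover have "\<forall>i. a i ^ (2 ^ n) = 1" using assms(2) by (simp add: a_def pair_vec_def)
  ultimately have "a \<in> A" using assms(1) unfolding two_part_def by blast
  moreover have "a 0 \<noteq> a 2" by (simp add: a_def pair_vec_def)
  ultimately show ?thesis by blast
qed

lemma finite_monomial_roots: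
  assumes "M > 0"
  shows "finite {mon d t | d t. (\<forall>i. d i ^ M = (1::complex)) \<and> bij t}"
proof -
  have "finite (PiE (UNIV :: 11 set) (\<lambda>_. {z::complex. z ^ M = 1}))"
    by (intro finite_PiE finite_roots_unity) (use assms in auto)
  then have "finite {d. \<forall>i::11. d i ^ M = (1::complex)}" by (rule rev_finite_subset) auto
  then have "finite ((\<lambda>(d, t). mon d t) ` ({d. \<forall>i::11. d i ^ M = (1::complex)} \<times> UNIV))" by simp
  then show ?thesis by (rule rev_finite_subset) auto
qed

lemma finite_base_group:
  assumes "M > 0" "\<And>i. x i ^ M = 1"
  shows "finite (base_group x)"
proof (rule finite_subset[OF _ finite_monomial_roots[OF assms(1)]], rule base_group_least)
  show "mat_group {mon d t | d t. (\<forall>i. d i ^ M = 1) \<and> bij t}"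
  proof (rule mat_group_mon)
    show "(\<forall>i. d i \<noteq> 0) \<and> bij t" if "(\<forall>i. d i ^ M = 1) \<and> bij t" for d :: "11 \<Rightarrow> complex" and t :: perm11
    proof -
      have "d i \<noteq> 0" for i
      proof
        assume "d i = 0"
        moreover have "d i ^ M = 1" using that by blast
        ultimately show False using assms(1) by (simp add: power_0_left)
      qed
      then show ?thesis using that by blast
    qed
    show "(\<forall>i. (d i * e (t i)) ^ M = 1) \<and> bij (\<lambda>i. r (t i))"
      if "(\<forall>i. d i ^ M = 1) \<and> bij t" "(\<forall>i. e i ^ M = 1) \<and> bij r" for d e :: "11 \<Rightarrow> complex" and t r :: perm11
      using that bij_compose[of t r] by (simp add: power_mult_distrib)
  qed (simp_all add: bij_id[unfolded id_def] bij_imp_bij_inv power_inverse)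
  have "(\<lambda>_::11. 1) i ^ M = (1::complex)" for i by simp
  then show "mon (\<lambda>_. 1) sigma11 \<in> {mon d t | d t. (\<forall>i. d i ^ M = 1) \<and> bij t}" using bij_sigma11 by blast
  show "mon x tau11 \<in> {mon d t | d t. (\<forall>i. d i ^ M = 1) \<and> bij t}" using bij_tau11 assms(2) by blast
qed

lemma perm_part_ext_group:
  assumes "admissible x A" shows "perm_part (ext_group x A) = M11"
proof
  show "perm_part (ext_group x A) \<subseteq> M11"
    unfolding perm_part_def using ext_group_monE[OF assms] perm_of_mon by (metis image_subsetI)
  show "M11 \<subseteq> perm_part (ext_group x A)"
  proof
    fix t assume t: "t \<in> M11"
    have x: "\<And>i. x i \<noteq> 0" using assms by (simp add: admissible_def)
    obtain y where y: "\<And>i. y i \<noteq> 0" "mon y t \<in> ext_group x A"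
      using M11_lifts[OF mat_group_ext_group[OF assms] ext_group_incl(1) _ ext_group_incl(2) x t]
      by (metis zero_neq_one)
    then show "t \<in> perm_part (ext_group x A)" unfolding perm_part_def using perm_of_mon[of y t] by force
  qed
qed

lemma target_ext_group:
  assumes "classified x A" shows "target_group (ext_group x A)"
proof -
  have adm: "admissible x A" using assms by (rule classified_admissible)
  have sym: "sym_diag A" using assms by (simp add: classified_def)
  obtain M where M: "M > 0" "\<And>i. x i ^ M = 1"
  proof -
    from assms consider "x = (\<lambda>_. 1)" | n where "x = xvec n" unfolding classified_def by blast
    then show thesis
    proof cases
      case 1 then show thesis using that[of 1] by simp
    next
      case 2
      have "xvec n i ^ (2 ^ n * 2) = 1" for i
        unfolding power_mult xvec_power by (simp add: xvec_def eps_1)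
      then show thesis using that[of "2 ^ n * 2"] 2 by simp
    qed
  qed
  have "ext_group x A \<subseteq> (\<lambda>(a, g). mon a (\<lambda>i. i) ** g) ` (A \<times> base_group x)"
  proof
    fix g assume "g \<in> ext_group x A"
    then obtain a y t where "g = mon (\<lambda>i. a i * y i) t" "a \<in> A" "mon y t \<in> base_group x" "\<forall>i. y i \<noteq> 0" "t \<in> M11"
      by (rule ext_group_elems[OF adm])
    then show "g \<in> (\<lambda>(a, g). mon a (\<lambda>i. i) ** g) ` (A \<times> base_group x)"
      by (intro image_eqI[of _ _ "(a, mon y t)"]) (simp_all add: mon_mult)
  qed
  then have fin: "finite (ext_group x A)"
    by (rule finite_subset) (use sym finite_base_group[OF M] in \<open>simp add: sym_diag_def\<close>)
  have mono: "ext_group x A \<subseteq> Collect monomial"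
  proof
    fix g assume "g \<in> ext_group x A"
    then obtain d t where "g = mon d t" "\<And>i. d i \<noteq> 0" "t \<in> M11" by (rule ext_group_monE[OF adm]) blast
    then show "g \<in> Collect monomial" using monomial_mon[of d t] M11_bij by simp
  qed
  have irr: "irreducible_mat_group (ext_group x A)"
  proof (cases "\<exists>a\<in>A. \<exists>i j. a i \<noteq> a j")
    case True
    show ?thesis by (rule irreducible_nonscalar[OF ext_group_incl(1,3) sym True])
  next
    case False
    then obtain n where n: "x = xvec n" "two_part n A" using assms unfolding classified_def by blast
    with False nonscalar_if_two_part have "n = 0" by blast
    then have "mon (xvec 0) tau11 \<in> ext_group x A" using ext_group_incl(2)[of x A] n(1) by simp
    then show ?thesis by (rule irreducible_signed[OF ext_group_incl(1)])
  qed
  have "perm_group_iso (perm_part (ext_group x A)) M11"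
    unfolding perm_part_ext_group[OF adm] perm_group_iso_def by (intro exI[of _ id]) simp
  then show ?thesis using mat_group_ext_group[OF adm] mono fin irr unfolding target_group_def by blast
qed

subsection \<open>Conjugacy in the general linear group\<close>

text \<open>By double transitivity a nontrivial \<open>P\<close> contains some \<open>r\<close>
  taking 0 to 1, and its conjugates act transitively. Commutativity then determines an element of
  \<open>P\<close> by its value at 0, so \<open>r\<close> commutes with the stabiliser of 0 and 1;
  the fixed points of \<open>kap11\<close> and \<open>nu11\<close> make that impossible.\<close>

lemma M11_abelian_normal_trivial:
  assumes M: "P \<subseteq> M11"
    and comm: "\<And>p q i. p \<in> P \<Longrightarrow> q \<in> P \<Longrightarrow> p (q i) = q (p i)"
    and norm: "\<And>p m. p \<in> P \<Longrightarrow> m \<in> M11 \<Longrightarrow> (\<lambda>i. m (p (inv m i))) \<in> P"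
    and p: "p \<in> P"
  shows "p = (\<lambda>i. i)"
proof (rule ccontr)
  assume "p \<noteq> (\<lambda>i. i)"
  then obtain i0 where "i0 \<noteq> p i0" by fastforce
  then obtain m where m: "m \<in> M11" "m 0 = i0" "m 1 = p i0" using M11_doubly_transitive by blast
  define r where "r = (\<lambda>i. inv m (p (m i)))"
  have bm: "bij m" using m(1) M11_bij by blast
  have r: "r \<in> P" using norm[OF p M11_inv[OF m(1)]] by (simp add: r_def inv_inv_eq[OF bm])
  have r0: "r 0 = 1" using m(2,3) bij_inv_simps(2)[OF bm, of 1] by (simp add: r_def)
  have bij_r: "bij r" using r M M11_bij by blast
  have trans: "\<exists>q\<in>P. q 0 = j" if j: "j \<noteq> 0" for j
  proof -
    obtain k where k: "k \<in> M11" "k 0 = 0" "k 1 = j" using M11_stab_transitive[OF j] by blast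
    have "inv k 0 = 0" using bij_inv_simps(2)[OF M11_bij[OF k(1)], of 0] k(2) by simp
    then show ?thesis using norm[OF r k(1)] by (rule_tac bexI) (simp_all add: r0 k(3))
  qed
  \<comment> \<open>Conjugating \<open>r\<close> by such a \<open>k\<close> gives another element of
    \<open>P\<close> that takes 0 to 1.\<close>
  have comm_fix: "k (r i) = r (k i)" if k: "k \<in> M11" "k 0 = 0" "k 1 = 1" for k i
  proof -
    define r' where "r' = (\<lambda>i. k (r (inv k i)))"
    have bk: "bij k" using k(1) M11_bij by blast
    have r': "r' \<in> P" unfolding r'_def by (rule norm[OF r k(1)])
    have "inv k 0 = 0" using bij_inv_simps(2)[OF bk, of 0] k(2) by simp
    then have r'0: "r' 0 = 1" by (simp add: r'_def r0 k(3))
    have "r' j = r j" for j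
    proof (cases "j = 0")
      case False
      then obtain q where q: "q \<in> P" "q 0 = j" using trans by blast
      have "r' j = q (r' 0)" "r j = q (r 0)" using comm[OF r' q(1)] comm[OF r q(1)] q(2) by metis+
      then show ?thesis by (simp add: r0 r'0)
    qed (simp add: r0 r'0)
    from this[of "k i"] show ?thesis by (simp add: r'_def bk)
  qed
  have inj: "r i = r j \<Longrightarrow> i = j" for i j using bij_r by (metis bij_inv_simps(2))
  have fix_kap: "kap11 i = i \<Longrightarrow> i = 0 \<or> i = 1" for i
  proof -
    have "\<forall>i. kap11 i = i \<longrightarrow> i = 0 \<or> i = 1" unfolding all_11 by simp
    then show "kap11 i = i \<Longrightarrow> i = 0 \<or> i = 1" by blast
  qed
  have fix_nu: "nu11 i = i \<Longrightarrow> i = 0 \<or> i = 1 \<or> i = 7" for i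
  proof -
    have "\<forall>i. nu11 i = i \<longrightarrow> i = 0 \<or> i = 1 \<or> i = 7" unfolding all_11 by simp
    then show "nu11 i = i \<Longrightarrow> i = 0 \<or> i = 1 \<or> i = 7" by blast
  qed
  \<comment> \<open>\<open>r\<close> permutes the fixed points of everything it commutes with: 0 and
    1 for \<open>kap11\<close>, and 0, 1, 7 for \<open>nu11\<close>. So it exchanges 0 and 1 and
    fixes 7.\<close>
  have "kap11 (r 1) = r 1" using comm_fix[OF special_in_M11(3), of 1] by simp
  then have "r 1 = 0" using fix_kap inj[of 1 0] r0 by fastforce
  moreover have "nu11 (r 7) = r 7" using comm_fix[OF special_in_M11(2), of 7] by simp
  ultimately have r7: "r 7 = 7" using fix_nu inj[of 7 0] inj[of 7 1] r0 by fastforce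
  \<comment> \<open>Commuting with \<open>r\<close> gives
    \<open>q 1 = q (r 0) = r (q 0) = r 7 = 7\<close>, which is also \<open>q 0\<close>.\<close>
  obtain q where q: "q \<in> P" "q 0 = 7" using trans[of 7] by auto
  have "q 1 = r 7" using comm[OF r q(1), of 0] q(2) r0 by simp
  then have "q 1 = q 0" using r7 q(2) by simp
  moreover have "bij q" using q M M11_bij by blast
  ultimately have "(1::11) = 0" by (metis bij_inv_simps(2))
  then show False by simp
qed

section \<open>Conjugation and diagonal parts\<close>

lemma conj_inv:
  fixes g h :: cmat11
  assumes "invertible g" "invertible h"
  shows "matrix_inv (g ** h ** matrix_inv g) = g ** matrix_inv h ** matrix_inv g"
proof (rule matrix_inv_unique_right)
  have "(g ** h ** matrix_inv g) ** (g ** matrix_inv h ** matrix_inv g)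
      = g ** (h ** ((matrix_inv g ** g) ** (matrix_inv h ** matrix_inv g)))"
    by (simp only: matrix_mul_assoc)
  also have "\<dots> = g ** ((h ** matrix_inv h) ** matrix_inv g)"
    by (simp add: matrix_inv_invertible[OF assms(1)] matrix_mul_assoc)
  also have "\<dots> = mat 1" by (simp add: matrix_inv_invertible[OF assms(1)] matrix_inv_invertible[OF assms(2)])
  finally show "(g ** h ** matrix_inv g) ** (g ** matrix_inv h ** matrix_inv g) = mat 1" .
qed

lemma conj_mult:
  fixes g h k :: cmat11
  assumes "invertible g"
  shows "(g ** h ** matrix_inv g) ** (g ** k ** matrix_inv g) = g ** (h ** k) ** matrix_inv g"
proof -
  have "(g ** h ** matrix_inv g) ** (g ** k ** matrix_inv g)
      = g ** (h ** ((matrix_inv g ** g) ** (k ** matrix_inv g)))"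
    by (simp only: matrix_mul_assoc)
  then show ?thesis by (simp add: matrix_inv_invertible[OF assms] matrix_mul_assoc)
qed

lemma invertible_matrix_inv: "invertible (g :: cmat11) \<Longrightarrow> invertible (matrix_inv g)"
  using matrix_inv_invertible unfolding invertible_def by blast

lemma matrix_inv_inv: "invertible (g :: cmat11) \<Longrightarrow> matrix_inv (matrix_inv g) = g"
  by (rule matrix_inv_unique_right) (rule matrix_inv_invertible)

lemma GL_conj_sym:
  assumes "GL_conj G H" shows "GL_conj H G"
proof -
  obtain g where g: "invertible g" "H = (\<lambda>h. g ** h ** matrix_inv g) ` G"
    using assms unfolding GL_conj_def by blast
  have "matrix_inv g ** (g ** h ** matrix_inv g) ** g = h" for h
  proof -
    have "matrix_inv g ** (g ** h ** matrix_inv g) ** g = (matrix_inv g ** g) ** (h ** (matrix_inv g ** g))"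
      by (simp only: matrix_mul_assoc)
    then show ?thesis by (simp add: matrix_inv_invertible[OF g(1)])
  qed
  then have "G = (\<lambda>h. matrix_inv g ** h ** matrix_inv (matrix_inv g)) ` H"
    unfolding g(2) image_image matrix_inv_inv[OF g(1)] by simp
  then show ?thesis using invertible_matrix_inv[OF g(1)] unfolding GL_conj_def by blast
qed

text \<open>The permutations underlying \<open>B\<close> commute and are stable under conjugation by
  \<open>M11\<close>, so \<open>M11_abelian_normal_trivial\<close> leaves only the identity.\<close>

lemma abelian_normal_diag:
  assumes adm: "admissible x A" and B: "B \<subseteq> ext_group x A"
    and comm: "\<And>b c. b \<in> B \<Longrightarrow> c \<in> B \<Longrightarrow> b ** c = c ** b"
    and norm: "\<And>b h. b \<in> B \<Longrightarrow> h \<in> ext_group x A \<Longrightarrow> h ** b ** matrix_inv h \<in> B"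
    and b: "b \<in> B"
  obtains a where "a \<in> A" "b = mon a (\<lambda>i. i)"
proof -
  define P where "P = {t \<in> M11. \<exists>d. (\<forall>i. d i \<noteq> 0) \<and> mon d t \<in> B}"
  have x: "\<And>i. x i \<noteq> 0" using adm by (simp add: admissible_def)
  have triv: "t = (\<lambda>i. i)" if "t \<in> P" for t
  proof (rule M11_abelian_normal_trivial[OF _ _ _ that])
    show "P \<subseteq> M11" unfolding P_def by blast
  next
    fix p q i assume "p \<in> P" "q \<in> P"
    then obtain d e where d: "\<forall>i. d i \<noteq> 0" "mon d p \<in> B" and e: "\<forall>i. e i \<noteq> 0" "mon e q \<in> B" unfolding P_def by blast
    have "mon (\<lambda>i. d i * e (p i)) (\<lambda>i. q (p i)) = mon (\<lambda>i. e i * d (q i)) (\<lambda>i. p (q i))"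
      using comm[OF d(2) e(2)] by (simp add: mon_mult)
    then have "(\<lambda>i. q (p i)) = (\<lambda>i. p (q i))"
      using mon_eq_iff[of "\<lambda>i. d i * e (p i)"] d(1) e(1) by auto
    then show "p (q i) = q (p i)" by (rule fun_cong[THEN sym])
  next
    fix p m assume p: "p \<in> P" and m: "m \<in> M11"
    obtain d where d: "\<forall>i. d i \<noteq> 0" "mon d p \<in> B" using p unfolding P_def by blast
    obtain y where y: "\<And>i. y i \<noteq> 0" "mon y (inv m) \<in> ext_group x A"
      using M11_lifts[OF mat_group_ext_group[OF adm] ext_group_incl(1) _ ext_group_incl(2) x M11_inv[OF m]]
      by (metis zero_neq_one)
    have bm: "bij m" using M11_bij[OF m] .
    define e where "e = (\<lambda>i. y i * d (inv m i) * inverse (y (m (p (inv m i)))))"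
    from norm[OF d(2) y(2)]
    have "mon e (\<lambda>i. m (p (inv m i))) \<in> B"
      by (simp add: e_def matrix_inv_mon[OF y(1) bij_imp_bij_inv[OF bm]] mon_mult inv_inv_eq[OF bm])
    moreover have "\<forall>i. e i \<noteq> 0" using y(1) d(1) by (simp add: e_def)
    moreover have "(\<lambda>i. m (p (inv m i))) \<in> M11"
      using M11_comp[OF m M11_comp[of p "inv m"]] p M11_inv[OF m] unfolding P_def by blast
    ultimately show "(\<lambda>i. m (p (inv m i))) \<in> P" unfolding P_def by (intro CollectI conjI exI[of _ e])
  qed
  have "b \<in> ext_group x A" using b B by blast
  then obtain d t where dt: "b = mon d t" "\<And>i. d i \<noteq> 0" "t \<in> M11" by (rule ext_group_monE[OF adm]) blast
  have "mon d t \<in> B" using b dt(1) by simp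
  then have "t \<in> P" using dt(2,3) unfolding P_def by auto
  then have bd: "b = mon d (\<lambda>i. i)" using triv dt(1) by blast
  then have "d \<in> A" using \<open>b \<in> ext_group x A\<close> ext_group_diag[OF adm, of d] by simp
  then show thesis using bd by (rule that)
qed

text \<open>The conjugate of \<open>A\<close> is abelian and normal in the second group, hence
  diagonal and inside \<open>A'\<close>. Written entrywise, a nonzero entry of \<open>g\<close> in
  row \<open>i\<close> and column \<open>j\<close> forces \<open>a j = a' i\<close>.\<close>

lemma conj_diag_part:
  assumes adm: "admissible x A" and adm': "admissible x' A'"
    and g: "invertible g" and eq: "ext_group x' A' = (\<lambda>h. g ** h ** matrix_inv g) ` ext_group x A"
    and a: "a \<in> A"
  obtains a' where "a' \<in> A'" "\<And>i j. g $ i $ j * a j = a' i * g $ i $ j"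
proof -
  define B where "B = (\<lambda>a. g ** mon a (\<lambda>i. i) ** matrix_inv g) ` A"
  have A: "diag_group A" and inv: "\<And>p a. p \<in> M11 \<Longrightarrow> a \<in> A \<Longrightarrow> (\<lambda>i. a (p i)) \<in> A"
    using adm by (auto simp: admissible_def)
  have "g ** mon a (\<lambda>i. i) ** matrix_inv g \<in> B" using a by (simp add: B_def)
  then obtain a' where a': "a' \<in> A'" "g ** mon a (\<lambda>i. i) ** matrix_inv g = mon a' (\<lambda>i. i)"
  proof (rule abelian_normal_diag[OF adm', rotated 3])
    show "B \<subseteq> ext_group x' A'" unfolding B_def eq using ext_group_incl(3) by blast
  next
    fix b c assume "b \<in> B" "c \<in> B"
    then show "b ** c = c ** b" unfolding B_def by (auto simp: conj_mult[OF g] mon_mult mult.commute)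
  next
    fix b h assume b: "b \<in> B" and h: "h \<in> ext_group x' A'"
    obtain a where a: "a \<in> A" "b = g ** mon a (\<lambda>i. i) ** matrix_inv g" using b unfolding B_def by blast
    obtain k where k: "k \<in> ext_group x A" "h = g ** k ** matrix_inv g" using h unfolding eq by blast
    obtain d t where dt: "k = mon d t" "\<And>i. d i \<noteq> 0" "t \<in> M11" by (rule ext_group_monE[OF adm k(1)]) blast
    have bt: "bij t" using M11_bij[OF dt(3)] .
    have ik: "invertible k" unfolding dt(1) by (rule invertible_mon[OF dt(2) bt])
    have "h ** b ** matrix_inv h = g ** (k ** mon a (\<lambda>i. i) ** matrix_inv k) ** matrix_inv g"
      unfolding k(2) a(2) conj_inv[OF g ik] conj_mult[OF g] by simp
    also have "k ** mon a (\<lambda>i. i) ** matrix_inv k = mon (\<lambda>i. a (t i)) (\<lambda>i. i)"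
    proof -
      have c: "d i * a (t i) * inverse (d i) = a (t i)" for i using dt(2)[of i] by simp
      show ?thesis by (simp add: dt(1) matrix_inv_mon[OF dt(2) bt] mon_mult bt c)
    qed
    finally show "h ** b ** matrix_inv h \<in> B" unfolding B_def using inv[OF dt(3) a(1)] by auto
  qed blast
  have "g ** mon a (\<lambda>i. i) = (g ** mon a (\<lambda>i. i) ** matrix_inv g) ** g"
    by (simp add: matrix_mul_assoc[symmetric] matrix_inv_invertible[OF g])
  also have "\<dots> = mon a' (\<lambda>i. i) ** g" by (simp add: a'(2))
  finally have e: "g ** mon a (\<lambda>i. i) = mon a' (\<lambda>i. i) ** g" .
  have "g $ i $ j * a j = a' i * g $ i $ j" for i j
    using arg_cong[OF e, of "\<lambda>M. M $ i $ j"]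
    by (simp add: matrix_matrix_mult_def if_distrib[of "\<lambda>x. _ * x"] if_distrib[of "\<lambda>x. x * _"] cong: if_cong)
  then show thesis using that a'(1) by blast
qed

text \<open>Some term of the Leibniz expansion of a nonzero determinant is nonzero.\<close>

lemma invertible_transversal:
  assumes "invertible (g :: cmat11)"
  obtains p where "bij p" "\<And>i. g $ i $ p i \<noteq> 0"
proof -
  have "det g \<noteq> 0" using assms invertible_det_nz by blast
  then obtain p where "p permutes UNIV" "(\<Prod>i\<in>UNIV. g $ i $ p i) \<noteq> 0"
    unfolding det_def using sum.not_neutral_contains_not_neutral
    by (metis (no_types, lifting) mem_Collect_eq mult_zero_right)
  then show thesis using that[of p] permutes_bij by (auto simp: prod_zero_iff)
qed

text \<open>Along a transversal of nonzero entries of \<open>g\<close>, the vectors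
  \<open>a'\<close> and \<open>a\<close> agree up to a permutation, and \<open>A'\<close> is
  invariant under Sym(11). Applied in both directions this makes \<open>A\<close> a conjugacy
  invariant.\<close>

lemma conj_diag_subset:
  assumes c: "classified x A" and c': "classified x' A'" and conj: "GL_conj (ext_group x A) (ext_group x' A')"
  shows "A \<subseteq> A'"
proof
  fix a assume a: "a \<in> A"
  obtain g where g: "invertible g" "ext_group x' A' = (\<lambda>h. g ** h ** matrix_inv g) ` ext_group x A"
    using conj unfolding GL_conj_def by blast
  obtain a' where a': "a' \<in> A'" "\<And>i j. g $ i $ j * a j = a' i * g $ i $ j"
    by (rule conj_diag_part[OF classified_admissible[OF c] classified_admissible[OF c'] g a]) blast
  obtain p where p: "bij p" "\<And>i. g $ i $ p i \<noteq> 0" by (rule invertible_transversal[OF g(1)]) blast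
  have "a' i = a (p i)" for i using a'(2)[of i "p i"] p(2)[of i] by (simp add: mult.commute)
  then have "a = (\<lambda>i. a' (inv p i))" using p(1) by simp
  then show "a \<in> A'" using c' a'(1) bij_imp_bij_inv[OF p(1)] unfolding classified_def sym_diag_def by metis
qed

lemma two_part_unique:
  assumes "two_part m A" "two_part n A" shows "m = n"
proof -
  have "\<not> m < n" if mn: "two_part m A" "two_part n A" for m n
  proof
    assume lt: "m < n"
    define k where "k = n - 1"
    have k: "n = k + 1" "m \<le> k" using lt by (auto simp: k_def)
    define z where "z = eps n"
    have zk: "z ^ (2 ^ k) = -1" using eps_power[of k] by (simp add: z_def k)
    have zn: "z ^ (2 ^ n) = 1" using zk by (simp add: k power_mult mult.commute[of 2])
    have z0: "z \<noteq> 0" by (simp add: z_def eps_nonzero)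
    have "(\<forall>i. pair_vec 0 1 z i ^ (2 ^ n) = 1) \<and> (\<Prod>i\<in>UNIV. pair_vec 0 1 z i) = 1"
      using zn z0 by (simp add: prod_11 pair_vec_def power_inverse)
    then have "\<forall>i. pair_vec 0 1 z i ^ (2 ^ m) = 1" using mn unfolding two_part_def by blast
    then have "pair_vec 0 1 z 0 ^ (2 ^ m) = 1" by blast
    then have "z ^ (2 ^ m) = 1" by (simp add: pair_vec_def)
    then have "(z ^ (2 ^ m)) ^ (2 ^ (k - m)) = 1" by simp
    then have "z ^ (2 ^ k) = 1" using k(2) by (simp add: power_mult[symmetric] power_add[symmetric])
    then show False using zk by simp
  qed
  then show ?thesis using assms by (metis linorder_neqE_nat)
qed


section \<open>Separating the two families\<close>

lemma word_coeff_power: "word_coeff D T w i ^ k = word_coeff (\<lambda>l i. D l i ^ k) T w i"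
  by (induction w arbitrary: i) (simp_all add: power_mult_distrib)

definition gen_coeff :: "(11 \<Rightarrow> complex) \<Rightarrow> nat \<Rightarrow> 11 \<Rightarrow> complex" where
  "gen_coeff x l = (if l = 0 then (\<lambda>_. 1) else x)"

lemma word_in_base_group:
  assumes "\<And>i. x i \<noteq> 0"
  shows "mon (word_coeff (gen_coeff x) gen_letter w) (word_perm gen_letter w) \<in> base_group x"
  by (rule word_in_group[OF mat_group_base_group[OF assms]])
    (use base_group_gens in \<open>auto simp: gen_coeff_def gen_letter_def\<close>)

text \<open>The distinguishing element: \<open>nu11\<close> fixes the points 0 and 1, and its lift to $\langle s, w_2 d_1\rangle$
  has different signs there, whereas any two entries of an element of $\langle s, w_2, A\rangle$
  have a ratio that occurs in $A$.\<close>
lemma nu11_lift: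
  obtains y where "mon y nu11 \<in> base_group (xvec n)" "y 0 ^ (2 ^ n) = - 1" "y 1 ^ (2 ^ n) = 1"
proof -
  define y where "y = word_coeff (gen_coeff (xvec n)) gen_letter [0,0,0,1,0,0,1,0,0,1,0,0,1,0,0,1,0,0]"
  have y: "y i ^ (2 ^ n) = word_coeff (gen_coeff (xvec 0)) gen_letter [0,0,0,1,0,0,1,0,0,1,0,0,1,0,0,1,0,0] i" for i
    unfolding y_def word_coeff_power
    by (rule arg_cong[of _ _ "\<lambda>D. word_coeff D gen_letter _ i"])
      (simp add: fun_eq_iff gen_coeff_def xvec_power)
  show thesis
  proof
    show "mon y nu11 \<in> base_group (xvec n)"
      unfolding y_def nu11_def by (rule word_in_base_group) (rule xvec_nonzero)
    show "y 0 ^ (2 ^ n) = - 1" "y 1 ^ (2 ^ n) = 1"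
      unfolding y by (simp_all add: gen_coeff_def gen_letter_def xvec_def eps_1)
  qed
qed

text \<open>For nonscalar \<open>A\<close> a conjugating matrix is monomial. Carried back to the
  first group, the lift of \<open>nu11\<close> shows a ratio of two entries in \<open>A\<close>
  whose $2^n$-th power is -1, and Sym-invariance turns it into a forbidden pair vector.\<close>

lemma not_conj_split_nonsplit:
  assumes c: "classified (\<lambda>_. 1) A" and ns: "\<exists>a\<in>A. \<exists>i j. a i \<noteq> a j" and c': "classified (xvec n) A" and tp: "two_part n A"
  shows "\<not> GL_conj (ext_group (\<lambda>_. 1) A) (ext_group (xvec n) A)"
proof
  assume "GL_conj (ext_group (\<lambda>_. 1) A) (ext_group (xvec n) A)"
  then obtain g where g: "invertible g" "ext_group (xvec n) A = (\<lambda>h. g ** h ** matrix_inv g) ` ext_group (\<lambda>_. 1) A"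
    unfolding GL_conj_def by blast
  note adm = classified_admissible[OF c] and adm' = classified_admissible[OF c']
  have sym: "sym_diag A" using c by (simp add: classified_def)
  then have A: "diag_group A" by (simp add: sym_diag_def)
  have symp: "\<And>p a. bij p \<Longrightarrow> a \<in> A \<Longrightarrow> (\<lambda>i. a (p i)) \<in> A" using sym by (simp add: sym_diag_def)
  obtain p where p: "bij p" "\<And>i. g $ i $ p i \<noteq> 0" by (rule invertible_transversal[OF g(1)]) blast
  \<comment> \<open>Two nonzero entries in one row would force \<open>b j = b (p i)\<close> for
    every \<open>b\<close> in \<open>A\<close>, but double transitivity moves a pair of distinct
    entries of a nonscalar vector to these positions.\<close>
  have zero: "g $ i $ j = 0" if j: "j \<noteq> p i" for i j
  proof (rule ccontr)
    assume nz: "g $ i $ j \<noteq> 0"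
    obtain a k l where a: "a \<in> A" "a k \<noteq> a l" using ns by blast
    then have "k \<noteq> l" by blast
    then obtain m where m: "m \<in> M11" "m 0 = k" "m 1 = l" using M11_doubly_transitive by blast
    obtain r where r: "r \<in> M11" "r 0 = j" "r 1 = p i" using M11_doubly_transitive[OF j] by blast
    have br: "bij r" using r(1) M11_bij by blast
    define b where "b = (\<lambda>i. a (m (inv r i)))"
    have b: "b \<in> A" unfolding b_def
      using symp[OF bij_compose[OF bij_imp_bij_inv[OF br] M11_bij[OF m(1)]] a(1)] .
    have "inv r j = 0" "inv r (p i) = 1" using bij_inv_simps(2)[OF br, of 0] bij_inv_simps(2)[OF br, of 1] r by simp_all
    then have ne: "b j \<noteq> b (p i)" using a(2) m by (simp add: b_def)
    obtain b' where "\<And>i j. g $ i $ j * b j = b' i * g $ i $ j"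
      by (rule conj_diag_part[OF adm adm' g b]) blast
    from this[of i j] this[of i "p i"] show False using ne nz p(2)[of i] by (simp add: mult.commute)
  qed
  define b where "b = (\<lambda>i. g $ i $ p i)"
  have gm: "g = mon b p" using zero by (auto simp: vec_eq_iff b_def)
  have b: "\<And>i. b i \<noteq> 0" using p(2) by (simp add: b_def)
  obtain y where y: "mon y nu11 \<in> base_group (xvec n)" "y 0 ^ (2 ^ n) = - 1" "y 1 ^ (2 ^ n) = 1"
    by (rule nu11_lift)
  have "base_group (xvec n) \<subseteq> ext_group (xvec n) A"
    by (rule base_group_least[OF mat_group_ext_group[OF adm'] ext_group_incl(1,2)])
  then obtain k where k: "k \<in> ext_group (\<lambda>_. 1) A" "mon y nu11 = g ** k ** matrix_inv g" using y(1) g(2) by blast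
  obtain a z t where at: "k = mon (\<lambda>i. a i * z i) t" "a \<in> A" "mon z t \<in> base_group (\<lambda>_. 1)" "\<forall>i. z i \<noteq> 0" "t \<in> M11"
    by (rule ext_group_elems[OF adm k(1)])
  have "z = (\<lambda>_. 1)" using base_group_one[OF at(3)] .
  then have ka: "k = mon a t" using at(1) by simp
  have a0: "\<And>i. a i \<noteq> 0" using diag_groupD(4)[OF A at(2)] .
  have "mon y nu11 ** g = g ** k"
    unfolding k(2) by (simp add: matrix_mul_assoc[symmetric] matrix_inv_invertible[OF g(1)])
  then have "mon (\<lambda>i. b i * a (p i)) (\<lambda>i. t (p i)) = mon (\<lambda>i. y i * b (nu11 i)) (\<lambda>i. p (nu11 i))"
    by (simp add: gm ka mon_mult)
  then have e: "(\<lambda>i. b i * a (p i)) = (\<lambda>i. y i * b (nu11 i))"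
    using mon_eq_iff[of "\<lambda>i. b i * a (p i)"] b a0 by simp
  \<comment> \<open>At the fixed points 0 and 1 of \<open>nu11\<close> the coefficients of the
    conjugating matrix cancel.\<close>
  have y01: "a (p 0) = y 0" "a (p 1) = y 1" using fun_cong[OF e, of 0] fun_cong[OF e, of 1] b by simp_all
  have "p 0 \<noteq> p 1" using p(1) by (metis bij_inv_simps(2) zero_neq_one)
  then have pv: "pair_vec (p 0) (p 1) (y 0 / y 1) \<in> A"
    using pair_vec_in_Sym_invariant[OF A _ at(2), of "p 0" "p 1"] symp y01 by simp
  define z where "z = y 0 / y 1"
  have zn: "z ^ (2 ^ n) = - 1" using y(2,3) by (simp add: z_def power_divide)
  then have z0: "z \<noteq> 0" by (auto simp: power_0_left)
  have zz: "z ^ (2 ^ Suc n) = 1" using zn by (simp add: power_mult mult.commute[of 2])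
  have "(\<Prod>i\<in>UNIV. pair_vec (p 0) (p 1) z i) = (\<Prod>i\<in>{p 0, p 1}. pair_vec (p 0) (p 1) z i)"
    by (rule prod.mono_neutral_right) (auto simp: pair_vec_def)
  then have "(\<Prod>i\<in>UNIV. pair_vec (p 0) (p 1) z i) = 1" using \<open>p 0 \<noteq> p 1\<close> z0 by (simp add: pair_vec_def)
  moreover have "\<forall>i. pair_vec (p 0) (p 1) z i ^ (2 ^ Suc n) = 1"
    using zz by (simp add: pair_vec_def power_inverse del: power_Suc)
  ultimately have "\<forall>i. pair_vec (p 0) (p 1) z i ^ (2 ^ n) = 1"
    using tp pv unfolding two_part_def z_def by blast
  then have "z ^ (2 ^ n) = 1" using \<open>p 0 \<noteq> p 1\<close> by (metis pair_vec_def)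
  with zn show False by simp
qed

lemma classified_conj_eq:
  assumes c: "classified x A" and c': "classified x' A'" and conj: "GL_conj (ext_group x A) (ext_group x' A')"
  shows "ext_group x A = ext_group x' A'"
proof -
  have A: "A' = A" using conj_diag_subset[OF c c' conj] conj_diag_subset[OF c' c GL_conj_sym[OF conj]] by blast
  note c' = c'[unfolded A] and conj = conj[unfolded A]
  consider (s) "x = (\<lambda>_. 1)" "\<exists>a\<in>A. \<exists>i j. a i \<noteq> a j" | (n) n where "x = xvec n" "two_part n A"
    using c unfolding classified_def by blast
  then have "x = x'"
  proof cases
    case s
    consider "x' = (\<lambda>_. 1)" | n where "x' = xvec n" "two_part n A"
      using c' unfolding classified_def by blast
    then show ?thesis
    proof cases
      case (2 n)
      then show ?thesis using not_conj_split_nonsplit[of A n] s c c' conj by simp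
    qed (simp add: s)
  next
    case (n n)
    consider "x' = (\<lambda>_. 1)" "\<exists>a\<in>A. \<exists>i j. a i \<noteq> a j" | m where "x' = xvec m" "two_part m A"
      using c' unfolding classified_def by blast
    then show ?thesis
    proof cases
      case 1
      then show ?thesis using not_conj_split_nonsplit[of A n] n c c' GL_conj_sym[OF conj] by simp
    next
      case (2 m)
      then show ?thesis using two_part_unique[OF n(2) 2(2)] n by simp
    qed
  qed
  then show ?thesis by (simp add: A)
qed

subsection \<open>Permutation representations of $M_{11}$ of degree 11\<close>

text \<open>\<open>mu11\<close> and \<open>nu11\<close> receive letters of their own because the
  relations that rigidify the group are short in terms of them.\<close>

definition letter4 :: "nat \<Rightarrow> perm11" where
  "letter4 l = (if l = 0 then sigma11 else if l = 1 then tau11 else if l = 2 then mu11 else nu11)"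

lemma letter4_in_M11: "letter4 l \<in> M11"
  by (simp add: letter4_def M11_gens special_in_M11)

lemma mu11_eq: "mu11 i = 3 * i"
proof -
  have "\<forall>i. mu11 i = 3 * i" unfolding all_11 by simp
  then show ?thesis by blast
qed

text \<open>In order: \<open>mu11\<close> conjugates the cycle to a power, \<open>nu11\<close>
  normalises the group of \<open>mu11\<close>, a product of order dividing 3, the order of the
  cycle, and \<open>tau11\<close> in terms of the other letters. They control homomorphisms to
  permutations and monomial lifts alike.\<close>

lemma letter4_relations:
  "word_perm letter4 [0,2] = word_perm letter4 [2,0,0,0]"
  "word_perm letter4 [2,2,3] = word_perm letter4 [3,2]"
  "word_perm letter4 [0,0,0,0,0,0,3,0,0,0,0,0,0,3,0,0,0,0,0,0,3] = word_perm letter4 []"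
  "word_perm letter4 [0,0,0,0,0,0,0,0,0,0,0] = word_perm letter4 []"
  "word_perm letter4 [3,0,0,3,0,2,3] = word_perm letter4 [1]"
  unfolding fun_eq_iff all_11 by (simp_all add: letter4_def)

definition M11_hom :: "(perm11 \<Rightarrow> perm11) \<Rightarrow> bool" where
  "M11_hom h \<longleftrightarrow> (\<forall>x\<in>M11. \<forall>y\<in>M11. h (\<lambda>i. x (y i)) = (\<lambda>i. h x (h y i))) \<and> h (\<lambda>i. i) = (\<lambda>i. i)"

lemma M11_hom_word:
  assumes "M11_hom h"
  shows "word_perm (\<lambda>l. h (letter4 l)) w = h (word_perm letter4 w) \<and> word_perm letter4 w \<in> M11"
proof (induction w)
  case Nil
  then show ?case using assms by (simp add: M11_hom_def M11_id)
next
  case (Cons l w)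
  have "h (\<lambda>i. word_perm letter4 w (letter4 l i)) = (\<lambda>i. h (word_perm letter4 w) (h (letter4 l) i))"
    using assms Cons letter4_in_M11 unfolding M11_hom_def by blast
  moreover have "(\<lambda>i. word_perm letter4 w (letter4 l i)) \<in> M11"
    using M11_comp[of "word_perm letter4 w" "letter4 l"] Cons letter4_in_M11 by blast
  ultimately show ?case using Cons by simp
qed

lemma M11_hom_relation:
  assumes "M11_hom h" "word_perm letter4 w = word_perm letter4 w'"
  shows "word_perm (\<lambda>l. h (letter4 l)) w i = word_perm (\<lambda>l. h (letter4 l)) w' i"
  using M11_hom_word[OF assms(1), of w] M11_hom_word[OF assms(1), of w'] assms(2) by simp

lemma M11_hom_conj:
  assumes "M11_hom h" "bij p"
  shows "M11_hom (\<lambda>x i. inv p (h x (p i)))"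
  using assms unfolding M11_hom_def by simp

lemma M11_hom_identity:
  assumes h: "M11_hom h" and s: "h sigma11 = sigma11" and t: "h tau11 = tau11" and x: "x \<in> M11"
  shows "h x = x"
proof -
  have "x \<in> {x \<in> M11. h x = x}"
  proof (rule M11_least[OF x])
    show "(\<lambda>i. i) \<in> {x \<in> M11. h x = x}" using h M11_id by (simp add: M11_hom_def)
    show "sigma11 \<in> {x \<in> M11. h x = x}" "tau11 \<in> {x \<in> M11. h x = x}" using s t M11_gens by simp_all
  next
    fix p q assume pq: "p \<in> {x \<in> M11. h x = x}" "q \<in> {x \<in> M11. h x = x}"
    then show "(\<lambda>i. p (q i)) \<in> {x \<in> M11. h x = x}"
      using h M11_comp[of p q] by (simp add: M11_hom_def)
  next
    fix p assume p: "p \<in> {x \<in> M11. h x = x}"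
    then have bp: "bij p" and pM: "p \<in> M11" and hp: "h p = p" using M11_bij by auto
    have "h (\<lambda>i. p (inv p i)) = (\<lambda>i. h p (h (inv p) i))"
      using h pM M11_inv[OF pM] unfolding M11_hom_def by blast
    then have "(\<lambda>i. i) = (\<lambda>i. p (h (inv p) i))" using bp h hp by (simp add: M11_hom_def)
    then have "p (h (inv p) i) = i" for i by (rule fun_cong[THEN sym])
    then have "h (inv p) = inv p" using bp by (metis bij_inv_simps(2) ext)
    then show "inv p \<in> {x \<in> M11. h x = x}" using M11_inv[OF pM] by simp
  qed
  then show ?thesis by blast
qed

text \<open>Labels the orbit of a moved point by the residues modulo 11. A nonzero period would be
  invertible, so 1 would be a period and the point fixed.\<close>

lemma order_11_cycle:
  fixes s :: perm11
  assumes "\<And>i. s (s (s (s (s (s (s (s (s (s (s i)))))))))) = i" and "s \<noteq> (\<lambda>i. i)"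
  obtains \<theta> :: perm11 where "bij \<theta>" "\<And>j. \<theta> (j + 1) = s (\<theta> j)"
proof -
  obtain x where x: "s x \<noteq> x" using assms(2) by fastforce
  define \<theta> :: perm11 where "\<theta> j = (if j = 0 then x else if j = 1 then s x else if j = 2 then s (s x)
    else if j = 3 then s (s (s x)) else if j = 4 then s (s (s (s x))) else if j = 5 then s (s (s (s (s x))))
    else if j = 6 then s (s (s (s (s (s x))))) else if j = 7 then s (s (s (s (s (s (s x))))))
    else if j = 8 then s (s (s (s (s (s (s (s x))))))) else if j = 9 then s (s (s (s (s (s (s (s (s x))))))))
    else s (s (s (s (s (s (s (s (s (s x))))))))))" for j
  have "\<forall>j. \<theta> (j + 1) = s (\<theta> j)" unfolding all_11 by (simp add: \<theta>_def assms(1))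
  then have step: "\<theta> (j + 1) = s (\<theta> j)" for j by blast
  have "inj \<theta>"
  proof (rule injI, rule ccontr)
    fix i j :: 11 assume e: "\<theta> i = \<theta> j" and ne: "i \<noteq> j"
    define d where "d = j - i"
    have per: "\<theta> (k + d) = \<theta> k" for k :: 11
    proof (rule cyclic_induct[of "\<lambda>k. \<theta> (k + d) = \<theta> k" i])
      show "\<theta> (i + d) = \<theta> i" using e by (simp add: d_def)
      fix k assume "\<theta> (k + d) = \<theta> k"
      then show "\<theta> (k + 1 + d) = \<theta> (k + 1)" using step[of k] step[of "k + d"] by (simp add: add_ac)
    qed
    \<comment> \<open>Fermat's theorem modulo 11 provides the inverse of the period.\<close>
    have "\<forall>d::11. d = 0 \<or> d ^ 9 * d = 1" unfolding all_11 by simp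
    then obtain m where m: "m * d = 1" using ne unfolding d_def by (metis right_minus_eq)
    have "\<theta> (m * d) = \<theta> 0"
      by (rule cyclic_induct[of "\<lambda>m. \<theta> (m * d) = \<theta> 0" 0]) (simp_all add: distrib_right per)
    then show False using m step[of 0] x by (simp add: \<theta>_def)
  qed
  then have "bij \<theta>" by (simp add: bij_def finite_UNIV_inj_surj)
  then show thesis using that step by blast
qed

text \<open>The permutations fixing 0 and intertwining multiplication by 9 and by 3, parametrised by the
  images of 1 and 10.\<close>
definition semilinear :: "11 \<Rightarrow> 11 \<Rightarrow> perm11" where
  "semilinear p q i = (if i = 0 then 0 else if i = 1 then p else if i = 9 then 3 * p else if i = 4 then 9 * p
    else if i = 3 then 5 * p else if i = 5 then 4 * p else if i = 10 then q else if i = 2 then 3 * q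
    else if i = 7 then 9 * q else if i = 8 then 5 * q else 4 * q)"

text \<open>The hypotheses are the third relation of \<open>letter4_relations\<close> evaluated at 5
  and at 7; all 121 pairs are tested, and the survivor is \<open>nu11\<close>.\<close>

lemma semilinear_unique:
  assumes "semilinear p q (4 * q + 6) = 5" "semilinear p q (semilinear p q (3 * q + 6) + 6) = 7"
  shows "p = 1 \<and> q = 2"
proof -
  have "\<forall>q p. semilinear p q (4 * q + 6) = 5 \<longrightarrow>
      semilinear p q (semilinear p q (3 * q + 6) + 6) = 7 \<longrightarrow> p = 1 \<and> q = 2"
    unfolding all_11 by (simp add: semilinear_def)
  then show ?thesis using assms by blast
qed

text \<open>Conjugation first makes the image of the cycle the translation by 1. Then the image of
  \<open>mu11\<close> is affine with slope 3, and a translation moves its fixed point to 0. After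
  that the relations leave only \<open>nu11\<close> itself as image of \<open>nu11\<close>, and
  \<open>tau11\<close> is a word in the other three.\<close>

lemma M11_hom_conj_identity:
  assumes h: "M11_hom h" and s: "h sigma11 \<noteq> (\<lambda>i. i)"
  obtains p where "bij p" "\<And>x i. x \<in> M11 \<Longrightarrow> h x (p i) = p (x i)"
proof -
  have "h sigma11 (h sigma11 (h sigma11 (h sigma11 (h sigma11 (h sigma11 (h sigma11 (h sigma11 (h sigma11
     (h sigma11 (h sigma11 i)))))))))) = i" for i
    using M11_hom_relation[OF h letter4_relations(4), of i] by (simp add: letter4_def)
  then obtain \<theta> :: perm11 where \<theta>: "bij \<theta>" "\<And>j. \<theta> (j + 1) = h sigma11 (\<theta> j)"
    by (rule order_11_cycle[OF _ s]) blast
  define h1 where "h1 = (\<lambda>x i. inv \<theta> (h x (\<theta> i)))"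
  have h1: "M11_hom h1" unfolding h1_def by (rule M11_hom_conj[OF h \<theta>(1)])
  have s1: "h1 sigma11 i = i + 1" for i
    unfolding h1_def \<theta>(2)[symmetric] using \<theta>(1) by simp
  have r1: "h1 mu11 (i + 1) = h1 mu11 i + 3" for i
    using M11_hom_relation[OF h1 letter4_relations(1), of i] by (simp add: letter4_def s1 add_ac)
  define b where "b = h1 mu11 0"
  have "h1 mu11 i - 3 * i = b" for i
    using shift_invariant_const[of "\<lambda>i. h1 mu11 i - 3 * i" i] r1 by (simp add: b_def distrib_left)
  then have u1: "h1 mu11 i = 3 * i + b" for i by (metis diff_add_cancel add.commute)
  define c where "c = 5 * b"
  have bp: "bij (\<lambda>i. i + c)" by (rule bij_plus_right)
  have ip: "inv (\<lambda>i. i + c) j = j - c" for j using bij_inv_simps(2)[OF bp, of "j - c"] by simp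
  define h2 where "h2 = (\<lambda>x i. inv (\<lambda>i. i + c) (h1 x (i + c)))"
  have h2: "M11_hom h2" unfolding h2_def by (rule M11_hom_conj[OF h1 bp])
  have "h2 sigma11 i = sigma11 i" for i unfolding h2_def ip s1 unfolding sigma11_def by simp
  then have s2: "h2 sigma11 = sigma11" by blast
  have s2i: "h2 sigma11 i = i + 1" for i unfolding s2 by (simp add: sigma11_def)
  have "\<forall>b i::11. 3 * (i + 5 * b) + b - 5 * b = 3 * i"
    unfolding all_11[of "\<lambda>b. \<forall>i. 3 * (i + 5 * b) + b - 5 * b = 3 * i"] by (simp add: distrib_left)
  then have "3 * (i + c) + b - c = 3 * i" for i unfolding c_def by blast
  then have "h2 mu11 i = mu11 i" for i unfolding h2_def ip u1 mu11_eq .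
  then have u2: "h2 mu11 = mu11" by blast
  define v where "v = h2 nu11"
  have rv: "v (3 * (3 * i)) = 3 * v i" for i
    using M11_hom_relation[OF h2 letter4_relations(2), of i] by (simp add: letter4_def u2 mu11_eq v_def)
  have six: "v (v (v (i + 6) + 6) + 6) = i" for i
    using M11_hom_relation[OF h2 letter4_relations(3), of i]
    by (simp add: letter4_def s2i add.assoc v_def)
  define p where "p = v 1"
  define q where "q = v 10"
  have "\<forall>x::11. x = 3 * x \<longrightarrow> x = 0" unfolding all_11 by simp
  then have v0: "v 0 = 0" using rv[of 0] by simp
  have red: "(81::11) = 4" "(36::11) = 3" "(27::11) = 5" "(15::11) = 4" "(90::11) = 2" "(18::11) = 7" "(63::11) = 8"
    "(72::11) = 6" "(11::11) = 0" "(13::11) = 2" by simp_all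
  have pv: "v 1 = p" "v 9 = 3 * p" "v 4 = 9 * p" "v 3 = 5 * p" "v 5 = 4 * p"
    using rv[of 1] rv[of 9] rv[of 4] rv[of 3] by (simp_all add: p_def red mult.assoc[symmetric])
  have qv: "v 10 = q" "v 2 = 3 * q" "v 7 = 9 * q" "v 8 = 5 * q" "v 6 = 4 * q"
    using rv[of 10] rv[of 2] rv[of 7] rv[of 8] by (simp_all add: q_def red mult.assoc[symmetric])
  have "\<forall>i. v i = semilinear p q i" unfolding all_11 by (simp add: semilinear_def v0 pv qv)
  then have vV: "v i = semilinear p q i" for i by blast
  have "semilinear p q (4 * q + 6) = 5" "semilinear p q (semilinear p q (3 * q + 6) + 6) = 7"
    using six[of 5] six[of 7] by (simp_all add: vV[symmetric] v0 qv red)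
  then have pq: "p = 1" "q = 2" using semilinear_unique[of p q] by simp_all
  have "\<forall>i. v i = nu11 i" unfolding all_11 by (simp add: v0 pv qv pq)
  then have v2: "h2 nu11 = nu11" unfolding v_def by blast
  have "h2 tau11 i = tau11 i" for i
  proof -
    have "h2 tau11 i = nu11 (mu11 (sigma11 (nu11 (sigma11 (sigma11 (nu11 i))))))"
      using M11_hom_relation[OF h2 letter4_relations(5), of i] by (simp add: letter4_def s2 u2 v2)
    also have "\<dots> = tau11 i" using fun_cong[OF letter4_relations(5), of i] by (simp add: letter4_def)
    finally show ?thesis .
  qed
  then have id: "x \<in> M11 \<Longrightarrow> h2 x = x" for x using M11_hom_identity[OF h2 s2] by blast
  show thesis
  proof
    show "bij (\<lambda>i. \<theta> (i + c))" using bij_compose[OF bp \<theta>(1)] .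
    fix x i assume "x \<in> M11"
    from fun_cong[OF id[OF this], of i] have "h1 x (i + c) - c = x i" by (simp add: h2_def ip)
    then have "h1 x (i + c) = x i + c" by (metis diff_add_cancel)
    then have "\<theta> (inv \<theta> (h x (\<theta> (i + c)))) = \<theta> (x i + c)" by (simp add: h1_def)
    then show "h x (\<theta> (i + c)) = \<theta> (x i + c)" using \<theta>(1) by simp
  qed
qed

text \<open>An abstract isomorphism is upgraded to conjugacy in Sym(11); its inverse is a
  homomorphism that does not kill the cycle.\<close>

lemma perm_group_iso_M11:
  assumes iso: "perm_group_iso P M11"
    and bij: "\<And>p. p \<in> P \<Longrightarrow> bij p" and comp: "\<And>p q. p \<in> P \<Longrightarrow> q \<in> P \<Longrightarrow> (\<lambda>i. p (q i)) \<in> P"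
  obtains \<pi> where "bij \<pi>" "P = (\<lambda>x i. \<pi> (x (inv \<pi> i))) ` M11"
proof -
  obtain f where f: "bij_betw f P M11" "\<And>x y. x \<in> P \<Longrightarrow> y \<in> P \<Longrightarrow> f (\<lambda>i. x (y i)) = (\<lambda>i. f x (f y i))"
    using iso unfolding perm_group_iso_def comp_def by blast
  define h where "h = inv_into P f"
  have hb: "bij_betw h M11 P" unfolding h_def by (rule bij_betw_inv_into[OF f(1)])
  have hP: "x \<in> M11 \<Longrightarrow> h x \<in> P" for x using hb bij_betwE by blast
  have fh: "x \<in> M11 \<Longrightarrow> f (h x) = x" for x unfolding h_def using f(1) by (simp add: bij_betw_inv_into_right)
  have hf: "x \<in> P \<Longrightarrow> h (f x) = x" for x unfolding h_def using f(1) by (simp add: bij_betw_inv_into_left)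
  have mult: "h (\<lambda>i. x (y i)) = (\<lambda>i. h x (h y i))" if "x \<in> M11" "y \<in> M11" for x y
    using f(2)[OF hP[OF that(1)] hP[OF that(2)]] hf[OF comp[OF hP[OF that(1)] hP[OF that(2)]]] fh that by simp
  have one: "h (\<lambda>i. i) = (\<lambda>i. i)"
  proof
    fix i
    have "h (\<lambda>i. i) (h (\<lambda>i. i) i) = h (\<lambda>i. i) i" using fun_cong[OF mult[OF M11_id M11_id], of i] by simp
    then show "h (\<lambda>i. i) i = i" using bij[OF hP[OF M11_id]] by (metis bij_inv_simps(2))
  qed
  have nontriv: "h sigma11 \<noteq> (\<lambda>i. i)"
  proof
    assume "h sigma11 = (\<lambda>i. i)"
    then have "sigma11 = (\<lambda>i. i)" using fh[OF M11_gens(1)] fh[OF M11_id] one by simp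
    from fun_cong[OF this, of 0] show False by simp
  qed
  have hom: "M11_hom h" using mult one by (simp add: M11_hom_def)
  obtain p where p: "bij p" "\<And>x i. x \<in> M11 \<Longrightarrow> h x (p i) = p (x i)"
    by (rule M11_hom_conj_identity[OF hom nontriv]) blast
  have "h x = (\<lambda>i. p (x (inv p i)))" if "x \<in> M11" for x
    using p(2)[OF that, of "inv p i" for i] p(1) by (simp add: fun_eq_iff)
  then have "P = (\<lambda>x i. p (x (inv p i))) ` M11" using hb by (simp add: bij_betw_def)
  then show thesis using that p(1) by blast
qed

subsection \<open>Monomial lifts of $M_{11}$ modulo scalars\<close>

text \<open>A relation, since lifts are determined only up to a scalar: \<open>K d t\<close> says
  that the monomial matrix with coefficients \<open>d\<close> is one of the lifts of
  \<open>t\<close>.\<close>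

definition proj_rep :: "((11 \<Rightarrow> complex) \<Rightarrow> perm11 \<Rightarrow> bool) \<Rightarrow> bool" where
  "proj_rep K \<longleftrightarrow> K (\<lambda>_. 1) (\<lambda>i. i)
     \<and> (\<forall>d t e r. K d t \<longrightarrow> K e r \<longrightarrow> K (\<lambda>i. d i * e (t i)) (\<lambda>i. r (t i)))
     \<and> (\<forall>d e t. K d t \<longrightarrow> K e t \<longrightarrow> (\<exists>c. \<forall>i. d i = c * e i))
     \<and> (\<forall>d t c. c \<noteq> 0 \<longrightarrow> K d t \<longrightarrow> K (\<lambda>i. c * d i) t)
     \<and> (\<forall>t\<in>M11. \<exists>d. K d t) \<and> (\<forall>d t. K d t \<longrightarrow> (\<forall>i. d i \<noteq> 0))"

lemma proj_repD:
  assumes "proj_rep K"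
  shows "K (\<lambda>_. 1) (\<lambda>i. i)"
    "K d t \<Longrightarrow> K e r \<Longrightarrow> K (\<lambda>i. d i * e (t i)) (\<lambda>i. r (t i))"
    "K d t \<Longrightarrow> K e t \<Longrightarrow> \<exists>c. \<forall>i. d i = c * e i"
    "c \<noteq> 0 \<Longrightarrow> K d t \<Longrightarrow> K (\<lambda>i. c * d i) t"
    "t \<in> M11 \<Longrightarrow> \<exists>d. K d t" "K d t \<Longrightarrow> d i \<noteq> 0"
  using assms unfolding proj_rep_def by (simp_all, blast)

lemma proj_rep_word:
  assumes "proj_rep K" "\<And>l. l \<in> set w \<Longrightarrow> K (D l) (T l)"
  shows "K (word_coeff D T w) (word_perm T w)"
  using assms(2)
proof (induction w)
  case Nil
  then show ?case using proj_repD(1)[OF assms(1)] by simp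
next
  case (Cons l w)
  have "K (D l) (T l)" "K (word_coeff D T w) (word_perm T w)" using Cons by simp_all
  from proj_repD(2)[OF assms(1), OF this] show ?case by simp
qed

text \<open>The source of all equations for coefficients: both words lift one permutation, so their
  coefficient vectors are proportional.\<close>

lemma proj_rep_relation:
  assumes K: "proj_rep K" and "\<And>l. l \<in> set w \<union> set w' \<Longrightarrow> K (D l) (T l)" "word_perm T w = word_perm T w'"
  obtains c where "\<And>i. word_coeff D T w i = c * word_coeff D T w' i"
proof -
  have "K (word_coeff D T w) (word_perm T w)" "K (word_coeff D T w') (word_perm T w)"
    using proj_rep_word[OF K, of w D T] proj_rep_word[OF K, of w' D T] assms(2,3) by simp_all
  from proj_repD(3)[OF K, OF this] obtain c where "\<forall>i. word_coeff D T w i = c * word_coeff D T w' i" by blast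
  then show thesis using that[of c] by blast
qed

text \<open>The coboundary factor expresses conjugation by the diagonal matrix of
  \<open>b\<close>.\<close>

lemma proj_rep_conj:
  assumes K: "proj_rep K" and b: "\<And>i. b i \<noteq> 0"
  shows "proj_rep (\<lambda>d t. K (\<lambda>i. d i * b (t i) / b i) t)"
  unfolding proj_rep_def
proof (intro conjI allI impI ballI)
  show "K (\<lambda>i. 1 * b i / b i) (\<lambda>i. i)" using proj_repD(1)[OF K] b by simp
next
  fix d t e r assume "K (\<lambda>i. d i * b (t i) / b i) t" "K (\<lambda>i. e i * b (r i) / b i) r"
  from proj_repD(2)[OF K, OF this]
  have "K (\<lambda>i. (d i * b (t i) / b i) * (e (t i) * b (r (t i)) / b (t i))) (\<lambda>i. r (t i))" .
  moreover have "(d i * b (t i) / b i) * (e (t i) * b (r (t i)) / b (t i)) = d i * e (t i) * b (r (t i)) / b i" for i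
    using b[of "t i"] by simp
  ultimately show "K (\<lambda>i. d i * e (t i) * b (r (t i)) / b i) (\<lambda>i. r (t i))" by simp
next
  fix d e t assume "K (\<lambda>i. d i * b (t i) / b i) t" "K (\<lambda>i. e i * b (t i) / b i) t"
  from proj_repD(3)[OF K, OF this] obtain c where c: "\<And>i. d i * b (t i) / b i = c * (e i * b (t i) / b i)" by blast
  have "d i = c * e i" for i using c[of i] b by (simp add: field_simps)
  then show "\<exists>c. \<forall>i. d i = c * e i" by blast
next
  fix d t c assume "c \<noteq> (0::complex)" "K (\<lambda>i. d i * b (t i) / b i) t"
  from proj_repD(4)[OF K, OF this] show "K (\<lambda>i. c * d i * b (t i) / b i) t" by (simp add: mult.assoc)
next
  fix t assume "t \<in> M11"
  then obtain d where "K d t" using proj_repD(5)[OF K] by blast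
  then have "K (\<lambda>i. d i * b i / b (t i) * b (t i) / b i) t" using b by simp
  then show "\<exists>d. K (\<lambda>i. d i * b (t i) / b i) t" by (rule exI[of _ "\<lambda>i. d i * b i / b (t i)"])
next
  fix d t i assume "K (\<lambda>i. d i * b (t i) / b i) t"
  from proj_repD(6)[OF K, OF this, of i] show "d i \<noteq> 0" by auto
qed

lemma prod_const_11: "(\<Prod>i\<in>(UNIV::11 set). c) = (c::complex) ^ 11"
  by simp

text \<open>Partial products of \<open>S\<close> close up around the 11-cycle exactly because the
  total product is one.\<close>

lemma cyclic_potential:
  fixes S :: "11 \<Rightarrow> complex"
  assumes "\<And>i. S i \<noteq> 0" "(\<Prod>i\<in>UNIV. S i) = 1"
  obtains b where "\<And>i. b i \<noteq> 0" "\<And>i. b (i + 1) = S i * b i"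
proof -
  define b :: "11 \<Rightarrow> complex" where "b j = (if j = 0 then 1 else if j = 1 then S 0 else if j = 2 then S 0 * S 1
    else if j = 3 then S 0 * S 1 * S 2 else if j = 4 then S 0 * S 1 * S 2 * S 3
    else if j = 5 then S 0 * S 1 * S 2 * S 3 * S 4 else if j = 6 then S 0 * S 1 * S 2 * S 3 * S 4 * S 5
    else if j = 7 then S 0 * S 1 * S 2 * S 3 * S 4 * S 5 * S 6
    else if j = 8 then S 0 * S 1 * S 2 * S 3 * S 4 * S 5 * S 6 * S 7
    else if j = 9 then S 0 * S 1 * S 2 * S 3 * S 4 * S 5 * S 6 * S 7 * S 8
    else S 0 * S 1 * S 2 * S 3 * S 4 * S 5 * S 6 * S 7 * S 8 * S 9)" for j
  have "\<forall>j. b (j + 1) = S j * b j"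
    using assms(2) unfolding all_11 prod_11 by (simp add: b_def mult_ac)
  moreover have "\<forall>j. b j \<noteq> 0" using assms(1) by (simp add: b_def)
  ultimately show thesis using that by blast
qed

text \<open>A lift of \<open>mu11\<close> conjugates a lift $S$ of \<open>sigma11\<close> into a scalar multiple $z S^3$ with
  $z^{11} = 1$; replacing $S$ by $z^6 S$ absorbs the scalar, because $(z^6)^2 z^{-1} = z^{11} = 1$.\<close>
lemma proj_rep_normal_form:
  assumes K: "proj_rep K"
  obtains b where "\<And>i. b i \<noteq> 0" "K (\<lambda>i. b (sigma11 i) / b i) sigma11" "K (\<lambda>i. b (mu11 i) / b i) mu11"
proof -
  obtain S0 where S0: "K S0 sigma11" using proj_repD(5)[OF K] M11_gens by blast
  have nz0: "\<And>i. S0 i \<noteq> 0" using proj_repD(6)[OF K, OF S0] .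
  define p where "p = (\<Prod>i\<in>UNIV. S0 i)"
  have p0: "p \<noteq> 0" using nz0 by (simp add: p_def prod_zero_iff)
  \<comment> \<open>Product one is what \<open>cyclic_potential\<close> requires, and it confines
    the remaining ambiguity to eleventh roots of unity.\<close>
  obtain r where r: "r ^ 11 = inverse p" by (rule exists_complex_root[of 11 "inverse p"]) simp_all
  have r0: "r \<noteq> 0" using r p0 by auto
  define S where "S i = r * S0 i" for i
  have S: "K S sigma11" using proj_repD(4)[OF K, OF r0 S0] by (simp add: S_def[abs_def])
  have pS: "(\<Prod>i\<in>UNIV. S i) = 1" using p0 by (simp add: S_def prod.distrib prod_const_11 r p_def[symmetric])
  have nzS: "\<And>i. S i \<noteq> 0" using proj_repD(6)[OF K, OF S] .
  obtain U where U: "K U mu11" using proj_repD(5)[OF K] special_in_M11 by blast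
  have nzU: "\<And>i. U i \<noteq> 0" using proj_repD(6)[OF K, OF U] .
  define D where "D l = (if l = 0 then S else U)" for l :: nat
  have bij_mu: "bij mu11" using M11_bij special_in_M11 by blast
  have rel: "word_perm letter4 [0,2] = word_perm letter4 [2,0,0,0]" by (rule letter4_relations)
  obtain z where z: "\<And>i. word_coeff D letter4 [0,2] i = z * word_coeff D letter4 [2,0,0,0] i"
    by (rule proj_rep_relation[OF K _ rel, of D]) (use S U in \<open>auto simp: D_def letter4_def\<close>)
  have z: "S i * U (sigma11 i) = z * (U i * (S (mu11 i) * (S (sigma11 (mu11 i)) * S (sigma11 (sigma11 (mu11 i))))))" for i
    using z[of i] by (simp add: D_def letter4_def)
  have P: "(\<Prod>i\<in>UNIV. U (sigma11 i)) = (\<Prod>i\<in>UNIV. U i)" "(\<Prod>i\<in>UNIV. S (mu11 i)) = 1"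
    "(\<Prod>i\<in>UNIV. S (sigma11 (mu11 i))) = 1" "(\<Prod>i\<in>UNIV. S (sigma11 (sigma11 (mu11 i)))) = 1"
    using prod_bij[OF bij_sigma11, of U] prod_bij[OF bij_mu, of S] prod_bij[OF bij_compose[OF bij_mu bij_sigma11], of S]
      prod_bij[OF bij_compose[OF bij_mu bij_compose[OF bij_sigma11 bij_sigma11]], of S] pS by simp_all
  have "(\<Prod>i\<in>UNIV. S i * U (sigma11 i)) =
      (\<Prod>i\<in>UNIV. z * (U i * (S (mu11 i) * (S (sigma11 (mu11 i)) * S (sigma11 (sigma11 (mu11 i)))))))"
    using z by simp
  then have "(\<Prod>i\<in>UNIV. U i) = z ^ 11 * (\<Prod>i\<in>UNIV. U i)"
    unfolding prod.distrib P pS prod_const_11 by simp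
  moreover have "(\<Prod>i\<in>UNIV. U i) \<noteq> 0" using nzU by (simp add: prod_zero_iff)
  ultimately have z11: "z ^ 11 = 1" by simp
  then have z0: "z \<noteq> 0" by auto
  define S' where "S' i = z ^ 6 * S i" for i
  have S': "K S' sigma11" using proj_repD(4)[OF K, OF _ S, of "z ^ 6"] z0 by (simp add: S'_def[abs_def])
  have nzS': "\<And>i. S' i \<noteq> 0" using proj_repD(6)[OF K, OF S'] .
  have "(z ^ 6) ^ 11 = 1" using z11 by (metis power_mult mult.commute power_one)
  then have pS': "(\<Prod>i\<in>UNIV. S' i) = 1" by (simp add: S'_def prod.distrib prod_const_11 pS)
  have z12: "z ^ 7 = z ^ 18" using z11 power_add[of z 7 11] by simp
  have "S' i * U (sigma11 i) = U i * (S' (mu11 i) * (S' (sigma11 (mu11 i)) * S' (sigma11 (sigma11 (mu11 i)))))" for i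
  proof -
    have "S' i * U (sigma11 i) = z ^ 6 * (S i * U (sigma11 i))" by (simp add: S'_def)
    also have "\<dots> = z ^ 7 * (U i * (S (mu11 i) * (S (sigma11 (mu11 i)) * S (sigma11 (sigma11 (mu11 i))))))"
      by (simp add: z power_Suc[symmetric] eval_nat_numeral)
    also have "\<dots> = U i * (S' (mu11 i) * (S' (sigma11 (mu11 i)) * S' (sigma11 (sigma11 (mu11 i)))))"
      by (simp add: z12 S'_def power_add[of z 6 12, simplified] power_add[of z 6 6, simplified])
    finally show ?thesis .
  qed
  note relU = this
  obtain b where b: "\<And>i. b i \<noteq> 0" "\<And>i. b (i + 1) = S' i * b i"
    by (rule cyclic_potential[OF nzS' pS']) blast
  have S'b: "S' i = b (sigma11 i) / b i" for i using b by (simp add: sigma11_def)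
  \<comment> \<open>\<open>V\<close> compares \<open>U\<close> with the coboundary of
    \<open>b\<close>. By \<open>relU\<close> it is shift invariant, so \<open>U\<close> is a scalar
    multiple of that coboundary.\<close>
  define V where "V i = U i * b i / b (mu11 i)" for i
  have "V (i + 1) = V i" for i
  proof -
    have m: "sigma11 (sigma11 (sigma11 (mu11 i))) = mu11 (sigma11 i)"
      using fun_cong[OF rel, of i] by (simp add: letter4_def)
    have "b (sigma11 i) / b i * U (sigma11 i) = U i * (b (mu11 (sigma11 i)) / b (mu11 i))"
      using relU[of i] b(1) by (simp add: S'b m)
    then have "V (sigma11 i) = V i" using b(1) by (simp add: V_def field_simps)
    then show ?thesis by (simp add: sigma11_def)
  qed
  from shift_invariant_const[of V, OF this] have Vc: "V i = V 0" for i .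
  have V0: "V 0 \<noteq> 0" using nzU b(1) by (simp add: V_def)
  have eq: "inverse (V 0) * U i = b (mu11 i) / b i" for i
    using Vc[of i] V0 b(1)[of i] b(1)[of "mu11 i"] nzU[of i] by (simp add: V_def[of i] field_simps)
  have "K (\<lambda>i. inverse (V 0) * U i) mu11" using proj_repD(4)[OF K, OF _ U, of "inverse (V 0)"] V0 by simp
  then have "K (\<lambda>i. b (mu11 i) / b i) mu11" unfolding eq .
  moreover have "K (\<lambda>i. b (sigma11 i) / b i) sigma11" using S' by (simp add: S'b[symmetric])
  ultimately show thesis using that b(1) by blast
qed

text \<open>The lift of \<open>nu11\<close> reduces to one value on the nonzero squares and one on
  the nonsquares modulo 11. The relation of order 3 makes the second 1 and the first a sign, and the
  word for \<open>tau11\<close> transports the two choices.\<close>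

lemma proj_rep_dichotomy:
  assumes K: "proj_rep K" and s: "K (\<lambda>_. 1) sigma11" and u: "K (\<lambda>_. 1) mu11"
  shows "K (\<lambda>_. 1) tau11 \<or> K (xvec 0) tau11"
proof -
  obtain V0 where V0: "K V0 nu11" using proj_repD(5)[OF K] special_in_M11 by blast
  have nz0: "\<And>i. V0 i \<noteq> 0" using proj_repD(6)[OF K, OF V0] .
  \<comment> \<open>Normalising at 0, which \<open>mu11\<close> and \<open>nu11\<close> fix, makes
    the proportionality constant of the next relation equal to 1.\<close>
  define V where "V i = inverse (V0 0) * V0 i" for i
  have V: "K V nu11" using proj_repD(4)[OF K, OF _ V0, of "inverse (V0 0)"] nz0 by (simp add: V_def[abs_def])
  have v0: "V 0 = 1" using nz0 by (simp add: V_def)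
  have nz: "\<And>i. V i \<noteq> 0" using proj_repD(6)[OF K, OF V] .
  define D where "D l = (if l = 3 then V else (\<lambda>_. 1))" for l :: nat
  have KD: "K (D l) (letter4 l)" if "l \<in> {0, 2, 3}" for l
    using that s u V by (auto simp: D_def letter4_def)
  obtain c where c: "\<And>i. word_coeff D letter4 [2,2,3] i = c * word_coeff D letter4 [3,2] i"
    by (rule proj_rep_relation[OF K _ letter4_relations(2), of D]) (use KD in auto)
  then have c: "V (mu11 (mu11 i)) = c * V i" for i by (simp add: D_def letter4_def)
  from c[of 0] v0 have "c = 1" by simp
  then have orb: "V (mu11 (mu11 i)) = V i" for i using c by simp
  \<comment> \<open>The square of \<open>mu11\<close> is multiplication by 9, whose nonzero orbits
    are the squares 1, 3, 4, 5, 9 and the nonsquares.\<close>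
  define \<beta> where "\<beta> = V 1"
  define \<gamma> where "\<gamma> = V 2"
  have b: "V 1 = \<beta>" "V 9 = \<beta>" "V 4 = \<beta>" "V 3 = \<beta>" "V 5 = \<beta>"
    using orb[of 1] orb[of 9] orb[of 4] orb[of 3] by (simp_all add: \<beta>_def)
  have g: "V 2 = \<gamma>" "V 7 = \<gamma>" "V 8 = \<gamma>" "V 6 = \<gamma>" "V 10 = \<gamma>"
    using orb[of 2] orb[of 7] orb[of 8] orb[of 6] by (simp_all add: \<gamma>_def)
  have bg: "\<beta> \<noteq> 0" "\<gamma> \<noteq> 0" using nz by (simp_all add: \<beta>_def \<gamma>_def)
  obtain k where k: "\<And>i. word_coeff D letter4 [0,0,0,0,0,0,3,0,0,0,0,0,0,3,0,0,0,0,0,0,3] i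
      = k * word_coeff D letter4 [] i"
    by (rule proj_rep_relation[OF K _ letter4_relations(3), of D]) (use KD in auto)
  note k6 = k[of 0] k[of 1] k[of 2] k[of 3] k[of 4] k[of 5] k[of 6] k[of 7] k[of 8] k[of 9] k[of 10]
  note k6 = k6[simplified, simplified D_def letter4_def, simplified, unfolded v0 b g]
  have "\<gamma> = 1" "\<beta> * \<beta> = 1" using k6 bg by auto
  then have cases: "\<gamma> = 1" "\<beta> = 1 \<or> \<beta> = -1" by (simp_all add: square_eq_1_iff)
  have word: "K (word_coeff D letter4 [3,0,0,3,0,2,3]) tau11"
  proof -
    have "word_perm letter4 [3,0,0,3,0,2,3] = tau11" using letter4_relations(5) by (simp add: letter4_def fun_eq_iff)
    then show ?thesis using proj_rep_word[OF K, of "[3,0,0,3,0,2,3]" D letter4] KD by auto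
  qed
  from cases(2) show ?thesis
  proof
    assume "\<beta> = 1"
    then have "\<forall>i. word_coeff D letter4 [3,0,0,3,0,2,3] i = 1"
      unfolding all_11 by (simp add: D_def letter4_def v0 b g cases(1))
    then have "word_coeff D letter4 [3,0,0,3,0,2,3] = (\<lambda>_. 1)" by blast
    then show ?thesis using word by simp
  next
    assume "\<beta> = -1"
    then have "\<forall>i. - word_coeff D letter4 [3,0,0,3,0,2,3] i = xvec 0 i"
      unfolding all_11 by (simp add: D_def letter4_def v0 b g cases(1) xvec_def eps_1)
    then have "(\<lambda>i. - 1 * word_coeff D letter4 [3,0,0,3,0,2,3] i) = xvec 0" by (simp add: fun_eq_iff)
    moreover have "K (\<lambda>i. - 1 * word_coeff D letter4 [3,0,0,3,0,2,3] i) tau11"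
      by (rule proj_repD(4)[OF K, OF _ word]) simp
    ultimately show ?thesis by simp
  qed
qed

subsection \<open>Every group is conjugate to one in the list\<close>

lemma power_gcd_eq_1:
  fixes z :: complex
  assumes "z ^ m = 1" "z ^ n = 1"
  shows "z ^ gcd m n = 1"
proof (cases "m = 0")
  case False
  then obtain x y where "m * x = n * y + gcd m n" using bezout_nat by blast
  then have "(z ^ m) ^ x = (z ^ n) ^ y * z ^ gcd m n" by (simp add: power_mult[symmetric] power_add[symmetric])
  then show ?thesis using assms by simp
qed (use assms in simp)

lemma prime_11: "prime (11::nat)"
  by simp

lemma gcd_11:
  assumes "k mod 11 \<noteq> 0" shows "gcd k (11::nat) = 1"
proof -
  have "\<not> 11 dvd k" using assms by (simp add: dvd_eq_mod_eq_0)
  then have "coprime 11 k" by (rule prime_imp_coprime[OF prime_11])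
  then show ?thesis by (simp add: coprime_iff_gcd_eq_1 gcd.commute)
qed

text \<open>In a group of prime order any nontrivial element is a generator.\<close>

lemma eleventh_roots_generated:
  fixes w e :: complex
  assumes "w ^ 11 = 1" "w \<noteq> 1" "e ^ 11 = 1"
  obtains k where "w ^ k = e"
proof -
  have w0: "w \<noteq> 0" using assms(1) by auto
  have ne: "w ^ i \<noteq> w ^ j" if "i < j" "j < 11" for i j
  proof
    assume "w ^ i = w ^ j"
    then have "w ^ (j - i) = 1" using w0 that(1) by (simp add: power_diff)
    then have "w ^ gcd (j - i) 11 = 1" by (rule power_gcd_eq_1) (rule assms(1))
    moreover have "gcd (j - i) 11 = 1" by (rule gcd_11) (use that in simp)
    ultimately show False using assms(2) by simp
  qed
  have inj: "inj_on (\<lambda>k. w ^ k) {..<11}"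
  proof (rule inj_onI)
    fix i j assume h: "i \<in> {..<11}" "j \<in> {..<11}" "w ^ i = w ^ j"
    show "i = j" using ne[of i j] ne[of j i] h by (metis lessThan_iff linorder_neqE_nat)
  qed
  have sub: "(\<lambda>k. w ^ k) ` {..<11} \<subseteq> {z. z ^ 11 = 1}"
  proof safe
    fix k
    have "(w ^ k) ^ 11 = (w ^ 11) ^ k" by (simp only: power_mult[symmetric] mult.commute)
    then show "(w ^ k) ^ 11 = 1" by (simp only: assms(1) power_one)
  qed
  have fin: "finite {z::complex. z ^ 11 = 1}" by (rule finite_roots_unity) simp
  have "card {z::complex. z ^ 11 = 1} = 11" by (rule card_roots_unity_eq) simp
  then have "(\<lambda>k. w ^ k) ` {..<11} = {z. z ^ 11 = 1}"
    using card_subset_eq[OF fin sub] card_image[OF inj] by simp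
  then have "e \<in> (\<lambda>k. w ^ k) ` {..<11}" using assms(3) by simp
  then show thesis using that by blast
qed

lemma diag_group_torsion_cases:
  assumes A: "diag_group A" and N: "N > 0"
    and X: "\<And>x. (\<forall>i. x i ^ N = 1) \<Longrightarrow> (\<Prod>i\<in>UNIV. x i) = 1 \<Longrightarrow> x \<in> A"
    and pow: "\<And>a i j. a \<in> A \<Longrightarrow> a i ^ N = a j ^ N"
    and no: "\<not> (11 dvd N \<and> (\<forall>a\<in>A. a 0 ^ N = (\<Prod>i\<in>UNIV. a i) ^ (N div 11)))"
    and z: "\<And>i. z i ^ N = 1"
  obtains c a where "c \<noteq> 0" "a \<in> A" "\<And>i. z i = c * a i"
proof -
  define \<delta> where "\<delta> = (\<Prod>i\<in>UNIV. z i)"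
  have \<delta>N: "\<delta> ^ N = 1" unfolding \<delta>_def prod_power_distrib using z by simp
  then have \<delta>0: "\<delta> \<noteq> 0" using N by (auto simp: power_0_left)
  show thesis
  proof (cases "11 dvd N")
    case False
    then have "gcd 11 N = 1" using gcd_11[of N] by (simp add: dvd_eq_mod_eq_0 gcd.commute)
    then obtain x y where xy: "11 * x = N * y + 1" using bezout_nat[of 11 N] by auto
    \<comment> \<open>As 11 is invertible modulo \<open>N\<close>, the product \<delta> has an
      eleventh root among the \<open>N\<close>-th roots of unity; dividing by it lands in
      $X[N]$.\<close>
    define c where "c = \<delta> ^ x"
    have "c ^ 11 = \<delta> ^ (N * y + 1)" unfolding c_def xy[symmetric] by (simp add: power_mult[symmetric] mult.commute)
    then have c11: "c ^ 11 = \<delta>" using \<delta>N by (simp add: power_add power_mult)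
    have cN: "c ^ N = 1" unfolding c_def by (metis \<delta>N power_mult mult.commute power_one)
    have c0: "c \<noteq> 0" using \<delta>0 by (simp add: c_def)
    have "(\<lambda>i. z i / c) \<in> A"
    proof (rule X)
      show "\<forall>i. (z i / c) ^ N = 1" using z cN by (simp add: power_divide)
      show "(\<Prod>i\<in>UNIV. z i / c) = 1" using \<delta>0 by (simp add: prod_dividef c11 \<delta>_def[symmetric])
    qed
    then show thesis using that[of c "\<lambda>i. z i / c"] c0 by simp
  next
    case True
    then obtain M where M: "N = 11 * M" by blast
    then obtain a where a: "a \<in> A" "a 0 ^ N \<noteq> (\<Prod>i\<in>UNIV. a i) ^ M" using no by auto
    have a0: "\<And>i. a i \<noteq> 0" using diag_groupD(4)[OF A a(1)] .
    define y where "y i = a i / a 0" for i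
    have yN: "y i ^ N = 1" for i using pow[OF a(1), of i 0] a0 by (simp add: y_def power_divide)
    define w where "w = (\<Prod>i\<in>UNIV. y i) ^ M"
    have wA: "w = (\<Prod>i\<in>UNIV. a i) ^ M / a 0 ^ N"
      by (simp add: w_def y_def prod_dividef power_divide M power_mult)
    then have w1: "w \<noteq> 1" using a(2) a0 by auto
    have "(\<Prod>i\<in>UNIV. y i) ^ N = 1" unfolding prod_power_distrib using yN by simp
    then have w11: "w ^ 11 = 1" by (simp add: w_def M power_mult[symmetric] mult.commute)
    have "(\<delta> ^ M) ^ 11 = 1" using \<delta>N by (simp add: M power_mult[symmetric] mult.commute)
    then obtain k where k: "w ^ k = \<delta> ^ M" by (rule eleventh_roots_generated[OF w11 w1])
    \<comment> \<open>Dividing by the matching power of \<open>y\<close> leaves a product \<eta> of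
      order dividing \<open>M\<close>, which is the eleventh power of an \<open>N\<close>-th root of
      unity.\<close>
    define \<eta> where "\<eta> = \<delta> / (\<Prod>i\<in>UNIV. y i) ^ k"
    have py0: "(\<Prod>i\<in>UNIV. y i) \<noteq> 0" using a0 by (simp add: y_def prod_zero_iff)
    have "w ^ k \<noteq> 0" using w11 by auto
    moreover have "\<eta> ^ M = \<delta> ^ M / w ^ k"
      by (simp add: \<eta>_def w_def power_divide power_mult[symmetric] mult.commute)
    ultimately have \<eta>M: "\<eta> ^ M = 1" using k by simp
    have \<eta>0: "\<eta> \<noteq> 0" using \<delta>0 py0 by (simp add: \<eta>_def)
    obtain c where c: "\<eta> = c ^ 11" by (rule exists_complex_root[of 11]) auto
    have c0: "c \<noteq> 0" using c \<eta>0 by auto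
    have cN: "c ^ N = 1" using \<eta>M by (simp add: c M power_mult)
    have ykN: "(y i ^ k) ^ N = 1" for i by (metis yN power_mult mult.commute power_one)
    have "(\<lambda>i. z i / (c * y i ^ k)) \<in> A"
    proof (rule X)
      show "\<forall>i. (z i / (c * y i ^ k)) ^ N = 1" using z cN ykN by (simp add: power_divide power_mult_distrib)
      have "(\<Prod>i\<in>UNIV. z i / (c * y i ^ k)) = \<delta> / (c ^ 11 * (\<Prod>i\<in>UNIV. y i) ^ k)"
        by (simp add: prod_dividef prod.distrib prod_power_distrib \<delta>_def)
      also have "\<dots> = 1" using \<delta>0 py0 by (simp add: c[symmetric] \<eta>_def)
      finally show "(\<Prod>i\<in>UNIV. z i / (c * y i ^ k)) = 1" .
    qed
    from diag_groupD(2)[OF A this diag_group_power[OF A a(1), of k]]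
    have mem: "(\<lambda>i. z i / (c * y i ^ k) * a i ^ k) \<in> A" .
    have eq: "z i = (c / a 0 ^ k) * (z i / (c * y i ^ k) * a i ^ k)" for i
      using a0[of 0] a0[of i] c0 by (simp add: y_def power_divide)
    show thesis by (rule that[OF _ mem eq]) (use c0 a0 in simp)
  qed
qed

lemma diag_group_det_kernel:
  fixes h :: "11 \<Rightarrow> complex"
  assumes N: "N = 11 * M" "N > 0"
    and X: "\<And>x. (\<forall>i. x i ^ N = 1) \<Longrightarrow> (\<Prod>i\<in>UNIV. x i) = 1 \<Longrightarrow> x \<in> A"
    and h: "\<And>i. h i \<noteq> 0" "\<And>i. h i ^ N = (\<Prod>i\<in>UNIV. h i) ^ M"
  obtains c a where "c \<noteq> 0" "a \<in> A" "\<And>i. h i = c * a i"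
proof -
  define y where "y i = h i / h 0" for i
  define \<delta> where "\<delta> = (\<Prod>i\<in>UNIV. y i)"
  have yN: "y i ^ N = 1" for i
  proof -
    have "h i ^ N = h 0 ^ N" using h(2)[of i] h(2)[of 0] by (rule trans[OF _ sym])
    then show ?thesis using h(1)[of 0] by (simp add: y_def power_divide)
  qed
  have \<delta>0: "\<delta> \<noteq> 0" using h(1) by (simp add: \<delta>_def y_def prod_zero_iff)
  have \<delta>h: "\<delta> = (\<Prod>i\<in>UNIV. h i) / h 0 ^ 11" by (simp add: \<delta>_def y_def prod_dividef)
  have "\<delta> ^ M = h 0 ^ N / h 0 ^ N"
    unfolding \<delta>h power_divide h(2)[of 0, symmetric] by (simp add: N(1) power_mult)
  then have \<delta>M: "\<delta> ^ M = 1" using h(1)[of 0] by simp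
  obtain r where r: "\<delta> = r ^ 11" by (rule exists_complex_root[of 11]) auto
  have r0: "r \<noteq> 0" using r \<delta>0 by auto
  have mem: "(\<lambda>i. y i / r) \<in> A"
  proof (rule X)
    show "\<forall>i. (y i / r) ^ N = 1" using yN \<delta>M by (simp add: power_divide r N(1) power_mult)
    show "(\<Prod>i\<in>UNIV. y i / r) = 1" using \<delta>0 by (simp add: prod_dividef r[symmetric] \<delta>_def[symmetric])
  qed
  have eq: "h i = (h 0 * r) * (y i / r)" for i using r0 h(1)[of 0] by (simp add: y_def)
  show thesis by (rule that[OF _ mem eq]) (use r0 h(1)[of 0] in simp)
qed

section \<open>Monomial groups whose permutations are exactly those of \<open>M11\<close>\<close>

definition lifts_M11 :: "cmat11 set \<Rightarrow> bool" where
  "lifts_M11 G \<longleftrightarrow> mat_group G \<and> (\<forall>g\<in>G. \<exists>d t. g = mon d t \<and> (\<forall>i. d i \<noteq> 0) \<and> t \<in> M11)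
     \<and> (\<forall>t\<in>M11. \<exists>d. (\<forall>i. d i \<noteq> 0) \<and> mon d t \<in> G)"

definition diag_part :: "cmat11 set \<Rightarrow> (11 \<Rightarrow> complex) set" where
  "diag_part G = {a. mon a (\<lambda>i. i) \<in> G}"

lemma lifts_M11_nonzero:
  assumes "lifts_M11 G" "mon d t \<in> G" shows "d i \<noteq> 0" "t \<in> M11"
proof -
  obtain e r where "mon d t = mon e r" "\<forall>i. e i \<noteq> 0" "r \<in> M11" using assms unfolding lifts_M11_def by metis
  then have "d = e" "t = r" using mon_eq_iff[of e r d t] by auto
  then show "d i \<noteq> 0" "t \<in> M11" using \<open>\<forall>i. e i \<noteq> 0\<close> \<open>r \<in> M11\<close> by simp_all
qed

lemma lifts_M11_diag_part:
  assumes G: "lifts_M11 G"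
  shows "diag_group (diag_part G)" "p \<in> M11 \<Longrightarrow> a \<in> diag_part G \<Longrightarrow> (\<lambda>i. a (p i)) \<in> diag_part G"
proof -
  have mg: "mat_group G" using G by (simp add: lifts_M11_def)
  show "diag_group (diag_part G)" unfolding diag_part_def
    by (rule diag_group_of_mat_group[OF mg]) (rule lifts_M11_nonzero[OF G])
  assume p: "p \<in> M11" and a: "a \<in> diag_part G"
  obtain d where d: "\<And>i. d i \<noteq> 0" "mon d p \<in> G" using G p unfolding lifts_M11_def by blast
  have bp: "bij p" using p M11_bij by blast
  have "mon a (\<lambda>i. i) \<in> G" using a by (simp add: diag_part_def)
  from mon_mult_in[OF mg mon_mult_in[OF mg d(2) this] mon_inv_in[OF mg d(2,1) bp]]
  have "mon (\<lambda>i. d i * a (p i) * inverse (d i)) (\<lambda>i. i) \<in> G" by (simp add: bp)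
  moreover have "d i * a (p i) * inverse (d i) = a (p i)" for i using d(1)[of i] by simp
  ultimately show "(\<lambda>i. a (p i)) \<in> diag_part G" by (simp add: diag_part_def)
qed

lemma lifts_M11_ratio:
  assumes G: "lifts_M11 G" and d: "mon d t \<in> G" and e: "mon e t \<in> G"
  shows "(\<lambda>i. d i / e i) \<in> diag_part G"
proof -
  have "mat_group G" using G by (simp add: lifts_M11_def)
  from mon_divide_in[OF this d e lifts_M11_nonzero(1)[OF G e] M11_bij[OF lifts_M11_nonzero(2)[OF G e]]]
  show ?thesis by (simp add: diag_part_def)
qed

lemma mat_group_conj:
  assumes G: "mat_group G" and g: "invertible g"
  shows "mat_group ((\<lambda>h. g ** h ** matrix_inv g) ` G)" (is "mat_group ?H")
  unfolding mat_group_def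
proof (intro conjI ballI)
  have "g ** mat 1 ** matrix_inv g = mat 1" by (simp add: matrix_inv_invertible[OF g])
  then show "mat 1 \<in> ?H" using mat_groupD(1)[OF G] by (metis image_eqI)
  fix x assume "x \<in> ?H"
  then obtain h where h: "h \<in> G" "x = g ** h ** matrix_inv g" by blast
  have ih: "invertible h" using mat_groupD(3)[OF G h(1)] .
  show "invertible x" unfolding h(2) by (intro invertible_mult g ih invertible_matrix_inv)
  show "matrix_inv x \<in> ?H" unfolding h(2) conj_inv[OF g ih] using mat_groupD(4)[OF G h(1)] by blast
  fix y assume "y \<in> ?H"
  then obtain k where k: "k \<in> G" "y = g ** k ** matrix_inv g" by blast
  show "x ** y \<in> ?H" unfolding h(2) k(2) conj_mult[OF g] using mat_groupD(2)[OF G h(1) k(1)] by blast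
qed

lemma conj_by_diag:
  assumes G: "lifts_M11 G" and b: "\<And>i. b i \<noteq> (0::complex)"
  defines "G' \<equiv> (\<lambda>g. mon b (\<lambda>i. i) ** g ** matrix_inv (mon b (\<lambda>i. i))) ` G"
  shows "lifts_M11 G'" "diag_part G' = diag_part G" "mon d t \<in> G' \<longleftrightarrow> mon (\<lambda>i. d i * b (t i) / b i) t \<in> G"
proof -
  have mg: "mat_group G" using G by (simp add: lifts_M11_def)
  have im: "mon b (\<lambda>i. i) ** mon e r ** matrix_inv (mon b (\<lambda>i. i)) = mon (\<lambda>i. b i * e i / b (r i)) r" for e r
    by (simp add: matrix_inv_diag b mon_mult divide_inverse)
  show mem: "mon d t \<in> G' \<longleftrightarrow> mon (\<lambda>i. d i * b (t i) / b i) t \<in> G" for d t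
  proof
    assume "mon d t \<in> G'"
    then obtain g where g: "g \<in> G" "mon d t = mon b (\<lambda>i. i) ** g ** matrix_inv (mon b (\<lambda>i. i))" unfolding G'_def by blast
    obtain e r where er: "g = mon e r" "\<forall>i. e i \<noteq> 0" using G g(1) unfolding lifts_M11_def by blast
    have nz: "b i * e i / b (r i) \<noteq> 0" for i using b er(2) by simp
    have "mon (\<lambda>i. b i * e i / b (r i)) r = mon d t" using g(2) by (simp add: er(1) im)
    then have "d = (\<lambda>i. b i * e i / b (r i))" "t = r"
      using mon_eq_iff[of "\<lambda>i. b i * e i / b (r i)" r d t, OF nz] by auto
    then have "mon (\<lambda>i. d i * b (t i) / b i) t = g" using b by (simp add: er(1))
    then show "mon (\<lambda>i. d i * b (t i) / b i) t \<in> G" using g(1) by simp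
  next
    assume "mon (\<lambda>i. d i * b (t i) / b i) t \<in> G"
    then have "mon b (\<lambda>i. i) ** mon (\<lambda>i. d i * b (t i) / b i) t ** matrix_inv (mon b (\<lambda>i. i)) \<in> G'"
      unfolding G'_def by blast
    then show "mon d t \<in> G'" using b by (simp add: im)
  qed
  show "diag_part G' = diag_part G" unfolding diag_part_def mem using b by simp
  have ib: "invertible (mon b (\<lambda>i. i))" by (rule invertible_mon[OF b bij_id[unfolded id_def]])
  show "lifts_M11 G'" unfolding lifts_M11_def
  proof (intro conjI ballI)
    show "mat_group G'" unfolding G'_def by (rule mat_group_conj[OF mg ib])
  next
    fix x assume "x \<in> G'"
    then obtain g where g: "g \<in> G" "x = mon b (\<lambda>i. i) ** g ** matrix_inv (mon b (\<lambda>i. i))" unfolding G'_def by blast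
    obtain e r where er: "g = mon e r" "\<forall>i. e i \<noteq> 0" "r \<in> M11" using G g(1) unfolding lifts_M11_def by blast
    show "\<exists>d t. x = mon d t \<and> (\<forall>i. d i \<noteq> 0) \<and> t \<in> M11"
      unfolding g(2) er(1) im by (intro exI[of _ "\<lambda>i. b i * e i / b (r i)"] exI[of _ r]) (simp add: er b)
  next
    fix t assume "t \<in> M11"
    then obtain e where e: "\<forall>i. e i \<noteq> 0" "mon e t \<in> G" using G unfolding lifts_M11_def by blast
    have "mon (\<lambda>i. b i * e i / b (t i)) t \<in> G'" unfolding mem using e(2) b by simp
    then show "\<exists>d. (\<forall>i. d i \<noteq> 0) \<and> mon d t \<in> G'"
      by (intro exI[of _ "\<lambda>i. b i * e i / b (t i)"]) (simp add: e b)
  qed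
qed

text \<open>Entrywise powers respect products of monomial matrices, and two lifts of one permutation
  differ by a diagonal element of the group, whose \<open>N\<close>-th power is scalar.\<close>

lemma proj_rep_powers:
  assumes G: "lifts_M11 G" and pow: "\<And>a i j. a \<in> diag_part G \<Longrightarrow> a i ^ N = a j ^ N"
  shows "proj_rep (\<lambda>d t. \<exists>g c. c \<noteq> 0 \<and> mon g t \<in> G \<and> (\<forall>i. d i = c * g i ^ N))"
  unfolding proj_rep_def
proof (intro conjI allI impI ballI)
  have mg: "mat_group G" using G by (simp add: lifts_M11_def)
  show "\<exists>g c. c \<noteq> 0 \<and> mon g (\<lambda>i. i) \<in> G \<and> (\<forall>i. 1 = c * g i ^ N)"
    using mat_groupD(1)[OF mg] unfolding mat_eq_mon by (intro exI[of _ "\<lambda>_. 1"] exI[of _ 1]) simp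
  show "\<exists>g c. c \<noteq> 0 \<and> mon g (\<lambda>i. r (t i)) \<in> G \<and> (\<forall>i. d i * e (t i) = c * g i ^ N)"
    if d: "\<exists>g c. c \<noteq> 0 \<and> mon g t \<in> G \<and> (\<forall>i. d i = c * g i ^ N)"
      and e: "\<exists>g c. c \<noteq> 0 \<and> mon g r \<in> G \<and> (\<forall>i. e i = c * g i ^ N)" for d e :: "11 \<Rightarrow> complex" and t r
  proof -
    obtain g c where g: "c \<noteq> 0" "mon g t \<in> G" "\<forall>i. d i = c * g i ^ N" using d by blast
    obtain h k where h: "k \<noteq> 0" "mon h r \<in> G" "\<forall>i. e i = k * h i ^ N" using e by blast
    show ?thesis
      by (intro exI[of _ "\<lambda>i. g i * h (t i)"] exI[of _ "c * k"])
        (use g h mon_mult_in[OF mg g(2) h(2)] in \<open>simp add: power_mult_distrib\<close>)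
  qed
  show "\<exists>c. \<forall>i. d i = c * e i"
    if d: "\<exists>g c. c \<noteq> 0 \<and> mon g t \<in> G \<and> (\<forall>i. d i = c * g i ^ N)"
      and e: "\<exists>g c. c \<noteq> 0 \<and> mon g t \<in> G \<and> (\<forall>i. e i = c * g i ^ N)" for d e :: "11 \<Rightarrow> complex" and t
  proof -
    obtain g c where g: "c \<noteq> 0" "mon g t \<in> G" "\<forall>i. d i = c * g i ^ N" using d by blast
    obtain h k where h: "k \<noteq> 0" "mon h t \<in> G" "\<forall>i. e i = k * h i ^ N" using e by blast
    have r: "(g i / h i) ^ N = (g 0 / h 0) ^ N" for i using pow[OF lifts_M11_ratio[OF G g(2) h(2)]] .
    have "d i = (c * (g 0 / h 0) ^ N / k) * e i" for i
      using g h(1,3) lifts_M11_nonzero(1)[OF G h(2), of i] unfolding r[of i, symmetric] by (simp add: power_divide)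
    then show ?thesis by blast
  qed
  show "\<exists>g c. c \<noteq> 0 \<and> mon g t \<in> G \<and> (\<forall>i. k * d i = c * g i ^ N)"
    if "k \<noteq> 0" "\<exists>g c. c \<noteq> 0 \<and> mon g t \<in> G \<and> (\<forall>i. d i = c * g i ^ N)" for d :: "11 \<Rightarrow> complex" and t k
    using that by (metis mult.assoc mult_eq_0_iff)
  show "\<exists>d g c. c \<noteq> 0 \<and> mon g t \<in> G \<and> (\<forall>i. d i = c * g i ^ N)" if t: "t \<in> M11" for t
  proof -
    obtain g where "mon g t \<in> G" using G t unfolding lifts_M11_def by blast
    then show ?thesis by (intro exI[of _ "\<lambda>i. g i ^ N"] exI[of _ g] exI[of _ 1]) simp
  qed
  show "d i \<noteq> 0" if "\<exists>g c. c \<noteq> 0 \<and> mon g t \<in> G \<and> (\<forall>i. d i = c * g i ^ N)" for d :: "11 \<Rightarrow> complex" and t i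
    using that lifts_M11_nonzero(1)[OF G] by auto
qed

lemma prod_word_perm:
  assumes "bij t" shows "(\<Prod>i\<in>UNIV. d i * e (t i)) = (\<Prod>i\<in>UNIV. d i) * (\<Prod>i\<in>UNIV. e i :: complex)"
  using prod_bij[OF assms, of e] by (simp add: prod.distrib)

lemma eq_1_if_square_and_eleventh:
  fixes z :: complex
  assumes "z ^ 2 = 1" "z ^ 11 = 1" shows "z = 1"
  using power_gcd_eq_1[OF assms] gcd_11[of 2] by simp

text \<open>If 11 divides $N$ and $A$ is as small as possible, then $g \mapsto g^N (\det g)^{-N/11}$ (up to the
  sign of the permutation) kills $A$, so it is a genuine representation on $G$; the relations
  $us^3 = su$ and $w_2^2 = 1$ then pin down the scalars that are invisible to $g \mapsto g^N$.\<close>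
lemma scalar_normal_form:
  assumes G: "lifts_M11 G" and N: "N > 0"
    and X: "\<And>x. (\<forall>i. x i ^ N = 1) \<Longrightarrow> (\<Prod>i\<in>UNIV. x i) = 1 \<Longrightarrow> x \<in> diag_part G"
    and pow: "\<And>a i j. a \<in> diag_part G \<Longrightarrow> a i ^ N = a j ^ N"
    and h: "mon h sigma11 \<in> G" "\<And>i. h i ^ N = c1"
    and U: "mon U mu11 \<in> G" "\<And>i. U i ^ N = c2"
    and k: "mon k tau11 \<in> G" "\<And>i. k i ^ N = c3 * x i ^ N"
    and x: "\<And>i. x i \<noteq> 0" "(\<Prod>i\<in>UNIV. x i) = 1" "x 0 ^ N * x (tau11 0) ^ N = 1"
  obtains l m where "l \<noteq> 0" "m \<noteq> 0" "mon (\<lambda>_. l) sigma11 \<in> G" "mon (\<lambda>i. m * x i) tau11 \<in> G"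
proof -
  define A where "A = diag_part G"
  have mg: "mat_group G" using G by (simp add: lifts_M11_def)
  have A: "diag_group A" unfolding A_def by (rule lifts_M11_diag_part(1)[OF G])
  note X = X[folded A_def] and pow = pow[folded A_def]
  have nz: "h i \<noteq> 0" "U i \<noteq> 0" "k i \<noteq> 0" for i
    using lifts_M11_nonzero(1)[OF G] h(1) U(1) k(1) by blast+
  have c0: "c1 \<noteq> 0" "c2 \<noteq> 0" "c3 \<noteq> 0" using h(2)[of 0] U(2)[of 0] k(2)[of 0] nz by auto
  define q where "q i = k i / x i" for i
  have qN: "q i ^ N = c3" for i using k(2)[of i] x(1)[of i] by (simp add: q_def power_divide)
  have q0: "q i \<noteq> 0" for i using nz(3) x(1) by (simp add: q_def)
  have "\<exists>l a. l \<noteq> 0 \<and> a \<in> A \<and> (\<forall>i. h i = l * a i)" "\<exists>m a. m \<noteq> 0 \<and> a \<in> A \<and> (\<forall>i. q i = m * a i)"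
  proof -
    have "(\<exists>l a. l \<noteq> 0 \<and> a \<in> A \<and> (\<forall>i. h i = l * a i)) \<and> (\<exists>m a. m \<noteq> 0 \<and> a \<in> A \<and> (\<forall>i. q i = m * a i))"
    proof (cases "11 dvd N \<and> (\<forall>a\<in>A. a 0 ^ N = (\<Prod>i\<in>UNIV. a i) ^ (N div 11))")
      case False
      have scal: "\<exists>l a. l \<noteq> 0 \<and> a \<in> A \<and> (\<forall>i. f i = l * a i)"
        if f: "\<And>i. f i \<noteq> 0" "\<And>i. f i ^ N = c" for f and c :: complex
      proof -
        have "c \<noteq> 0" using f(1)[of 0] f(2)[of 0] by auto
        then have r: "(f i / f 0) ^ N = 1" for i by (simp add: power_divide f(2))
        obtain c' a where ca: "c' \<noteq> 0" "a \<in> A" "\<And>i. f i / f 0 = c' * a i"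
          by (rule diag_group_torsion_cases[where z = "\<lambda>i. f i / f 0", OF A N X pow False r]) blast+
        have "f i = (c' * f 0) * a i" for i
        proof -
          have "f i = (f i / f 0) * f 0" using f(1)[of 0] by simp
          then show ?thesis unfolding ca(3) by (simp only: mult_ac)
        qed
        moreover have "c' * f 0 \<noteq> 0" using f(1)[of 0] ca(1) by simp
        ultimately show ?thesis using ca(2) by blast
      qed
      show ?thesis using scal[of h c1, OF nz(1) h(2)] scal[of q c3, OF q0 qN] by blast
    next
      case True
      then obtain M where M: "N = 11 * M" by blast
      have ker: "a 0 ^ N = (\<Prod>i\<in>UNIV. a i) ^ M" if "a \<in> A" for a using True that M by simp
      define P where "P = (\<Prod>i\<in>UNIV. h i)"
      define Q where "Q = (\<Prod>i\<in>UNIV. U i)"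
      define R where "R = (\<Prod>i\<in>UNIV. k i)"
      have PQR: "P \<noteq> 0" "Q \<noteq> 0" "R \<noteq> 0" unfolding P_def Q_def R_def using nz by (simp_all add: prod_zero_iff)
      have b: "bij sigma11" "bij mu11" "bij tau11" using M11_bij M11_gens special_in_M11 by blast+
      have comm: "(\<lambda>i. mu11 (sigma11 i)) = (\<lambda>i. sigma11 (sigma11 (sigma11 (mu11 i))))"
        using letter4_relations(1) by (simp add: letter4_def)
      have e1: "mon (\<lambda>i. h i * U (sigma11 i)) (\<lambda>i. mu11 (sigma11 i)) \<in> G" by (rule mon_mult_in[OF mg h(1) U(1)])
      have e2: "mon (\<lambda>i. h i * (h (sigma11 i) * h (sigma11 (sigma11 i)))) (\<lambda>i. sigma11 (sigma11 (sigma11 i))) \<in> G"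
        by (rule mon_mult_in[OF mg h(1) mon_mult_in[OF mg h(1) h(1)]])
      define s3 where "s3 i = h i * (h (sigma11 i) * h (sigma11 (sigma11 i)))" for i
      have e3: "mon (\<lambda>i. U i * s3 (mu11 i)) (\<lambda>i. sigma11 (sigma11 (sigma11 (mu11 i)))) \<in> G"
        using mon_mult_in[OF mg U(1) e2] by (simp add: s3_def)
      define a where "a i = (h i * U (sigma11 i)) / (U i * s3 (mu11 i))" for i
      have a: "a \<in> A" using lifts_M11_ratio[OF G e1[unfolded comm] e3] by (simp add: A_def a_def[abs_def])
      have aN: "a 0 ^ N = c1 * c2 / (c2 * c1 ^ 3)"
          unfolding a_def s3_def power_divide power_mult_distrib h(2) U(2) by (simp add: power3_eq_cube)
      have ps3: "(\<Prod>i\<in>UNIV. s3 i) = P ^ 3"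
        unfolding s3_def prod_word_perm[OF b(1), of h "\<lambda>i. h i * h (sigma11 i)"] prod_word_perm[OF b(1), of h h]
        by (simp add: P_def power3_eq_cube)
      have "(\<Prod>i\<in>UNIV. a i) = (P * Q) / (Q * P ^ 3)"
        unfolding a_def prod_dividef prod_word_perm[OF b(1)] prod_word_perm[OF b(2)] ps3 by (simp add: P_def Q_def)
      then have "c1 * c2 / (c2 * c1 ^ 3) = ((P * Q) / (Q * P ^ 3)) ^ M" using ker[OF a] aN by simp
      \<comment> \<open>The value of that quotient on \<open>h\<close> equals its value on the third
        power of \<open>h\<close>, hence has square 1. Its eleventh power is 1 too, since
        \<open>P ^ N\<close> is \<open>c1 ^ 11\<close>.\<close>
      then have "(c1 / P ^ M) ^ 2 = 1"
        using c0 PQR by (simp add: power_divide power_mult_distrib field_simps power2_eq_square power3_eq_cube)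
      moreover have "(c1 / P ^ M) ^ 11 = 1"
      proof -
        have "P ^ N = (\<Prod>i\<in>(UNIV::11 set). c1)" unfolding P_def prod_power_distrib h(2) ..
        then have "P ^ N = c1 ^ 11" by simp
        moreover have "(P ^ M) ^ 11 = P ^ N" unfolding M power_mult[symmetric] by (simp add: mult.commute)
        ultimately show ?thesis using c0 by (simp add: power_divide)
      qed
      ultimately have "c1 / P ^ M = 1" by (rule eq_1_if_square_and_eleventh)
      then have hP: "h i ^ N = (\<Prod>i\<in>UNIV. h i) ^ M" for i using PQR by (simp add: h(2) P_def)
      have tt: "(\<lambda>i. tau11 (tau11 i)) = (\<lambda>i. i)" by (simp add: tau11_involution)
      \<comment> \<open>For \<open>tau11\<close> the square of the lift is diagonal and gives the
        same conclusion; \<open>x\<close> contributes nothing because its product is one.\<close>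
      define a' where "a' i = k i * k (tau11 i)" for i
      have a': "a' \<in> A" using mon_mult_in[OF mg k(1) k(1)] unfolding tt A_def diag_part_def a'_def[abs_def] by simp
      have "a' 0 ^ N = c3 ^ 2 * (x 0 ^ N * x (tau11 0) ^ N)"
        by (simp only: a'_def power_mult_distrib k(2)) (simp add: power2_eq_square)
      then have a'N: "a' 0 ^ N = c3 ^ 2" by (simp only: x(3)) simp
      have "(\<Prod>i\<in>UNIV. a' i) = R ^ 2"
        unfolding a'_def prod_word_perm[OF b(3)] by (simp add: R_def power2_eq_square)
      then have "c3 ^ 2 = (R ^ 2) ^ M" using ker[OF a'] a'N by simp
      then have "(c3 / R ^ M) ^ 2 = 1"
        using c0 PQR by (simp add: power_divide power_mult[symmetric] mult.commute)
      moreover have "(c3 / R ^ M) ^ 11 = 1"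
      proof -
        have "R = (\<Prod>i\<in>UNIV. q i)" using x(2) by (simp add: R_def q_def prod_dividef)
        then have "R ^ N = (\<Prod>i\<in>(UNIV::11 set). c3)" by (simp only: prod_power_distrib qN)
        then have "R ^ N = c3 ^ 11" by simp
        moreover have "(R ^ M) ^ 11 = R ^ N" unfolding M power_mult[symmetric] by (simp add: mult.commute)
        ultimately show ?thesis using c0 by (simp add: power_divide)
      qed
      ultimately have "c3 / R ^ M = 1" by (rule eq_1_if_square_and_eleventh)
      moreover have "R = (\<Prod>i\<in>UNIV. q i)" using x(2) by (simp add: R_def q_def prod_dividef)
      ultimately have qP: "q i ^ N = (\<Prod>i\<in>UNIV. q i) ^ M" for i using PQR by (simp add: qN)
      obtain l a where "l \<noteq> 0" "a \<in> A" "\<And>i. h i = l * a i"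
        by (rule diag_group_det_kernel[OF M N X nz(1) hP]) blast+
      moreover obtain m a' where "m \<noteq> 0" "a' \<in> A" "\<And>i. q i = m * a' i"
        by (rule diag_group_det_kernel[OF M N X q0 qP]) blast+
      ultimately show ?thesis by blast
    qed
    then show "\<exists>l a. l \<noteq> 0 \<and> a \<in> A \<and> (\<forall>i. h i = l * a i)" "\<exists>m a. m \<noteq> 0 \<and> a \<in> A \<and> (\<forall>i. q i = m * a i)" by blast+
  qed
  then obtain l a m a' where la: "l \<noteq> 0" "a \<in> A" "\<forall>i. h i = l * a i" and ma: "m \<noteq> 0" "a' \<in> A" "\<forall>i. q i = m * a' i"
    by blast
  have "mon (\<lambda>i. inverse (a i)) (\<lambda>i. i) \<in> G" "mon (\<lambda>i. inverse (a' i)) (\<lambda>i. i) \<in> G"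
    using diag_groupD(3)[OF A la(2)] diag_groupD(3)[OF A ma(2)] by (simp_all add: A_def diag_part_def)
  from mon_mult_in[OF mg this(1) h(1)] mon_mult_in[OF mg this(2) k(1)]
  have "mon (\<lambda>i. inverse (a i) * h i) sigma11 \<in> G" "mon (\<lambda>i. inverse (a' i) * k i) tau11 \<in> G" .
  moreover have "inverse (a i) * h i = l" for i using la(3) diag_groupD(4)[OF A la(2), of i] by simp
  moreover have "inverse (a' i) * k i = m * x i" for i
  proof -
    have "k i / x i = m * a' i" using ma(3) by (simp add: q_def)
    then have "k i = m * a' i * x i" using x(1)[of i] by (simp add: field_simps)
    then show ?thesis using diag_groupD(4)[OF A ma(2), of i] by simp
  qed
  ultimately show thesis using that la(1) ma(1) by simp
qed

lemma word_coeff_scale: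
  "word_coeff (\<lambda>l i. s l * D l i) T w i = prod_list (map s w) * word_coeff D T w i"
  by (induction w arbitrary: i) simp_all

text \<open>The relations $s^{11} = w_2^2 = (s^3 w_2)^5 = 1$ of $M_{11}$ force any scalars multiplying the
  generators to lie in $A$.\<close>
lemma remove_scalars:
  assumes G: "lifts_M11 G" and x: "\<And>i. x i \<noteq> 0"
    and base: "\<And>y. mon y (\<lambda>i. i) \<in> base_group x \<Longrightarrow> y \<in> diag_part G"
    and lm: "l \<noteq> 0" "m \<noteq> 0" "mon (\<lambda>_. l) sigma11 \<in> G" "mon (\<lambda>i. m * x i) tau11 \<in> G"
  shows "mon (\<lambda>_. 1) sigma11 \<in> G" "mon x tau11 \<in> G"
proof -
  define A where "A = diag_part G"
  have mg: "mat_group G" using G by (simp add: lifts_M11_def)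
  have A: "diag_group A" unfolding A_def by (rule lifts_M11_diag_part(1)[OF G])
  define s where "s j = (if j = 0 then l else m)" for j :: nat
  define Z where "Z = {c. (\<lambda>_::11. c) \<in> A}"
  \<comment> \<open>A word for the identity gives an element of \<open>A\<close> with and without
    the scalars; their quotient is the scalar product of the word.\<close>
  have rel: "prod_list (map s w) \<in> Z" if w: "word_perm gen_letter w = (\<lambda>i. i)" for w
  proof -
    have mem: "mon (\<lambda>i. s j * gen_coeff x j i) (gen_letter j) \<in> G" for j
      using lm by (simp add: s_def gen_coeff_def gen_letter_def)
    have "mon (word_coeff (\<lambda>j i. s j * gen_coeff x j i) gen_letter w) (\<lambda>i. i) \<in> G"
      by (rule back_subst[of "\<lambda>t. mon _ t \<in> G", OF word_in_group[OF mg] w]) (rule mem)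
    then have 1: "(\<lambda>i. prod_list (map s w) * word_coeff (gen_coeff x) gen_letter w i) \<in> A"
      by (simp add: A_def diag_part_def word_coeff_scale[abs_def])
    have 2: "word_coeff (gen_coeff x) gen_letter w \<in> A"
      unfolding A_def by (rule base) (use word_in_base_group[where x = x and w = w, OF x] w in simp)
    have "(\<lambda>i. prod_list (map s w) * word_coeff (gen_coeff x) gen_letter w i / word_coeff (gen_coeff x) gen_letter w i) \<in> A"
      by (rule diag_groupD(5)[OF A 1 2])
    then show ?thesis using diag_groupD(4)[OF A 2] by (simp add: Z_def)
  qed
  have Zm: "c * d \<in> Z" if "c \<in> Z" "d \<in> Z" for c d using diag_groupD(2)[OF A] that by (simp add: Z_def)
  have Zd: "c / d \<in> Z" if "c \<in> Z" "d \<in> Z" for c d using diag_groupD(5)[OF A] that by (simp add: Z_def)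
  have Zp: "c ^ n \<in> Z" if "c \<in> Z" for c n using diag_group_power[OF A, of "\<lambda>_. c"] that by (simp add: Z_def)
  have "prod_list (map s [0,0,0,0,0,0,0,0,0,0,0]) \<in> Z"
    by (rule rel) (unfold fun_eq_iff all_11, simp add: gen_letter_def)
  then have l11: "l ^ 11 \<in> Z" by (simp add: s_def eval_nat_numeral mult_ac)
  have "prod_list (map s [1,1]) \<in> Z"
    by (rule rel) (unfold fun_eq_iff all_11, simp add: gen_letter_def)
  then have m2: "m ^ 2 \<in> Z" by (simp add: s_def power2_eq_square)
  have "prod_list (map s [0,0,0,1,0,0,0,1,0,0,0,1,0,0,0,1,0,0,0,1]) \<in> Z"
    by (rule rel) (unfold fun_eq_iff all_11, simp add: gen_letter_def)
  then have lm5: "l ^ 15 * m ^ 5 \<in> Z" by (simp add: s_def eval_nat_numeral mult_ac)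
  \<comment> \<open>The relations give $l^{11}$ and $l^{30}$ up to known elements, and $121 - 120 =
    1$.\<close>
  have "l = (l ^ 11) ^ 11 / ((l ^ 15 * m ^ 5) ^ 2 / (m ^ 2) ^ 5) ^ 4"
  proof -
    have "(l ^ 15 * m ^ 5) ^ 2 / (m ^ 2) ^ 5 = l ^ 30"
      using lm(2) by (simp add: power_mult_distrib power_mult[symmetric])
    moreover have "(l ^ 11) ^ 11 = l * (l ^ 30) ^ 4"
      by (simp add: power_mult[symmetric] power_Suc[symmetric] del: power_Suc)
    ultimately show ?thesis using lm(1) by simp
  qed
  then have l: "l \<in> Z" using Zd[OF Zp[OF l11, of 11] Zp[OF Zd[OF Zp[OF lm5, of 2] Zp[OF m2, of 5]], of 4]] by simp
  have "m = (l ^ 15 * m ^ 5) / (l ^ 15 * (m ^ 2) ^ 2)"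
    using lm(1,2) by (simp add: power_mult[symmetric] eval_nat_numeral)
  then have m: "m \<in> Z" using Zd[OF lm5 Zm[OF Zp[OF l, of 15] Zp[OF m2, of 2]]] by simp
  have "mon (\<lambda>_. inverse l) (\<lambda>i. i) \<in> G" "mon (\<lambda>_. inverse m) (\<lambda>i. i) \<in> G"
    using diag_groupD(3)[OF A, of "\<lambda>_. l"] diag_groupD(3)[OF A, of "\<lambda>_. m"] l m
    by (simp_all add: Z_def A_def diag_part_def)
  from mon_mult_in[OF mg this(1) lm(3)] mon_mult_in[OF mg this(2) lm(4)]
  show "mon (\<lambda>_. 1) sigma11 \<in> G" "mon x tau11 \<in> G" using lm(1,2) by (simp_all add: mult.assoc[symmetric])
qed

lemma irreducible_conj:
  assumes irr: "irreducible_mat_group G" and g: "invertible g"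
  shows "irreducible_mat_group ((\<lambda>h. g ** h ** matrix_inv g) ` G)"
  unfolding irreducible_mat_group_def
proof (intro allI impI)
  fix W assume h: "csubspace W \<and> (\<forall>k\<in>(\<lambda>h. g ** h ** matrix_inv g) ` G. \<forall>v\<in>W. k *v v \<in> W)"
  then have W: "csubspace W" by blast
  define V where "V = {v. g *v v \<in> W}"
  have gi: "g *v (matrix_inv g *v v) = v" "matrix_inv g *v (g *v v) = v" for v
    by (simp_all add: matrix_vector_mul_assoc matrix_inv_invertible[OF g])
  have "csubspace V" unfolding csubspace_def V_def
    using csubspaceD[OF W] by (simp add: matrix_vector_right_distrib vector_scalar_commute)
  moreover have "k *v v \<in> V" if k: "k \<in> G" and v: "v \<in> V" for k v
  proof -
    have "(g ** k ** matrix_inv g) *v (g *v v) \<in> W" using h k v unfolding V_def by blast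
    then show ?thesis unfolding V_def by (simp add: matrix_vector_mul_assoc[symmetric] gi)
  qed
  ultimately have "V = {0} \<or> V = UNIV" using irr unfolding irreducible_mat_group_def by blast
  then show "W = {0} \<or> W = UNIV"
  proof
    assume V0: "V = {0}"
    have "w = 0" if w: "w \<in> W" for w
    proof -
      have "matrix_inv g *v w \<in> V" using w by (simp add: V_def gi)
      then have "matrix_inv g *v w = 0" using V0 by simp
      then show "w = 0" using gi(1)[of w] by simp
    qed
    then show ?thesis using csubspaceD(1)[OF W] by blast
  next
    assume V1: "V = UNIV"
    have "w \<in> W" for w
    proof -
      have "matrix_inv g *v w \<in> V" using V1 by simp
      then show ?thesis by (simp add: V_def gi)
    qed
    then show ?thesis by blast
  qed
qed

lemma two_power_odd:
  fixes N :: nat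
  assumes "N > 0" obtains n m where "N = 2 ^ n * m" "odd m"
proof -
  have "\<exists>n m. N = 2 ^ n * m \<and> odd m" using assms
  proof (induction N rule: less_induct)
    case (less N)
    show ?case
    proof (cases "odd N")
      case True
      then show ?thesis by (intro exI[of _ 0] exI[of _ N]) simp
    next
      case False
      then obtain K where K: "N = 2 * K" by blast
      then have "K < N" "K > 0" using less.prems by auto
      then obtain n m where "K = 2 ^ n * m" "odd m" using less.IH by blast
      then show ?thesis using K by (intro exI[of _ "Suc n"] exI[of _ m]) simp
    qed
  qed
  then show thesis using that by blast
qed

text \<open>Permutation matrices and scalars preserve the line of constant vectors. This is why the
  split family demands nonscalar \<open>A\<close>.\<close>

lemma not_irreducible_scalar_extension:
  assumes adm: "admissible (\<lambda>_. 1) A" and sc: "\<And>a i j. a \<in> A \<Longrightarrow> a i = a j"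
  shows "\<not> irreducible_mat_group (ext_group (\<lambda>_. 1) A)"
proof
  assume irr: "irreducible_mat_group (ext_group (\<lambda>_. 1) A)"
  define W where "W = {v :: complex^11. \<forall>i j. v $ i = v $ j}"
  have "csubspace W" unfolding csubspace_def W_def by (simp, metis)
  moreover have "g *v v \<in> W" if g: "g \<in> ext_group (\<lambda>_. 1) A" and v: "v \<in> W" for g v
  proof -
    obtain a y t where h: "g = mon (\<lambda>i. a i * y i) t" "a \<in> A" "mon y t \<in> base_group (\<lambda>_. 1)" "\<forall>i. y i \<noteq> 0" "t \<in> M11"
      by (rule ext_group_elems[OF adm g])
    have "y = (\<lambda>_. 1)" using base_group_one[OF h(3)] .
    moreover have "a i * v $ t i = a j * v $ t j" for i j
      using v sc[OF h(2), of i j] unfolding W_def by (metis (mono_tags) mem_Collect_eq)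
    ultimately show ?thesis unfolding W_def h(1) by (simp add: mon_mult_vec)
  qed
  ultimately have "W = {0} \<or> W = UNIV" using irr unfolding irreducible_mat_group_def by blast
  moreover have "(\<chi> i. 1) \<in> W" "(\<chi> i. 1) \<noteq> (0 :: complex^11)" by (simp_all add: W_def vec_eq_iff)
  moreover have "axis 0 1 \<notin> W"
  proof
    assume "axis 0 1 \<in> W"
    then have "\<forall>i j. (axis 0 1 :: complex^11) $ i = (axis 0 1 :: complex^11) $ j" unfolding W_def by simp
    from this[rule_format, of 0 1] have "(axis 0 1 :: complex^11) $ 0 = (axis 0 1 :: complex^11) $ 1" .
    then show False by (simp add: axis_def)
  qed
  ultimately show False by blast
qed

text \<open>The normal form is found for \<open>N\<close>-th powers, realised on the group by a
  diagonal conjugation, and completed by removing factors in \<open>A\<close> and scalars; then the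
  generators and the diagonal part identify the group.\<close>

lemma lifts_M11_conj_classified:
  assumes G: "lifts_M11 G" and fin: "finite G" and irr: "irreducible_mat_group G"
  shows "\<exists>x A. classified x A \<and> GL_conj G (ext_group x A)"
proof -
  define A where "A = diag_part G"
  have A: "diag_group A" and inv: "\<And>p a. p \<in> M11 \<Longrightarrow> a \<in> A \<Longrightarrow> (\<lambda>i. a (p i)) \<in> A"
    using lifts_M11_diag_part[OF G] by (simp_all add: A_def)
  have finA: "finite A"
  proof (rule finite_imageD)
    show "finite (diag_mats A)" by (rule finite_subset[OF _ fin]) (auto simp: A_def diag_part_def)
    show "inj_on (\<lambda>a. mon a (\<lambda>i. i)) A" by (simp add: inj_on_def mon_diag_eq_iff)
  qed
  obtain N where N: "N > 0"
    and X: "\<And>x. (\<forall>i. x i ^ N = 1) \<Longrightarrow> (\<Prod>i\<in>UNIV. x i) = 1 \<Longrightarrow> x \<in> A"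
    and pow: "\<And>a i j. a \<in> A \<Longrightarrow> a i ^ N = a j ^ N"
  proof (rule diag_group_exponent[OF A finA])
    show "(\<lambda>i. a (i + 1)) \<in> A" if "a \<in> A" for a using inv[OF M11_gens(1) that] by (simp add: sigma11_def)
    show "pair_vec 0 1 (a 0 / a 1) \<in> A" if "a \<in> A" for a
      by (rule pair_vec_in_M11_invariant[OF A _ that]) (rule inv)
  qed blast
  define K where "K = (\<lambda>d t. \<exists>g c. c \<noteq> 0 \<and> mon g t \<in> G \<and> (\<forall>i. d i = c * g i ^ N))"
  have K: "proj_rep K" unfolding K_def by (rule proj_rep_powers[OF G]) (rule pow[unfolded A_def])
  obtain b0 where b0: "\<And>i. b0 i \<noteq> 0" "K (\<lambda>i. b0 (sigma11 i) / b0 i) sigma11" "K (\<lambda>i. b0 (mu11 i) / b0 i) mu11"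
    by (rule proj_rep_normal_form[OF K]) blast
  have "\<exists>w\<in>{(\<lambda>_. 1), xvec 0}. K (\<lambda>i. w i * b0 (tau11 i) / b0 i) tau11"
    using proj_rep_dichotomy[OF proj_rep_conj[where b = b0, OF K b0(1)]] b0(2,3) by simp
  then obtain w where w: "w = (\<lambda>_. 1) \<or> w = xvec 0" "K (\<lambda>i. w i * b0 (tau11 i) / b0 i) tau11" by blast
  \<comment> \<open>Conjugating the group by an \<open>N\<close>-th root of \<open>b0\<close>
    conjugates the \<open>N\<close>-th powers by \<open>b0\<close> itself.\<close>
  have "\<forall>i. \<exists>r. b0 i = r ^ N" using exists_complex_root[of N] N by (metis neq0_conv)
  then obtain b where b: "\<And>i. b0 i = b i ^ N" by metis
  have bnz: "b i \<noteq> 0" for i using b[of i] b0(1)[of i] N by (auto simp: power_0_left)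
  define G' where "G' = (\<lambda>g. mon b (\<lambda>i. i) ** g ** matrix_inv (mon b (\<lambda>i. i))) ` G"
  note cj = conj_by_diag[where b = b, OF G bnz, folded G'_def]
  have A': "diag_part G' = A" using cj(2) by (simp add: A_def)
  have ib: "invertible (mon b (\<lambda>i. i))" by (rule invertible_mon[OF bnz bij_id[unfolded id_def]])
  have lift: "\<exists>g c. mon g t \<in> G' \<and> (\<forall>i. g i ^ N = c * v i)" if v: "K (\<lambda>i. v i * b0 (t i) / b0 i) t" for v t
  proof -
    obtain g c where g: "c \<noteq> 0" "mon g t \<in> G" "\<And>i. v i * b0 (t i) / b0 i = c * g i ^ N"
      using v unfolding K_def by blast
    define g' where "g' i = g i * b i / b (t i)" for i
    have "mon g' t \<in> G'" unfolding cj(3) using g(2) bnz by (simp add: g'_def)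
    moreover have "g' i ^ N = inverse c * v i" for i
    proof -
      have "g' i ^ N = g i ^ N * b0 i / b0 (t i)" by (simp add: g'_def power_mult_distrib power_divide b)
      also have "g i ^ N = inverse c * (v i * b0 (t i) / b0 i)" using g(1,3) by simp
      finally show ?thesis using b0(1) by simp
    qed
    ultimately show ?thesis by blast
  qed
  obtain h c1 where h: "mon h sigma11 \<in> G'" "\<And>i. h i ^ N = c1"
    using lift[of "\<lambda>_. 1" sigma11] b0(2) by auto
  obtain U c2 where U: "mon U mu11 \<in> G'" "\<And>i. U i ^ N = c2"
    using lift[of "\<lambda>_. 1" mu11] b0(3) by auto
  obtain k c3 where k: "mon k tau11 \<in> G'" "\<And>i. k i ^ N = c3 * w i" using lift[OF w(2)] by blast
  obtain n m where nm: "N = 2 ^ n * m" "odd m" by (rule two_power_odd[OF N])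
  have twoN: "z ^ N = 1" if "z ^ (2 ^ n) = 1" for z :: complex using that by (simp add: nm(1) power_mult)
  \<comment> \<open>An \<open>N\<close>-th root of \<open>w\<close> with product one: the odd factor
    \<open>m\<close> does not affect signs, so \<open>xvec n\<close> serves for
    \<open>xvec 0\<close>.\<close>
  define x where "x = (if w = (\<lambda>_. 1) then (\<lambda>_. 1) else xvec n)"
  have x0: "\<And>i. x i \<noteq> 0" by (simp add: x_def xvec_nonzero)
  have xN: "x i ^ N = w i" for i
  proof (cases "w = (\<lambda>_. 1)")
    case False
    then have "w = xvec 0" using w(1) by blast
    moreover have "xvec n i ^ N = xvec 0 i ^ m" by (simp add: nm(1) power_mult xvec_power)
    moreover have "xvec 0 i ^ m = xvec 0 i" using nm(2) by (simp add: xvec_def eps_1)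
    ultimately show ?thesis using False by (simp add: x_def)
  qed (simp add: x_def)
  have px: "(\<Prod>i\<in>UNIV. x i) = 1" by (simp add: x_def prod_xvec)
  have w0: "w 0 * w (tau11 0) = 1" using w(1) by (auto simp: xvec_def eps_1)
  have base: "y \<in> A" if "mon y (\<lambda>i. i) \<in> base_group x" for y
  proof (cases "w = (\<lambda>_. 1)")
    case True
    then have "mon y (\<lambda>i. i) \<in> base_group (\<lambda>_. 1)" using that by (simp add: x_def)
    then have "y = (\<lambda>_. 1)" by (rule base_group_one)
    then show ?thesis using diag_groupD(1)[OF A] by simp
  next
    case False
    then have "mon y (\<lambda>i. i) \<in> base_group (xvec n)" using that by (simp add: x_def)
    from xvec_diag[OF this] show ?thesis using X twoN by blast
  qed
  obtain l p where lp: "l \<noteq> 0" "p \<noteq> 0" "mon (\<lambda>_. l) sigma11 \<in> G'" "mon (\<lambda>i. p * x i) tau11 \<in> G'"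
  proof (rule scalar_normal_form[OF cj(1) N _ _ h U k(1) _ x0 px])
    show "\<And>x. \<forall>i. x i ^ N = 1 \<Longrightarrow> prod x UNIV = 1 \<Longrightarrow> x \<in> diag_part G'" unfolding A' by (rule X)
    show "\<And>a i j. a \<in> diag_part G' \<Longrightarrow> a i ^ N = a j ^ N" unfolding A' by (rule pow)
    show "\<And>i. k i ^ N = c3 * x i ^ N" by (simp add: xN k(2))
    show "x 0 ^ N * x (tau11 0) ^ N = 1" unfolding xN by (rule w0)
  qed blast
  note gens = remove_scalars[where x = x, OF cj(1) x0 base[folded A'] lp]
  have adm: "admissible x A" unfolding admissible_def using x0 A inv base by blast
  have eq: "G' = ext_group x A"
  proof (rule eq_ext_groupI[OF adm])
    show "mat_group G'" using cj(1) by (simp add: lifts_M11_def)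
    show "\<And>g. g \<in> G' \<Longrightarrow> \<exists>d t. g = mon d t \<and> (\<forall>i. d i \<noteq> 0) \<and> t \<in> M11" using cj(1) by (simp add: lifts_M11_def)
    show "\<And>d. mon d (\<lambda>i. i) \<in> G' \<longleftrightarrow> d \<in> A" unfolding A'[symmetric] diag_part_def by simp
    show "mon (\<lambda>_. 1) sigma11 \<in> G'" by (rule gens(1))
    show "mon x tau11 \<in> G'" by (rule gens(2))
  qed
  have conj: "GL_conj G (ext_group x A)" unfolding GL_conj_def eq[symmetric] G'_def using ib by blast
  have "(\<lambda>i. a (q i)) \<in> A" if q: "bij q" and a: "a \<in> A" for q a
  proof -
    have a0: "\<And>i. a i \<noteq> 0" using diag_groupD(4)[OF A a] .
    \<comment> \<open>Entries of \<open>a\<close> differ by \<open>N\<close>-th roots of unity and a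
      permutation keeps their product, so the quotient lies in $X[N]$.\<close>
    have "(\<lambda>i. a (q i) / a i) \<in> A"
    proof (rule X)
      show "\<forall>i. (a (q i) / a i) ^ N = 1" using pow[OF a] a0 by (simp add: power_divide)
      show "(\<Prod>i\<in>UNIV. a (q i) / a i) = 1" using a0 by (simp add: prod_dividef prod_bij[OF q] prod_zero_iff)
    qed
    from diag_groupD(2)[OF A a this] show ?thesis using a0 by simp
  qed
  then have sym: "sym_diag A" using A finA by (simp add: sym_diag_def)
  have "classified x A"
  proof (cases "w = (\<lambda>_. 1)")
    case True
    then have x1: "x = (\<lambda>_. 1)" by (simp add: x_def)
    have "irreducible_mat_group (ext_group x A)"
      unfolding eq[symmetric] G'_def by (rule irreducible_conj[OF irr ib])
    \<comment> \<open>Irreducibility enters here, to exclude the split group over scalars.\<close>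
    then have "\<exists>a\<in>A. \<exists>i j. a i \<noteq> a j" using not_irreducible_scalar_extension adm unfolding x1 by blast
    then show ?thesis using sym x1 by (simp add: classified_def)
  next
    case False
    have "two_part n A" unfolding two_part_def
    proof (intro allI iffI)
      fix a :: "11 \<Rightarrow> complex" assume h: "a \<in> A \<and> (\<Prod>i\<in>UNIV. a i) = 1 \<and> (\<exists>k. \<forall>i. a i ^ 2 ^ k = 1)"
      then obtain k where k: "\<forall>i. a i ^ 2 ^ k = 1" by blast
      \<comment> \<open>Product one gives $z^{11}=1$, and \<open>z\<close> also has 2-power order,
        so it is 1. Thus the order of every entry of \<open>a\<close> divides both
        \<open>2 ^ k\<close> and \<open>N\<close>, hence \<open>2 ^ n\<close>.\<close>
      define z where "z = a 0 ^ N"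
      have az: "a i ^ N = z" for i using pow h by (simp add: z_def)
      have "(\<Prod>i\<in>UNIV. a i) ^ N = z ^ 11" by (simp add: prod_power_distrib az)
      then have z11: "z ^ 11 = 1" using h by simp
      have z2: "z ^ (2 ^ k) = 1" using k by (metis z_def power_mult mult.commute power_one)
      have "\<not> 11 dvd (2::nat) ^ k" using prime_dvd_power[OF prime_11, of 2 k] by auto
      then have "gcd (2 ^ k) (11::nat) = 1" by (intro gcd_11) (simp add: dvd_eq_mod_eq_0)
      then have "z = 1" using power_gcd_eq_1[OF z2 z11] by simp
      have "a i ^ (2 ^ n) = 1" for i
      proof -
        have "a i ^ gcd (2 ^ k) N = 1" using k az \<open>z = 1\<close> by (intro power_gcd_eq_1) auto
        moreover have "gcd (2 ^ k) N dvd 2 ^ n"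
        proof -
          have "coprime (gcd (2 ^ k) N) m"
            by (rule coprime_divisors[of _ "2 ^ k" _ m]) (use nm(2) in auto)
          moreover have "gcd (2 ^ k) N dvd 2 ^ n * m" unfolding nm(1)[symmetric] by simp
          ultimately show ?thesis by (simp add: coprime_dvd_mult_left_iff)
        qed
        ultimately show ?thesis by (metis dvdE power_mult power_one)
      qed
      then show "(\<forall>i. a i ^ 2 ^ n = 1) \<and> (\<Prod>i\<in>UNIV. a i) = 1" using h by blast
    next
      fix a :: "11 \<Rightarrow> complex" assume h: "(\<forall>i. a i ^ 2 ^ n = 1) \<and> (\<Prod>i\<in>UNIV. a i) = 1"
      then have "a \<in> A" using X twoN by blast
      then show "a \<in> A \<and> (\<Prod>i\<in>UNIV. a i) = 1 \<and> (\<exists>k. \<forall>i. a i ^ 2 ^ k = 1)" using h by blast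
    qed
    then show ?thesis using sym False by (auto simp: classified_def x_def)
  qed
  with conj show ?thesis by blast
qed

lemma GL_conj_trans:
  assumes "GL_conj G H" "GL_conj H K" shows "GL_conj G K"
proof -
  obtain g where g: "invertible g" "H = (\<lambda>h. g ** h ** matrix_inv g) ` G" using assms(1) unfolding GL_conj_def by blast
  obtain k where k: "invertible k" "K = (\<lambda>h. k ** h ** matrix_inv k) ` H" using assms(2) unfolding GL_conj_def by blast
  have i: "matrix_inv (k ** g) = matrix_inv g ** matrix_inv k"
  proof (rule matrix_inv_unique_right)
    have "(k ** g) ** (matrix_inv g ** matrix_inv k) = k ** ((g ** matrix_inv g) ** matrix_inv k)"
      by (simp only: matrix_mul_assoc)
    then show "(k ** g) ** (matrix_inv g ** matrix_inv k) = mat 1"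
      by (simp add: matrix_inv_invertible[OF g(1)] matrix_inv_invertible[OF k(1)])
  qed
  have "K = (\<lambda>h. (k ** g) ** h ** matrix_inv (k ** g)) ` G"
    unfolding k(2) g(2) image_image i by (simp only: matrix_mul_assoc)
  then show ?thesis using invertible_mult[OF k(1) g(1)] unfolding GL_conj_def by blast
qed

text \<open>The permutation part is only isomorphic to \<open>M11\<close> at first;
  \<open>perm_group_iso_M11\<close> supplies a permutation matrix that makes it equal.\<close>

lemma target_group_conj_lifts_M11:
  assumes "target_group G"
  obtains G' where "GL_conj G G'" "lifts_M11 G'" "finite G'" "irreducible_mat_group G'"
proof -
  have mg: "mat_group G" and mono: "\<And>g. g \<in> G \<Longrightarrow> monomial g" and fin: "finite G"
    and irr: "irreducible_mat_group G" and iso: "perm_group_iso (perm_part G) M11"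
    using assms unfolding target_group_def by auto
  have elem: "\<exists>d. (\<forall>i. d i \<noteq> 0) \<and> mon d p \<in> G \<and> bij p" if p: "p \<in> perm_part G" for p
  proof -
    obtain g where g: "g \<in> G" "p = perm_of g" using p unfolding perm_part_def by blast
    obtain d t where "g = mon d t" "\<And>i. d i \<noteq> 0" "bij t" using monomialE[OF mono[OF g(1)]] by blast
    then show ?thesis using g perm_of_mon[of d t] by auto
  qed
  have part: "t \<in> perm_part G" if "mon d t \<in> G" "\<And>i. d i \<noteq> 0" for d t
    unfolding perm_part_def using that perm_of_mon[of d t] by (metis image_eqI)
  obtain \<pi> where \<pi>: "bij \<pi>" "perm_part G = (\<lambda>x i. \<pi> (x (inv \<pi> i))) ` M11"
  proof (rule perm_group_iso_M11[OF iso])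
    show "\<And>p. p \<in> perm_part G \<Longrightarrow> bij p" using elem by blast
    fix p q assume pq: "p \<in> perm_part G" "q \<in> perm_part G"
    obtain d where d: "\<forall>i. d i \<noteq> 0" "mon d p \<in> G" using elem[OF pq(1)] by blast
    obtain e where e: "\<forall>i. e i \<noteq> 0" "mon e q \<in> G" using elem[OF pq(2)] by blast
    show "(\<lambda>i. p (q i)) \<in> perm_part G" by (rule part[OF mon_mult_in[OF mg e(2) d(2)]]) (use d e in simp)
  qed blast
  define Q where "Q = mon (\<lambda>_. 1) \<pi>"
  have iQ: "invertible Q" unfolding Q_def by (rule invertible_mon[OF _ \<pi>(1)]) simp
  have invQ: "matrix_inv Q = mon (\<lambda>_. 1) (inv \<pi>)"
    unfolding Q_def using matrix_inv_mon[of "\<lambda>_. 1" \<pi>] \<pi>(1) by simp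
  have im: "Q ** mon d t ** matrix_inv Q = mon (\<lambda>i. d (\<pi> i)) (\<lambda>i. inv \<pi> (t (\<pi> i)))" for d t
    unfolding invQ unfolding Q_def mon_mult by simp
  define G' where "G' = (\<lambda>h. Q ** h ** matrix_inv Q) ` G"
  have "lifts_M11 G'" unfolding lifts_M11_def
  proof (intro conjI ballI)
    show "mat_group G'" unfolding G'_def by (rule mat_group_conj[OF mg iQ])
  next
    fix x assume "x \<in> G'"
    then obtain g where g: "g \<in> G" "x = Q ** g ** matrix_inv Q" unfolding G'_def by blast
    obtain d t where dt: "g = mon d t" "\<And>i. d i \<noteq> 0" using monomialE[OF mono[OF g(1)]] by blast
    have "t \<in> perm_part G" using part[of d t] g(1) dt by simp
    then obtain y where y: "y \<in> M11" "t = (\<lambda>i. \<pi> (y (inv \<pi> i)))" using \<pi>(2) by blast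
    have "x = mon (\<lambda>i. d (\<pi> i)) y" unfolding g(2) dt(1) im y(2) using \<pi>(1) by simp
    then show "\<exists>d t. x = mon d t \<and> (\<forall>i. d i \<noteq> 0) \<and> t \<in> M11"
      by (intro exI[of _ "\<lambda>i. d (\<pi> i)"] exI[of _ y]) (simp add: dt(2) y(1))
  next
    fix y assume y: "y \<in> M11"
    then have "(\<lambda>i. \<pi> (y (inv \<pi> i))) \<in> perm_part G" using \<pi>(2) by blast
    then obtain d where d: "\<forall>i. d i \<noteq> 0" "mon d (\<lambda>i. \<pi> (y (inv \<pi> i))) \<in> G" using elem[of "\<lambda>i. \<pi> (y (inv \<pi> i))"] by blast
    have "Q ** mon d (\<lambda>i. \<pi> (y (inv \<pi> i))) ** matrix_inv Q = mon (\<lambda>i. d (\<pi> i)) y" unfolding im using \<pi>(1) by simp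
    then have "mon (\<lambda>i. d (\<pi> i)) y \<in> G'"
      using imageI[OF d(2), of "\<lambda>h. Q ** h ** matrix_inv Q"] by (simp add: G'_def)
    then show "\<exists>d. (\<forall>i. d i \<noteq> 0) \<and> mon d y \<in> G'" by (intro exI[of _ "\<lambda>i. d (\<pi> i)"]) (simp add: d(1))
  qed
  moreover have "GL_conj G G'" unfolding GL_conj_def G'_def using iQ by blast
  moreover have "finite G'" unfolding G'_def using fin by simp
  moreover have "irreducible_mat_group G'" unfolding G'_def by (rule irreducible_conj[OF irr iQ])
  ultimately show thesis using that by blast
qed

theorem theorem9p25:
  shows "(\<forall>G\<in>Qstar. target_group G)
       \<and> (\<forall>G. target_group G \<longrightarrow> (\<exists>H\<in>Qstar. GL_conj G H))
       \<and> (\<forall>G\<in>Qstar. \<forall>H\<in>Qstar. G \<noteq> H \<longrightarrow> \<not> GL_conj G H)"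
proof (intro conjI allI ballI impI)
  fix G assume "G \<in> Qstar"
  then show "target_group G" using target_ext_group unfolding Qstar_iff by blast
next
  fix G assume "target_group G"
  then obtain G' where G': "GL_conj G G'" "lifts_M11 G'" "finite G'" "irreducible_mat_group G'"
    by (rule target_group_conj_lifts_M11)
  obtain x A where "classified x A" "GL_conj G' (ext_group x A)"
    using lifts_M11_conj_classified[OF G'(2-4)] by blast
  then show "\<exists>H\<in>Qstar. GL_conj G H" unfolding Bex_def Qstar_iff using GL_conj_trans[OF G'(1)] by blast
next
  fix G H assume "G \<in> Qstar" "H \<in> Qstar" "G \<noteq> H"
  then show "\<not> GL_conj G H" using classified_conj_eq unfolding Qstar_iff by blast
qed

end
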